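(* Let $X$ be an infinite dimensional complex Banach space and let $T\in L(X)$. Then the following inclusions hold: $$\partial\sigma_{gD}(T)\subset\partial\sigma_{gD\mathcal{M}}(T)\subset\partial\sigma_{gD\mathcal{W}_+}(T)\subset\partial\sigma_{gD\Phi_+}(T)\subset\partial\sigma_{gK}(T),$$ $$\partial\sigma_{gD}(T)\subset\partial\sigma_{gD\mathcal{W}}(T)\subset\partial\sigma_{gD\Phi}(T)\subset\partial\sigma_{gK}(T),$$ $$\partial\sigma_{gD}(T)\subset\partial\sigma_{gD\mathcal{Q}}(T)\subset\partial\sigma_{gD\mathcal{W}_-}(T)\subset\partial\sigma_{gD\Phi_-}(T)\subset\partial\sigma_{gK}(T),$$ $$\partial\sigma_{gD\Phi}(T)\subset\partial\sigma_{gD\Phi_+}(T),\quad \partial\sigma_{gD\Phi}(T)\subset\partial\sigma_{gD\Phi_-}(T),$$ $$\partial\sigma_{gD\mathcal{W}}(T)\subset\partial\sigma_{gD\mathcal{W}_+}(T),\quad \partial\sigma_{gD\mathcal{W}}(T)\subset\partial\sigma_{gD\mathcal{W}_-}(T),$$ and $$\eta\sigma_{gK}(T)=\eta\sigma_{gD\Phi_+}(T)=\eta\sigma_{gD\mathcal{W}_+}(T)=\eta\sigma_{gD\mathcal{M}}(T)=\eta\sigma_{gD\Phi_-}(T)=\eta\sigma_{gD\mathcal{W}_-}(T)$$ $$=\eta\sigma_{gD\mathcal{Q}}(T)=\eta\sigma_{gD\Phi}(T)=\eta\sigma_{gD\mathcal{W}}(T)=\eta\sigma_{gD}(T).$$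
   Context: $\partial K$ is the boundary of $K\subset\mathbb{C}$. For compact $K\subset\mathbb{C}$, the connected hull $\eta K$ is the complement of the unbounded component of $\mathbb{C}\setminus K$. (All spectra below are compact, possibly empty, subsets of $\mathbb{C}$.) $L(Y)$ is the algebra of bounded linear operators on a Banach space $Y$; $T-\lambda$ means $T-\lambda I$. For a Banach space $Y$ (finite dimensional or zero spaces allowed) and $S\in L(Y)$, $N(S)$ and $R(S)$ are kernel and range, $\alpha(S)=\dim N(S)$, $\beta(S)=\operatorname{codim}R(S)$. Classes of operators on $Y$: $\Phi_+(Y)$: $R(S)$ closed and $\alpha(S)<\infty$; $\Phi_-(Y)$: $\beta(S)<\infty$; $\Phi(Y)$: $\alpha(S),\beta(S)<\infty$; for semi-Fredholm $S$, $\operatorname{ind}(S)=\alpha(S)-\beta(S)$; $\mathcal{W}_+(Y)=\{S\in\Phi_+(Y):\operatorname{ind}(S)\le0\}$; $\mathcal{W}_-(Y)=\{S\in\Phi_-(Y):\operatorname{ind}(S)\ge0\}$; $\mathcal{W}(Y)=\{S\in\Phi(Y):\operatorname{ind}(S)=0\}$; $\mathcal{M}(Y)$: bounded below operators ($c\|x\|\le\|Sx\|$ for some $c>0$ and all $x$); $\mathcal{Q}(Y)$: surjective operators. $(M,N)\in Red(S)$ for $S\in L(X)$ means that $M,N$ are closed $S$-invariant subspaces of $X$ with $X=M\oplus N$; $S_M\in L(M)$, $S_N\in L(N)$ are the restrictions. An operator is quasinilpotent if $\|S^n\|^{1/n}\to0$. For $\mathbf{R}\in\{\Phi_+,\Phi_-,\Phi,\mathcal{W}_+,\mathcal{W}_-,\mathcal{W},\mathcal{M},\mathcal{Q}\}$,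 $\sigma_{gD\mathbf{R}}(T)$ is the set of $\lambda\in\mathbb{C}$ for which there is no $(M,N)\in Red(T-\lambda)$ with $(T-\lambda)_M\in\mathbf{R}(M)$ and $(T-\lambda)_N$ quasinilpotent. $S\in L(X)$ is generalized Drazin invertible if there is $B\in L(X)$ with $SB=BS$, $BSB=B$ and $SBS-S$ quasinilpotent (equivalently, there is $(M,N)\in Red(S)$ with $S_M$ invertible and $S_N$ quasinilpotent); $\sigma_{gD}(T)$ is the set of $\lambda\in\mathbb{C}$ such that $T-\lambda$ is not generalized Drazin invertible. $S\in L(Y)$ is Kato if $R(S)$ is closed and $N(S)\subset R(S^n)$ for all $n\ge 0$; $S\in L(X)$ admits a generalized Kato decomposition (GKD) if there is $(M,N)\in Red(S)$ with $S_M$ Kato and $S_N$ quasinilpotent; $\sigma_{gK}(T)=\{\lambda\in\mathbb{C}:T-\lambda\text{ does not admit a GKD}\}$. *)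

theory Defs
  imports "HOL-Analysis.Analysis"
begin

class complex_banach = banach +
  fixes scaleC :: "complex \<Rightarrow> 'a \<Rightarrow> 'a" (infixr "*\<^sub>C" 75)
  assumes scaleC_add_right: "a *\<^sub>C (x + y) = a *\<^sub>C x + a *\<^sub>C y"
    and scaleC_add_left: "(a + b) *\<^sub>C x = a *\<^sub>C x + b *\<^sub>C x"
    and scaleC_scaleC: "a *\<^sub>C b *\<^sub>C x = (a * b) *\<^sub>C x"
    and scaleC_of_real: "complex_of_real r *\<^sub>C x = r *\<^sub>R x"
    and norm_scaleC: "norm (a *\<^sub>C x) = cmod a * norm x"

lemma scaleC_one: "1 *\<^sub>C x = (x :: 'a::complex_banach)"
  using scaleC_of_real[of 1 x] by simp

global_interpretation complex_vector: vector_space "scaleC :: complex \<Rightarrow> 'a \<Rightarrow> 'a::complex_banach"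
  defines csubspace = complex_vector.subspace
    and cspan = complex_vector.span
    and cdim = complex_vector.dim
  by unfold_locales (simp_all add: scaleC_add_right scaleC_add_left scaleC_scaleC scaleC_one)

definition bounded_clinear :: "('a::complex_banach \<Rightarrow> 'a) \<Rightarrow> bool"
  where "bounded_clinear T \<longleftrightarrow> bounded_linear T \<and> (\<forall>c x. T (c *\<^sub>C x) = c *\<^sub>C T x)"

definition cfinite_dim :: "'a::complex_banach set \<Rightarrow> bool"
  where "cfinite_dim V \<longleftrightarrow> (\<exists>B. finite B \<and> V \<subseteq> cspan B)"

text \<open>The constant \<open>cdim\<close> is \<open>0\<close> on infinite dimensional spaces, hence the case distinction.\<close>

definition edim :: "'a::complex_banach set \<Rightarrow> enat"
  where "edim V = (if cfinite_dim V then enat (cdim V) else \<infinity>)"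

definition alg_complement :: "'a::complex_banach set \<Rightarrow> 'a set \<Rightarrow> 'a set \<Rightarrow> bool"
  where "alg_complement Y R C \<longleftrightarrow> csubspace C \<and> R \<inter> C = {0} \<and> {r + c | r c. r \<in> R \<and> c \<in> C} = Y"

text \<open>The codimension of a subspace \<open>R\<close> of \<open>Y\<close>, i.e. the dimension of \<open>Y/R\<close>, read off
  from an algebraic complement; see \<open>ecodim_eq\<close> for independence of the choice.\<close>

definition ecodim :: "'a::complex_banach set \<Rightarrow> 'a set \<Rightarrow> enat"
  where "ecodim Y R = edim (SOME C. alg_complement Y R C)"

lemma edim_complement_le:
  assumes R: "csubspace R" and C: "alg_complement Y R C" and D: "alg_complement Y R D"
  shows "edim C \<le> edim D"
proof (cases "cfinite_dim D")
  case True
  obtain B where B: "B \<subseteq> D" "complex_vector.independent B" "D \<subseteq> cspan B" "card B = cdim D"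
    using complex_vector.basis_exists[of D] by blast
  obtain F where F: "finite F" "D \<subseteq> cspan F"
    using True unfolding cfinite_dim_def by blast
  have finB: "finite B"
    using complex_vector.independent_span_bound[OF F(1) B(2) order_trans[OF B(1) F(2)]] by simp
  have sC: "csubspace C" and sD: "csubspace D"
    using C D unfolding alg_complement_def by auto
  have "\<exists>c\<in>C. b - c \<in> R" if "b \<in> B" for b
  proof -
    have "0 \<in> R" by (rule complex_vector.subspace_0[OF R])
    then have "0 + b \<in> Y" using that B(1) D unfolding alg_complement_def by blast
    then have "b \<in> {r + c | r c. r \<in> R \<and> c \<in> C}"
      using C unfolding alg_complement_def by simp
    then obtain r c where "b = r + c" "r \<in> R" "c \<in> C"
      by blast
    then have "c \<in> C" "b - c \<in> R" by simp_all
    then show ?thesis by blast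
  qed
  then obtain f where f: "\<And>b. b \<in> B \<Longrightarrow> f b \<in> C" "\<And>b. b \<in> B \<Longrightarrow> b - f b \<in> R"
    by metis
  have CB: "C \<subseteq> cspan (f ` B)"
  proof
    fix c assume c: "c \<in> C"
    have "0 \<in> R" by (rule complex_vector.subspace_0[OF R])
    then have "0 + c \<in> Y" using c C unfolding alg_complement_def by blast
    then have "c \<in> {r + c | r c. r \<in> R \<and> c \<in> D}"
      using D unfolding alg_complement_def by simp
    then obtain r d where rd: "c = r + d" "r \<in> R" "d \<in> D"
      by blast
    then have "d \<in> cspan B" using B(3) by blast
    then obtain u where u: "d = (\<Sum>b\<in>B. u b *\<^sub>C b)"
      unfolding complex_vector.span_finite[OF finB] by (rule rangeE)
    let ?e = "\<Sum>b\<in>B. u b *\<^sub>C f b"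
    have eC: "?e \<in> C"
      by (intro complex_vector.subspace_sum[OF sC] complex_vector.subspace_scale[OF sC] f)
    have "d - ?e = (\<Sum>b\<in>B. u b *\<^sub>C (b - f b))"
      unfolding u by (simp add: complex_vector.scale_right_diff_distrib sum_subtractf)
    also have "\<dots> \<in> R"
      by (intro complex_vector.subspace_sum[OF R] complex_vector.subspace_scale[OF R] f)
    finally have "r + (d - ?e) \<in> R"
      by (rule complex_vector.subspace_add[OF R rd(2)])
    then have "c - ?e \<in> R" by (simp add: rd(1) add_diff_eq)
    moreover have "c - ?e \<in> C" by (rule complex_vector.subspace_diff[OF sC c eC])
    ultimately have "c - ?e \<in> R \<inter> C" by (rule IntI)
    then have "c = ?e" using C unfolding alg_complement_def by simp
    moreover have "?e \<in> cspan (f ` B)"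
      by (intro complex_vector.span_sum complex_vector.span_scale complex_vector.span_base) auto
    ultimately show "c \<in> cspan (f ` B)" by simp
  qed
  have "cdim C \<le> card (f ` B)"
    by (rule complex_vector.dim_le_card[OF CB finite_imageI[OF finB]])
  also have "\<dots> \<le> cdim D" using card_image_le[OF finB, of f] B(4) by simp
  finally have "cdim C \<le> cdim D" .
  moreover have "cfinite_dim C" unfolding cfinite_dim_def
    by (intro exI[of _ "f ` B"] conjI finite_imageI finB CB)
  ultimately show ?thesis using True by (simp add: edim_def)
qed (simp add: edim_def)

lemma ecodim_eq:
  assumes "csubspace R" "alg_complement Y R C"
  shows "ecodim Y R = edim C"
proof -
  have "alg_complement Y R (SOME C. alg_complement Y R C)"
    using assms(2) by (rule someI)
  from edim_complement_le[OF assms(1) this assms(2)] edim_complement_le[OF assms(1,2) this]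
  show ?thesis unfolding ecodim_def by (rule order_antisym)
qed

text \<open>A closed subspace \<open>Y\<close> of \<open>X\<close> is a set, and an operator on \<open>Y\<close> is an operator \<open>S\<close> on \<open>X\<close>
  with \<open>S ` Y \<subseteq> Y\<close>, of which only the restriction to \<open>Y\<close> matters: the classes below describe
  when \<open>S\<^sub>Y\<close> belongs to \<open>\<Phi>\<^sub>+(Y)\<close> etc. As \<open>Y\<close> is closed in \<open>X\<close>, a subset of \<open>Y\<close> is closed in \<open>Y\<close>
  iff it is closed in \<open>X\<close>.\<close>

type_synonym 'a op_class = "'a set \<Rightarrow> ('a \<Rightarrow> 'a) \<Rightarrow> bool"

definition nullity :: "'a::complex_banach set \<Rightarrow> ('a \<Rightarrow> 'a) \<Rightarrow> enat"
  where "nullity Y S = edim {x \<in> Y. S x = 0}"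

definition defect :: "'a::complex_banach set \<Rightarrow> ('a \<Rightarrow> 'a) \<Rightarrow> enat"
  where "defect Y S = ecodim Y (S ` Y)"

text \<open>For semi-Fredholm operators nullity and defect are not both infinite, so the
  difference is a genuine element of the integers extended by \<open>\<plusminus>\<infinity>\<close>.\<close>

definition ind :: "'a::complex_banach set \<Rightarrow> ('a \<Rightarrow> 'a) \<Rightarrow> ereal"
  where "ind Y S = ereal_of_enat (nullity Y S) - ereal_of_enat (defect Y S)"

definition upper_semi_Fredholm :: "'a::complex_banach op_class"
  where "upper_semi_Fredholm Y S \<longleftrightarrow> closed (S ` Y) \<and> nullity Y S < \<infinity>"

definition lower_semi_Fredholm :: "'a::complex_banach op_class"
  where "lower_semi_Fredholm Y S \<longleftrightarrow> defect Y S < \<infinity>"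

definition Fredholm :: "'a::complex_banach op_class"
  where "Fredholm Y S \<longleftrightarrow> nullity Y S < \<infinity> \<and> defect Y S < \<infinity>"

definition upper_semi_Weyl :: "'a::complex_banach op_class"
  where "upper_semi_Weyl Y S \<longleftrightarrow> upper_semi_Fredholm Y S \<and> ind Y S \<le> 0"

definition lower_semi_Weyl :: "'a::complex_banach op_class"
  where "lower_semi_Weyl Y S \<longleftrightarrow> lower_semi_Fredholm Y S \<and> ind Y S \<ge> 0"

definition Weyl :: "'a::complex_banach op_class"
  where "Weyl Y S \<longleftrightarrow> Fredholm Y S \<and> ind Y S = 0"

definition bounded_below :: "'a::complex_banach op_class"
  where "bounded_below Y S \<longleftrightarrow> (\<exists>c>0. \<forall>x\<in>Y. c * norm x \<le> norm (S x))"

definition surjective :: "'a::complex_banach op_class"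
  where "surjective Y S \<longleftrightarrow> S ` Y = Y"

definition Kato :: "'a::complex_banach op_class"
  where "Kato Y S \<longleftrightarrow> closed (S ` Y) \<and> (\<forall>n. {x \<in> Y. S x = 0} \<subseteq> (S ^^ n) ` Y)"

text \<open>The operator norm in \<open>L(Y)\<close>; \<open>onorm_on UNIV\<close> is \<open>onorm\<close>.\<close>

definition onorm_on :: "'a::complex_banach set \<Rightarrow> ('a \<Rightarrow> 'a) \<Rightarrow> real"
  where "onorm_on Y S = (SUP x\<in>Y. norm (S x) / norm x)"

definition quasinilpotent :: "'a::complex_banach op_class"
  where "quasinilpotent Y S \<longleftrightarrow> (\<lambda>n. root n (onorm_on Y (S ^^ n))) \<longlonglongrightarrow> 0"

definition Red :: "('a::complex_banach \<Rightarrow> 'a) \<Rightarrow> ('a set \<times> 'a set) set"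
  where "Red S = {(M, N). csubspace M \<and> closed M \<and> S ` M \<subseteq> M \<and>
    csubspace N \<and> closed N \<and> S ` N \<subseteq> N \<and>
    M \<inter> N = {0} \<and> {x + y | x y. x \<in> M \<and> y \<in> N} = UNIV}"

definition shift :: "('a::complex_banach \<Rightarrow> 'a) \<Rightarrow> complex \<Rightarrow> 'a \<Rightarrow> 'a"
  where "shift T \<mu> = (\<lambda>x. T x - \<mu> *\<^sub>C x)"

definition \<sigma>_gDR :: "'a::complex_banach op_class \<Rightarrow> ('a \<Rightarrow> 'a) \<Rightarrow> complex set"
  where "\<sigma>_gDR R T = {\<mu>. \<not> (\<exists>(M, N) \<in> Red (shift T \<mu>).
    R M (shift T \<mu>) \<and> quasinilpotent N (shift T \<mu>))}"

definition gen_Drazin_invertible :: "('a::complex_banach \<Rightarrow> 'a) \<Rightarrow> bool"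
  where "gen_Drazin_invertible S \<longleftrightarrow> (\<exists>B. bounded_clinear B \<and> S \<circ> B = B \<circ> S \<and>
    B \<circ> S \<circ> B = B \<and> quasinilpotent UNIV (\<lambda>x. S (B (S x)) - S x))"

definition \<sigma>_gD :: "('a::complex_banach \<Rightarrow> 'a) \<Rightarrow> complex set"
  where "\<sigma>_gD T = {\<mu>. \<not> gen_Drazin_invertible (shift T \<mu>)}"

definition admits_GKD :: "('a::complex_banach \<Rightarrow> 'a) \<Rightarrow> bool"
  where "admits_GKD S \<longleftrightarrow> (\<exists>(M, N) \<in> Red S. Kato M S \<and> quasinilpotent N S)"

definition \<sigma>_gK :: "('a::complex_banach \<Rightarrow> 'a) \<Rightarrow> complex set"
  where "\<sigma>_gK T = {\<mu>. \<not> admits_GKD (shift T \<mu>)}"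

text \<open>The set \<open>outside K\<close> is the union of the unbounded components of \<open>- K\<close>; for compact \<open>K\<close>
  there is exactly one.\<close>

definition connected_hull :: "complex set \<Rightarrow> complex set" ("\<eta>")
  where "\<eta> K = - outside K"

lemma connected_hull_eq:
  assumes "compact K" "C \<in> components (- K)" "\<not> bounded C"
  shows "\<eta> K = - C"
proof -
  have b: "bounded (- (- K))" using assms(1) by (simp add: compact_imp_bounded)
  have "outside K = C"
  proof (intro set_eqI iffI)
    fix x assume "x \<in> outside K"
    then have x: "x \<in> - K" "\<not> bounded (connected_component_set (- K) x)"
      by (auto simp: outside_def)
    have "connected_component_set (- K) x = C"
      using cobounded_unique_unbounded_components[OF b assms(2,3) componentsI[OF x(1)] x(2)]
      by simp
    moreover have "x \<in> connected_component_set (- K) x"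
      using x(1) by (simp add: connected_component_refl)
    ultimately show "x \<in> C" by simp
  next
    fix x assume x: "x \<in> C"
    obtain y where y: "C = connected_component_set (- K) y"
      using assms(2) by (rule componentsE)
    then have "C = connected_component_set (- K) x"
      using connected_component_eq[of x "- K" y] x by simp
    moreover have "x \<in> - K"
      using in_components_subset[OF assms(2)] x by (rule subsetD)
    ultimately show "x \<in> outside K"
      using assms(3) by (simp add: outside_def)
  qed
  then show ?thesis by (simp add: connected_hull_def)
qed

end

theory Submission
  imports Defs
begin

text \<open>All spectra of the theorem are instances of one family: \<open>\<lambda>\<close> is outside the spectrum of a set \<open>C\<close> of
  pairs iff \<open>T - \<lambda>\<close> has a generalized Kato decomposition \<open>(M, N)\<close> for which nullity and defect of the
  Kato part form a pair in \<open>C\<close>. For the semi-Fredholm classes this rests on Kato's decomposition: as long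
  as a semi-Fredholm operator is not Kato, a Jordan chain can be split off, which lowers nullity and
  defect by one and hence preserves the index, and the chain is absorbed into the quasinilpotent part.
  A Kato operator stays Kato with the same nullity and defect under small multiples of the identity, and
  a quasinilpotent operator becomes invertible, so a decomposition of \<open>T - \<lambda>\<close> forces \<open>T - \<mu>\<close> to be Kato on
  the whole space with the same pair for all \<open>\<mu> \<noteq> \<lambda>\<close> near \<open>\<lambda>\<close>. Hence \<open>\<lambda>\<close> is interior either to the spectrum
  of \<open>C\<close> or to its complement, i.e. the frontier of every spectrum in the family lies in \<open>\<sigma>\<^sub>g\<^sub>K\<close>, the smallest
  one. The inclusions of frontiers follow from the inclusions of the spectra, and so do the equalities of
  the connected hulls.\<close>

section \<open>Open mapping\<close>

text \<open>The summands of a decomposition are sets and not types, so every analytic fact is proved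
  relative to a closed subspace, and quotients are avoided: distance to a subspace replaces the
  quotient norm, and codimension is tested by finite families independent modulo the range. The pair
  of nullity and defect is followed, rather than the index alone, because
  \<open>bounded_below\<close> and \<open>surjective\<close> ask for a zero entry. The delicate
  point is lower semicontinuity of the pair, which fails for general semi-Fredholm operators and
  holds for Kato ones: the intersection of all ranges of powers contains the kernel, is mapped onto
  itself, and modulo it the operator is bounded below. Infinite entries are controlled by working on
  a whole disc instead of at its centre. Two decompositions with nearby centres are compared at a
  common point off both centres, where each determines the same nullity and defect; this makes the
  negative condition, a pair outside \<open>C\<close>, stable as well.\<close>

text \<open>The residual halves in each step, so the corrections are dominated by a geometric series
  of sum 2, whence the factor 2. \<open>W\<close> only has to contain the residuals; it need not be
  closed or a subspace. The open mapping theorem and the later Neumann type arguments are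
  instances.\<close>

lemma successive_approximation:
  fixes T :: "'b::banach \<Rightarrow> 'c::real_normed_vector"
  assumes T: "bounded_linear T" and V: "subspace V" "closed V" and c: "c \<ge> 0"
    and step: "\<And>y. y \<in> W \<Longrightarrow> \<exists>x\<in>V. norm x \<le> c * norm y \<and> norm (y - T x) \<le> norm y / 2 \<and> y - T x \<in> W"
    and y: "y \<in> W"
  shows "\<exists>x\<in>V. T x = y \<and> norm x \<le> 2 * c * norm y"
proof -
  interpret T: bounded_linear T by fact
  obtain g where g: "\<And>y. y \<in> W \<Longrightarrow> g y \<in> V \<and> norm (g y) \<le> c * norm y \<and>
      norm (y - T (g y)) \<le> norm y / 2 \<and> y - T (g y) \<in> W"
    using step by metis
  define r where "r = rec_nat y (\<lambda>_ z. z - T (g z))"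
  have r0: "r 0 = y" and rS: "r (Suc n) = r n - T (g (r n))" for n
    by (simp_all add: r_def)
  have rW: "r n \<in> W" for n
    by (induction n) (use y g in \<open>auto simp: r0 rS\<close>)
  have rn: "norm (r n) \<le> norm y * (1/2)^n" for n
  proof (induction n)
    case (Suc n)
    have "norm (r (Suc n)) \<le> norm (r n) / 2" using g[OF rW[of n]] by (simp add: rS)
    then show ?case using Suc by simp
  qed (simp add: r0)
  have gn: "norm (g (r n)) \<le> c * norm y * (1/2)^n" for n
    using g[OF rW[of n]] mult_left_mono[OF rn[of n] c] by (simp add: mult.assoc)
  have sm: "summable (\<lambda>n. c * norm y * (1/2::real)^n)"
    by (intro summable_mult summable_geometric) simp
  have smn: "summable (\<lambda>n. norm (g (r n)))"
    by (rule summable_comparison_test'[OF sm, of 0]) (use gn in simp)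
  then have smg: "summable (\<lambda>n. g (r n))" by (rule summable_norm_cancel)
  define x where "x = (\<Sum>n. g (r n))"
  have part: "T (\<Sum>k<n. g (r k)) = y - r n" for n
    by (induction n) (simp_all add: r0 rS T.add)
  have "(\<lambda>n. T (\<Sum>k<n. g (r k))) \<longlonglongrightarrow> T x"
    unfolding x_def by (intro T.tendsto summable_LIMSEQ smg)
  moreover have "(\<lambda>n. y - r n) \<longlonglongrightarrow> y - 0"
  proof (intro tendsto_intros)
    have "(\<lambda>n. norm y * (1/2::real)^n) \<longlonglongrightarrow> norm y * 0"
      by (intro tendsto_intros LIMSEQ_power_zero) simp
    then show "r \<longlonglongrightarrow> 0"
      by (intro Lim_null_comparison[of r "\<lambda>n. norm y * (1/2::real)^n"]) (use rn in auto)
  qed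
  ultimately have "T x = y" unfolding part using LIMSEQ_unique by fastforce
  moreover have "x \<in> V"
  proof -
    have "(\<lambda>n. \<Sum>k<n. g (r k)) \<longlonglongrightarrow> x"
      unfolding x_def by (rule summable_LIMSEQ[OF smg])
    moreover have "(\<Sum>k<n. g (r k)) \<in> V" for n
      by (intro subspace_sum V) (use g rW in auto)
    ultimately show ?thesis using closed_sequentially[OF V(2), of "\<lambda>n. \<Sum>k<n. g (r k)"] by blast
  qed
  moreover have "norm x \<le> 2 * c * norm y"
  proof -
    have "norm x \<le> (\<Sum>n. norm (g (r n)))" unfolding x_def by (rule summable_norm[OF smn])
    also have "\<dots> \<le> (\<Sum>n. c * norm y * (1/2::real)^n)"
      by (intro suminf_le gn smn sm)
    also have "\<dots> = 2 * c * norm y"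
      by (subst suminf_mult) (simp_all add: suminf_geometric summable_geometric)
    finally show ?thesis .
  qed
  ultimately show ?thesis by blast
qed

lemma subspace_closure:
  fixes V :: "'b::real_normed_vector set"
  assumes "subspace V"
  shows "subspace (closure V)"
  unfolding subspace_def
proof (intro conjI ballI allI)
  show "0 \<in> closure V" using closure_subset subspace_0[OF assms] by blast
next
  fix x y assume "x \<in> closure V" "y \<in> closure V"
  then obtain f g where "\<And>n. f n \<in> V" "f \<longlonglongrightarrow> x" "\<And>n. g n \<in> V" "g \<longlonglongrightarrow> y"
    by (meson closure_sequential)
  then have "\<And>n. f n + g n \<in> V" "(\<lambda>n. f n + g n) \<longlonglongrightarrow> x + y"
    by (auto intro: subspace_add[OF assms] tendsto_add)
  then show "x + y \<in> closure V" by (meson closure_sequential)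
next
  fix c x assume "x \<in> closure V"
  then obtain f where "\<And>n. f n \<in> V" "f \<longlonglongrightarrow> x" by (meson closure_sequential)
  then have "\<And>n. c *\<^sub>R f n \<in> V" "(\<lambda>n. c *\<^sub>R f n) \<longlonglongrightarrow> c *\<^sub>R x"
    by (auto intro: subspace_scale[OF assms] tendsto_scaleR)
  then show "c *\<^sub>R x \<in> closure V" by (meson closure_sequential)
qed

text \<open>A converse of the open mapping estimate. The closure of the image serves as the set of
  residuals: a point \<open>y\<close> of it is approximated by some \<open>y'\<close> in the image
  with \<open>norm y' \<le> 2 * norm y\<close>, which explains the constant
  \<open>2 * \<bar>K\<bar>\<close>.\<close>

lemma closed_image_if_bounded_preimages:
  fixes T :: "'b::banach \<Rightarrow> 'c::real_normed_vector"
  assumes T: "bounded_linear T" and V: "subspace V" "closed V"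
    and K: "\<And>x. x \<in> V \<Longrightarrow> \<exists>z\<in>V. T z = T x \<and> norm z \<le> K * norm (T x)"
  shows "closed (T ` V)"
proof -
  interpret T: bounded_linear T by fact
  let ?W = "closure (T ` V)"
  have W: "subspace ?W"
    by (rule subspace_closure[OF linear_subspace_image[OF T.linear_axioms V(1)]])
  have "\<exists>x\<in>V. norm x \<le> (2 * \<bar>K\<bar>) * norm y \<and> norm (y - T x) \<le> norm y / 2 \<and> y - T x \<in> ?W"
    if y: "y \<in> ?W" for y
  proof (cases "y = 0")
    case True
    then show ?thesis using subspace_0[OF V(1)] subspace_0[OF W] by (intro bexI[of _ 0]) (auto simp: T.zero)
  next
    case False
    then have "norm y / 2 > 0" by simp
    then obtain y' where y': "y' \<in> T ` V" "dist y' y < norm y / 2"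
      using y closure_approachable by blast
    then obtain z where z: "z \<in> V" "T z = y'" "norm z \<le> K * norm y'"
      using K by blast
    have n: "norm y' \<le> 2 * norm y" using y'(2) norm_triangle_ineq2[of y' y] norm_ge_zero[of y]
      unfolding dist_norm by linarith
    have "norm z \<le> \<bar>K\<bar> * norm y'"
      using z(3) by (meson abs_ge_self mult_right_mono norm_ge_zero order_trans)
    also have "\<dots> \<le> \<bar>K\<bar> * (2 * norm y)" by (intro mult_left_mono n) simp
    finally have "norm z \<le> (2 * \<bar>K\<bar>) * norm y" by simp
    moreover have "y - y' \<in> ?W"
      using y y'(1) closure_subset[of "T ` V"] by (intro subspace_diff[OF W]) auto
    ultimately show ?thesis using z y'(2) by (intro bexI[of _ z]) (auto simp: dist_norm norm_minus_commute)
  qed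
  from successive_approximation[OF T V _ this] have "?W \<subseteq> T ` V" by fastforce
  then show ?thesis using closure_subset[of "T ` V"] closure_eq by blast
qed

text \<open>The image of \<open>V\<close> is closed, hence a Baire space in its own right, so the
  closure of the image of some ball in \<open>V\<close> contains a relatively open set. Differences
  of approximations recentre this set at the origin.\<close>

theorem open_mapping:
  fixes T :: "'b::banach \<Rightarrow> 'c::banach"
  assumes T: "bounded_linear T" and V: "subspace V" "closed V" and cl: "closed (T ` V)"
  obtains K where "K > 0" "\<And>y. y \<in> T ` V \<Longrightarrow> \<exists>x\<in>V. T x = y \<and> norm x \<le> K * norm y"
proof -
  interpret T: bounded_linear T by fact
  let ?W = "T ` V"
  have W: "subspace ?W" by (rule linear_subspace_image[OF T.linear_axioms V(1)])
  let ?B = "\<lambda>n. T ` (V \<inter> cball 0 (real n))"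
  define \<G> where "\<G> = range (\<lambda>n. closure (?B n))"
  have sub: "closure (?B n) \<subseteq> ?W" for n
    by (rule closure_minimal[OF _ cl]) auto
  have un: "\<Union>\<G> = ?W"
  proof
    show "?W \<subseteq> \<Union>\<G>"
    proof
      fix y assume "y \<in> ?W"
      then obtain x where x: "x \<in> V" "y = T x" by blast
      obtain n where "norm x \<le> real n" using real_arch_simple by blast
      then have "y \<in> closure (?B n)" using x closure_subset[of "?B n"] by auto
      then show "y \<in> \<Union>\<G>" by (auto simp: \<G>_def)
    qed
  qed (use sub in \<open>auto simp: \<G>_def\<close>)
  have "completely_metrizable_space (top_of_set ?W)"
    by (intro completely_metrizable_space_closedin completely_metrizable_space_euclidean) (use cl in auto)
  moreover have "(top_of_set ?W) interior_of \<Union>\<G> \<noteq> {}"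
  proof -
    have "(top_of_set ?W) interior_of ?W = ?W" using interior_of_topspace[of "top_of_set ?W"] by simp
    then show ?thesis unfolding un using subspace_0[OF W] by auto
  qed
  moreover have "countable \<G>" by (simp add: \<G>_def)
  moreover have "closedin (top_of_set ?W) G" if "G \<in> \<G>" for G
    using that sub by (auto simp: \<G>_def intro: closed_subset)
  ultimately have "\<exists>G\<in>\<G>. (top_of_set ?W) interior_of G \<noteq> {}"
    using Baire_category_alt[of "top_of_set ?W" \<G>] by blast
  then obtain n y0 where y0: "y0 \<in> (top_of_set ?W) interior_of (closure (?B n))"
    unfolding \<G>_def by auto
  define I where "I = (top_of_set ?W) interior_of (closure (?B n))"
  have Isub: "I \<subseteq> closure (?B n)" unfolding I_def by (rule interior_of_subset)
  have "openin (top_of_set ?W) I" unfolding I_def by simp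
  then have "\<exists>r>0. ball y0 r \<inter> ?W \<subseteq> I"
    unfolding openin_contains_ball using y0[folded I_def] by blast
  then obtain r where r: "r > 0" "ball y0 r \<inter> ?W \<subseteq> I" by blast
  have rsub: "ball y0 r \<inter> ?W \<subseteq> closure (?B n)"
    using r(2) Isub by (rule order_trans)
  have y0W: "y0 \<in> ?W" and y0c: "y0 \<in> closure (?B n)"
    using subsetD[OF Isub y0[folded I_def]] sub[of n] by auto
  \<comment> \<open>A vector \<open>y\<close> is rescaled by \<open>t = r / (2 * norm y)\<close>
    into the ball of radius \<open>r\<close>, where approximate preimages of norm at most
    \<open>2 * real n\<close> exist; undoing the scaling gives \<open>c\<close>.\<close>
  define c where "c = 2 * real n * 2 / r"
  have c0: "c \<ge> 0" using r(1) by (simp add: c_def)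
  \<comment> \<open>Both \<open>y0 + y\<close> and \<open>y0\<close> are approximated by images of
    vectors of norm at most \<open>n\<close>; subtracting removes the unknown centre and doubles the
    bound.\<close>
  have small: "\<exists>x\<in>V. norm x \<le> 2 * real n \<and> norm (y - T x) < e"
    if y: "y \<in> ?W" "norm y < r" and e: "e > 0" for y e
  proof -
    have "y0 + y \<in> ?W" by (rule subspace_add[OF W y0W y(1)])
    moreover have "y0 + y \<in> ball y0 r" using y(2) by (simp add: dist_norm)
    ultimately have "y0 + y \<in> closure (?B n)" using rsub by blast
    then obtain u where u: "u \<in> ?B n" "dist u (y0 + y) < e/2"
      using e closure_approachable by (metis half_gt_zero)
    obtain v where v: "v \<in> ?B n" "dist v y0 < e/2"
      using e y0c closure_approachable by (metis half_gt_zero)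
    obtain a b where ab: "a \<in> V" "norm a \<le> n" "u = T a" "b \<in> V" "norm b \<le> n" "v = T b"
      using u v by auto
    have *: "y - T (a - b) = (v - y0) - (u - (y0 + y))" by (simp add: T.diff ab)
    have "norm (y - T (a - b)) < e"
      using u(2) v(2) norm_triangle_ineq4[of "v - y0" "u - (y0 + y)"] unfolding * dist_norm by linarith
    moreover have "norm (a - b) \<le> 2 * real n" using norm_triangle_ineq4[of a b] ab by simp
    ultimately show ?thesis using subspace_diff[OF V(1) ab(1,4)] by blast
  qed
  have "\<exists>x\<in>V. norm x \<le> c * norm y \<and> norm (y - T x) \<le> norm y / 2 \<and> y - T x \<in> ?W"
    if y: "y \<in> ?W" for y
  proof (cases "y = 0")
    case True
    then show ?thesis using subspace_0[OF V(1)] subspace_0[OF W] by (intro bexI[of _ 0]) (auto simp: T.zero)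
  next
    case False
    define t where "t = r / (2 * norm y)"
    have t: "t > 0" using r(1) False by (simp add: t_def)
    have ty: "t *\<^sub>R y \<in> ?W" by (rule subspace_scale[OF W y])
    have "norm (t *\<^sub>R y) < r" using r(1) False by (simp add: t_def)
    then obtain x where x: "x \<in> V" "norm x \<le> 2 * real n" "norm (t *\<^sub>R y - T x) < r / 4"
      using small[OF ty, of "r/4"] r(1) by auto
    let ?x = "(1/t) *\<^sub>R x"
    have xV: "?x \<in> V" by (rule subspace_scale[OF V(1) x(1)])
    have "norm ?x = norm x / t" using t by simp
    also have "\<dots> \<le> 2 * real n / t" using x(2) t by (intro divide_right_mono) auto
    also have "\<dots> = c * norm y" using False r(1) by (simp add: t_def c_def)
    finally have 1: "norm ?x \<le> c * norm y" .
    have "y - T ?x = (1/t) *\<^sub>R (t *\<^sub>R y - T x)" using t by (simp add: T.scaleR algebra_simps)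
    then have "norm (y - T ?x) = norm (t *\<^sub>R y - T x) / t" using t by simp
    also have "\<dots> \<le> (r/4) / t" using x(3) t by (intro divide_right_mono) auto
    also have "\<dots> = norm y / 2" using r(1) False by (simp add: t_def)
    finally have 2: "norm (y - T ?x) \<le> norm y / 2" .
    show ?thesis using xV 1 2 subspace_diff[OF W y imageI[OF xV]] by blast
  qed
  from successive_approximation[OF T V c0 this]
  have *: "\<exists>x\<in>V. T x = y \<and> norm x \<le> 2 * c * norm y" if "y \<in> ?W" for y using that by blast
  \<comment> \<open>The summand 1 keeps the constant positive even when \<open>n = 0\<close>, and
    thus \<open>c = 0\<close>.\<close>
  have **: "2 * c * a \<le> (2 * c + 1) * a" if "a \<ge> 0" for a using that by (simp add: algebra_simps)
  show ?thesis
  proof (rule that[of "2 * c + 1"])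
    show "2 * c + 1 > 0" using c0 by simp
    show "\<exists>x\<in>V. T x = y \<and> norm x \<le> (2 * c + 1) * norm y" if "y \<in> ?W" for y
      using *[OF that] **[OF norm_ge_zero[of y]] by (meson order_trans)
  qed
qed

section \<open>Hahn--Banach\<close>

definition sublinear :: "('b::real_vector \<Rightarrow> real) \<Rightarrow> bool"
  where "sublinear p \<longleftrightarrow> (\<forall>x y. p (x + y) \<le> p x + p y) \<and> (\<forall>t x. t \<ge> 0 \<longrightarrow> p (t *\<^sub>R x) = t * p x)"

lemma sublinear_0: "sublinear p \<Longrightarrow> p 0 = 0"
  unfolding sublinear_def by (metis mult_zero_left order_refl scale_zero_right)

lemma sublinear_lower: "sublinear p \<Longrightarrow> - p (- x) \<le> p x"
  using sublinear_0[of p] unfolding sublinear_def by (metis add.right_inverse minus_le_iff add_le_cancel_left)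

text \<open>The device that lowers a sublinear functional which is not yet linear: at
  \<open>- y\<close> the new value is at most \<open>- q y\<close>. For a minimal \<open>q\<close>
  the third estimate becomes superadditivity.\<close>

lemma sublinear_along:
  fixes q :: "'b::real_vector \<Rightarrow> real"
  assumes q: "sublinear q"
  defines "q' \<equiv> \<lambda>y x. INF t\<in>{0..}. q (x + t *\<^sub>R y) - t * q y"
  shows "sublinear (q' y)" "q' y x \<le> q x" "q' y x \<le> q (x + y) - q y"
proof -
  have add: "q (a + b) \<le> q a + q b" for a b using q by (simp add: sublinear_def)
  have sc: "t \<ge> 0 \<Longrightarrow> q (t *\<^sub>R a) = t * q a" for a t using q by (simp add: sublinear_def)
  have q'_eq: "q' y x = (INF t\<in>{0..}. q (x + t *\<^sub>R y) - t * q y)" for x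
    by (simp add: q'_def)
  \<comment> \<open>A bound independent of \<open>t\<close>, so that the infimum is finite.\<close>
  have low: "- q (- x) \<le> q (x + t *\<^sub>R y) - t * q y" if "t \<ge> 0" for x t
    using add[of "x + t *\<^sub>R y" "- x"] sc[OF that] by simp
  have bdd: "bdd_below ((\<lambda>t. q (x + t *\<^sub>R y) - t * q y) ` {0..})" for x
    by (rule bdd_belowI[of _ "- q (- x)"]) (use low in auto)
  have le: "q' y x \<le> q (x + t *\<^sub>R y) - t * q y" if "t \<ge> 0" for x t
    unfolding q'_eq by (rule cINF_lower[OF bdd]) (use that in simp)
  show "q' y x \<le> q x" using le[of 0 x] by simp
  show "q' y x \<le> q (x + y) - q y" using le[of 1 x] by simp
  show "sublinear (q' y)"
    unfolding sublinear_def
  proof (intro conjI allI impI)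
    fix a b
    have 1: "q' y (a + b) \<le> (q (a + s *\<^sub>R y) - s * q y) + (q (b + t *\<^sub>R y) - t * q y)"
      if "s \<ge> 0" "t \<ge> 0" for s t
    proof -
      have "q' y (a + b) \<le> q ((a + b) + (s + t) *\<^sub>R y) - (s + t) * q y"
        by (rule le) (use that in simp)
      moreover have "(a + b) + (s + t) *\<^sub>R y = (a + s *\<^sub>R y) + (b + t *\<^sub>R y)" by (simp add: algebra_simps)
      ultimately show ?thesis using add[of "a + s *\<^sub>R y" "b + t *\<^sub>R y"] by (simp add: algebra_simps)
    qed
    have "q' y (a + b) - (q (a + s *\<^sub>R y) - s * q y) \<le> q' y b" if "s \<ge> 0" for s
      unfolding q'_eq[of b] by (rule cINF_greatest) (use 1[OF that] in \<open>auto simp: algebra_simps\<close>)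
    then have "q' y (a + b) - q' y b \<le> q' y a"
      unfolding q'_eq[of a] by (intro cINF_greatest) (auto simp: algebra_simps)
    then show "q' y (a + b) \<le> q' y a + q' y b" by simp
  next
    have half: "q' y (t *\<^sub>R a) \<le> t * q' y a" if t: "t > 0" for t a
    proof -
      have "q' y (t *\<^sub>R a) / t \<le> q (a + s *\<^sub>R y) - s * q y" if "s \<ge> 0" for s
      proof -
        have "q' y (t *\<^sub>R a) \<le> q (t *\<^sub>R a + (t * s) *\<^sub>R y) - (t * s) * q y"
          by (rule le) (use that t in simp)
        also have "t *\<^sub>R a + (t * s) *\<^sub>R y = t *\<^sub>R (a + s *\<^sub>R y)" by (simp add: algebra_simps)
        also have "q \<dots> - (t * s) * q y = t * (q (a + s *\<^sub>R y) - s * q y)"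
          using t by (simp add: sc right_diff_distrib)
        finally show ?thesis using t by (simp add: field_simps)
      qed
      then have "q' y (t *\<^sub>R a) / t \<le> q' y a" unfolding q'_eq[of a] by (intro cINF_greatest) auto
      then show ?thesis using t by (simp add: field_simps)
    qed
    have zero: "q' y 0 = 0"
    proof (rule antisym)
      show "q' y 0 \<le> 0" using le[of 0 0] sublinear_0[OF q] by simp
      show "0 \<le> q' y 0" unfolding q'_eq by (rule cINF_greatest) (auto simp: sc)
    qed
    fix t :: real and a assume "t \<ge> 0"
    show "q' y (t *\<^sub>R a) = t * q' y a"
    proof (cases "t = 0")
      case False
      then have t: "t > 0" using \<open>t \<ge> 0\<close> by simp
      have "q' y ((1/t) *\<^sub>R (t *\<^sub>R a)) \<le> (1/t) * q' y (t *\<^sub>R a)" by (rule half) (use t in simp)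
      then have "t * q' y a \<le> q' y (t *\<^sub>R a)" using t by (simp add: field_simps)
      with half[OF t] show ?thesis by (intro antisym)
    qed (simp add: zero)
  qed
qed

text \<open>Zorn's lemma for the reversed order. A chain is bounded by its pointwise infimum, which
  is finite because every member lies above \<open>- p (- x)\<close> at \<open>x\<close>.\<close>

lemma minimal_sublinear_exists:
  fixes p :: "'b::real_vector \<Rightarrow> real"
  assumes p: "sublinear p"
  obtains q where "sublinear q" "q \<le> p" "\<And>q'. sublinear q' \<Longrightarrow> q' \<le> q \<Longrightarrow> q' = q"
proof -
  define A where "A = {q. sublinear q \<and> q \<le> p}"
  define P where "P = (\<lambda>q q' :: 'b \<Rightarrow> real. q' \<le> q)"
  have "\<exists>m\<in>A. \<forall>a\<in>A. P m a \<longrightarrow> a = m"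
  proof (rule predicate_Zorn)
    show "partial_order_on A (relation_of P A)"
      by (rule partial_order_on_relation_ofI) (auto simp: P_def)
    fix C assume C: "C \<in> Chains (relation_of P A)"
    have CA: "q \<in> A" if "q \<in> C" for q
      using C that unfolding Chains_def relation_of_def by auto
    have tot: "q \<le> q' \<or> q' \<le> q" if "q \<in> C" "q' \<in> C" for q q'
      using C that unfolding Chains_def relation_of_def P_def by auto
    show "\<exists>u\<in>A. \<forall>a\<in>C. P a u"
    proof (cases "C = {}")
      case True
      then show ?thesis using p by (intro bexI[of _ p]) (auto simp: A_def)
    next
      case False
      define u where "u = (\<lambda>x. INF q\<in>C. q x)"
      have low: "- p (- x) \<le> q x" if "q \<in> C" for q x
        using CA[OF that] sublinear_lower[of q x] by (auto simp: A_def le_fun_def intro: order_trans[rotated])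
      have bdd: "bdd_below ((\<lambda>q. q x) ` C)" for x
        by (rule bdd_belowI[of _ "- p (- x)"]) (use low in auto)
      have le: "u x \<le> q x" if "q \<in> C" for q x
        unfolding u_def by (rule cINF_lower[OF bdd that])
      have "sublinear u" unfolding sublinear_def
      proof (intro conjI allI impI)
        fix x y
        \<comment> \<open>Members of a chain are comparable; the smaller one, \<open>h\<close>, can
          be used at both points at once.\<close>
        have 1: "u (x + y) \<le> q x + q' y" if qC: "q \<in> C" "q' \<in> C" for q q'
        proof -
          obtain h where h: "h \<in> C" "h \<le> q" "h \<le> q'"
            using tot[OF qC] qC by (metis order_refl)
          have "u (x + y) \<le> h x + h y"
            using le[OF h(1), of "x + y"] CA[OF h(1)] by (auto simp: A_def sublinear_def intro: order_trans)
          then show ?thesis using le_funD[OF h(2), of x] le_funD[OF h(3), of y] by linarith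
        qed
        have "u (x + y) - q x \<le> u y" if "q \<in> C" for q
        proof -
          have "u (x + y) - q x \<le> (INF q'\<in>C. q' y)"
            by (rule cINF_greatest[OF False]) (use 1[OF that] in \<open>auto simp: algebra_simps\<close>)
          then show ?thesis by (simp add: u_def)
        qed
        then have "u (x + y) - u y \<le> q x" if "q \<in> C" for q using that by (force simp: algebra_simps)
        then have "u (x + y) - u y \<le> (INF q\<in>C. q x)"
          by (intro cINF_greatest[OF False]) 
        then show "u (x + y) \<le> u x + u y" by (simp add: u_def)
      next
        fix t :: real and x assume t: "t \<ge> 0"
        have sc: "q (t *\<^sub>R x) = t * q x" if "q \<in> C" for q
          using CA[OF that] t by (auto simp: A_def sublinear_def)
        have "u (t *\<^sub>R x) = (INF q\<in>C. t * q x)"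
          unfolding u_def by (rule INF_cong) (auto simp: sc)
        also have "\<dots> = t * u x"
        proof (cases "t = 0")
          case True
          then show ?thesis using False by simp
        next
          case nz: False
          then have t: "t > 0" using t by simp
          show ?thesis
          proof (rule antisym)
            have "(INF q\<in>C. t * q x) / t \<le> u x"
              unfolding u_def
            proof (rule cINF_greatest[OF False])
              fix q assume q: "q \<in> C"
              have "bdd_below ((\<lambda>q. t * q x) ` C)"
                by (rule bdd_belowI2[of _ "t * - p (- x)"]) (rule mult_left_mono[OF low], use t in auto)
              then have "(INF q\<in>C. t * q x) \<le> t * q x" by (rule cINF_lower[OF _ q])
              then show "(INF q\<in>C. t * q x) / t \<le> q x" using t by (simp add: field_simps)
            qed
            then show "(INF q\<in>C. t * q x) \<le> t * u x" using t by (simp add: field_simps)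
            show "t * u x \<le> (INF q\<in>C. t * q x)"
              by (rule cINF_greatest[OF False]) (use le t in \<open>auto intro: mult_left_mono\<close>)
          qed
        qed
        finally show "u (t *\<^sub>R x) = t * u x" .
      qed
      moreover have "u \<le> p"
      proof -
        obtain q where q: "q \<in> C" using False by blast
        show ?thesis using le[OF q] CA[OF q] by (auto simp: A_def le_fun_def intro: order_trans)
      qed
      ultimately show ?thesis using le by (intro bexI[of _ u]) (auto simp: A_def P_def le_fun_def)
    qed
  qed
  then obtain m where m: "m \<in> A" "\<And>a. a \<in> A \<Longrightarrow> a \<le> m \<Longrightarrow> a = m"
    unfolding P_def by blast
  show ?thesis
  proof (rule that[of m])
    show "q' = m" if "sublinear q'" "q' \<le> m" for q'
      using m(1) that order_trans[OF that(2), of p] by (intro m(2)) (auto simp: A_def)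
  qed (use m(1) in \<open>auto simp: A_def\<close>)
qed

text \<open>Minimal sublinear functionals are linear. Minimizing below \<open>p\<close> lowered
  along \<open>x0\<close>, rather than below \<open>p\<close> itself, forces the value at
  \<open>x0\<close>: the lowered functional is at most \<open>p 0 - p x0\<close> at
  \<open>- x0\<close>.\<close>

theorem Hahn_Banach_sublinear:
  fixes p :: "'b::real_vector \<Rightarrow> real"
  assumes p: "sublinear p"
  obtains f where "linear f" "\<And>x. f x \<le> p x" "f x0 = p x0"
proof -
  let ?p = "\<lambda>x. INF t\<in>{0..}. p (x + t *\<^sub>R x0) - t * p x0"
  note p' = sublinear_along[OF p, where y = x0]
  obtain q where q: "sublinear q" "q \<le> ?p" and min: "\<And>q'. sublinear q' \<Longrightarrow> q' \<le> q \<Longrightarrow> q' = q"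
    using minimal_sublinear_exists[OF p'(1)] by blast
  have add1: "q (x + y) \<le> q x + q y" for x y using q(1) by (simp add: sublinear_def)
  have add2: "q x + q y \<le> q (x + y)" for x y
  proof -
    note q' = sublinear_along[OF q(1), where y = y]
    have "(\<lambda>x. INF t\<in>{0..}. q (x + t *\<^sub>R y) - t * q y) = q"
      by (rule min[OF q'(1)]) (rule le_funI, rule q'(2))
    from fun_cong[OF this, of x] show ?thesis using q'(3)[of x] by linarith
  qed
  have add: "q (x + y) = q x + q y" for x y using add1[of x y] add2[of x y] by simp
  have minus: "q (- x) = - q x" for x using add[of x "- x"] sublinear_0[OF q(1)] by simp
  have sc: "q (t *\<^sub>R x) = t * q x" for t x
  proof (cases "t \<ge> 0")
    case True
    then show ?thesis using q(1) by (simp add: sublinear_def)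
  next
    case False
    then have "0 \<le> - t" by simp
    then have "q ((- t) *\<^sub>R x) = - t * q x" using q(1) unfolding sublinear_def by blast
    then show ?thesis using minus[of "t *\<^sub>R x"] by simp
  qed
  have "linear q" by (rule linearI) (simp_all add: add sc)
  moreover have le: "q x \<le> p x" for x using le_funD[OF q(2), of x] p'(2)[of x] by linarith
  moreover have "q x0 = p x0"
  proof (rule antisym[OF le])
    have "q (- x0) \<le> p (- x0 + x0) - p x0" using le_funD[OF q(2), of "- x0"] p'(3)[of "- x0"] by linarith
    then show "p x0 \<le> q x0" using sublinear_0[OF p] by (simp add: minus)
  qed
  ultimately show ?thesis using that by blast
qed

section \<open>Complex functionals and separation from closed subspaces\<close>

definition cfunctional :: "('a::complex_banach \<Rightarrow> complex) \<Rightarrow> bool"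
  where "cfunctional f \<longleftrightarrow> bounded_linear f \<and> (\<forall>c x. f (c *\<^sub>C x) = c * f x)"

lemma bounded_clinear_scaleC_functional:
  assumes "cfunctional f"
  shows "bounded_clinear (\<lambda>x. f x *\<^sub>C a)"
  unfolding bounded_clinear_def
proof
  interpret f: bounded_linear f using assms by (simp add: cfunctional_def)
  obtain K where "\<And>x. norm (f x) \<le> norm x * K" using f.bounded by blast
  then have "norm (f x *\<^sub>C a) \<le> norm x * (K * norm a)" for x
    by (metis mult_right_mono norm_ge_zero norm_scaleC mult.assoc)
  then show "bounded_linear (\<lambda>x. f x *\<^sub>C a)"
    by (rule bounded_linear_intro[rotated 2])
      (simp_all add: f.add f.scaleR scaleC_add_left scaleR_conv_of_real scaleC_of_real flip: scaleC_scaleC)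
  show "\<forall>c x. f (c *\<^sub>C x) *\<^sub>C a = c *\<^sub>C f x *\<^sub>C a"
    using assms by (simp add: cfunctional_def scaleC_scaleC)
qed

lemma csubspace_imp_subspace: "csubspace V \<Longrightarrow> subspace V"
  unfolding subspace_def complex_vector.subspace_def by (metis scaleC_of_real)

lemma infdist_almost_attained:
  fixes A :: "'b::metric_space set"
  assumes "A \<noteq> {}" "e > 0"
  shows "\<exists>a\<in>A. dist x a < infdist x A + e"
proof -
  have "(INF a\<in>A. dist x a) < infdist x A + e" using assms by (simp add: infdist_def)
  then show ?thesis using assms(1) by (subst (asm) cINF_less_iff) auto
qed

text \<open>The distance to \<open>W\<close> is the quotient norm modulo \<open>W\<close>. A linear
  functional dominated by it is bounded and vanishes on \<open>W\<close>, which is why it is the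
  majorant for separation.\<close>

lemma subspace_infdist_sublinear:
  fixes W :: "'b::real_normed_vector set"
  assumes W: "subspace W"
  shows "sublinear (\<lambda>x. infdist x W)"
  unfolding sublinear_def
proof (intro conjI allI impI)
  have ne: "W \<noteq> {}" using subspace_0[OF W] by blast
  note approx = infdist_almost_attained[OF ne]
  fix x y :: 'b
  show "infdist (x + y) W \<le> infdist x W + infdist y W"
  proof (rule field_le_epsilon)
    fix e :: real assume "e > 0"
    then obtain u v where u: "u \<in> W" "dist x u < infdist x W + e/2" and v: "v \<in> W" "dist y v < infdist y W + e/2"
      using approx by (meson half_gt_zero)
    have "infdist (x + y) W \<le> dist (x + y) (u + v)" by (rule infdist_le) (rule subspace_add[OF W u(1) v(1)])
    also have "\<dots> \<le> dist x u + dist y v" by (rule dist_triangle_add)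
    finally show "infdist (x + y) W \<le> infdist x W + infdist y W + e" using u v by simp
  qed
  have half: "infdist (t *\<^sub>R x) W \<le> t * infdist x W" if "t > 0" for t x
  proof (rule field_le_epsilon)
    fix e :: real assume e: "e > 0"
    obtain u where u: "u \<in> W" "dist x u < infdist x W + e/t" using approx[of "e/t" x] e \<open>t > 0\<close> by auto
    have "infdist (t *\<^sub>R x) W \<le> dist (t *\<^sub>R x) (t *\<^sub>R u)" by (rule infdist_le) (rule subspace_scale[OF W u(1)])
    also have "\<dots> = t * dist x u" using \<open>t > 0\<close> by (simp add: dist_norm flip: scaleR_diff_right)
    also have "\<dots> \<le> t * (infdist x W + e/t)" using u(2) \<open>t > 0\<close> by (intro mult_left_mono) auto
    finally show "infdist (t *\<^sub>R x) W \<le> t * infdist x W + e" using \<open>t > 0\<close> by (simp add: algebra_simps)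
  qed
  fix t :: real assume "t \<ge> 0"
  show "infdist (t *\<^sub>R x) W = t * infdist x W"
  proof (cases "t = 0")
    case True
    then show ?thesis using subspace_0[OF W] by simp
  next
    case False
    then have t: "t > 0" using \<open>t \<ge> 0\<close> by simp
    have "infdist ((1/t) *\<^sub>R (t *\<^sub>R x)) W \<le> (1/t) * infdist (t *\<^sub>R x) W" by (rule half) (use t in simp)
    then have "t * infdist x W \<le> infdist (t *\<^sub>R x) W" using t by (simp add: field_simps)
    with half[OF t] show ?thesis by (intro antisym)
  qed
qed

theorem Hahn_Banach_separation:
  fixes W :: "'a::complex_banach set"
  assumes W: "csubspace W" "closed W" and x0: "x0 \<notin> W"
  obtains f where "cfunctional f" "\<And>w. w \<in> W \<Longrightarrow> f w = 0" "f x0 = 1"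
proof -
  note W' = csubspace_imp_subspace[OF W(1)]
  obtain f where f: "linear f" "\<And>x. f x \<le> infdist x W" "f x0 = infdist x0 W"
    using Hahn_Banach_sublinear[OF subspace_infdist_sublinear[OF W']] by blast
  interpret f: linear f by fact
  have pos: "f x0 > 0"
    unfolding f(3) using infdist_pos_not_in_closed[OF W(2) _ x0] subspace_0[OF W'] by blast
  have fW: "f w = 0" if "w \<in> W" for w
    using f(2)[of w] f(2)[of "- w"] that subspace_neg[OF W' that] by (simp add: f.neg)
  have le: "infdist x W \<le> norm x" for x
    using infdist_le[OF subspace_0[OF W'], of x] by simp
  have abs: "\<bar>f x\<bar> \<le> norm x" for x
    using order_trans[OF f(2) le, of x] order_trans[OF f(2) le, of "- x"] by (simp add: f.neg)
  have bf: "bounded_linear f"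
    by (rule bounded_linear_intro[of _ 1]) (auto simp: f.add f.scale abs)
  have bi: "bounded_linear (\<lambda>x :: 'a. \<i> *\<^sub>C x)"
  proof (rule bounded_linear_intro[of _ 1])
    fix r and x :: 'a
    show "\<i> *\<^sub>C (r *\<^sub>R x) = r *\<^sub>R (\<i> *\<^sub>C x)"
      by (simp add: scaleC_scaleC mult.commute flip: scaleC_of_real)
  qed (simp_all add: scaleC_add_right norm_scaleC)
  \<comment> \<open>The complex linear functional with real part \<open>f\<close>. It vanishes on
    \<open>W\<close> because \<open>W\<close> is invariant under multiplication by the imaginary
    unit.\<close>
  define F where "F = (\<lambda>x. complex_of_real (f x) - \<i> * complex_of_real (f (\<i> *\<^sub>C x)))"
  have bF: "bounded_linear F"
    unfolding F_def
    by (intro bounded_linear_sub bounded_linear_const_mult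
        bounded_linear_compose[OF bounded_linear_of_real] bounded_linear_compose[OF bf] bf bi)
  interpret F: bounded_linear F by fact
  have Fi: "F (\<i> *\<^sub>C x) = \<i> * F x" for x
  proof -
    have "\<i> *\<^sub>C \<i> *\<^sub>C x = - x" using scaleC_of_real[of "-1" x] by (simp add: scaleC_scaleC)
    then show ?thesis by (simp add: F_def f.neg algebra_simps)
  qed
  have Fc: "F (c *\<^sub>C x) = c * F x" for c x
  proof -
    have "c *\<^sub>C x = (complex_of_real (Re c) + complex_of_real (Im c) * \<i>) *\<^sub>C x"
      by (metis complex_eq mult.commute)
    also have "\<dots> = Re c *\<^sub>R x + Im c *\<^sub>R (\<i> *\<^sub>C x)"
      unfolding scaleC_add_left by (simp add: scaleC_of_real flip: scaleC_scaleC)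
    finally have "F (c *\<^sub>C x) = Re c *\<^sub>R F x + Im c *\<^sub>R (\<i> * F x)"
      by (simp add: F.add F.scaleR Fi)
    also have "\<dots> = c * F x" by (simp add: complex_eq_iff)
    finally show ?thesis .
  qed
  have nz: "F x0 \<noteq> 0" using pos by (auto simp: F_def complex_eq_iff)
  have F0: "F w = 0" if "w \<in> W" for w
    using fW[OF that] fW[OF complex_vector.subspace_scale[OF W(1) that]] by (simp add: F_def)
  show ?thesis
  proof (rule that[of "\<lambda>x. F x / F x0"])
    show "cfunctional (\<lambda>x. F x / F x0)" unfolding cfunctional_def
      using bF by (simp add: Fc bounded_linear_compose[OF bounded_linear_divide])
  qed (use F0 nz in auto)
qed

section \<open>Finite dimensional extensions of closed subspaces\<close>

lemma csubspace_add_span: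
  "csubspace W \<Longrightarrow> csubspace {w + v | w v. w \<in> W \<and> v \<in> cspan E}"
  by (intro complex_vector.subspace_sums complex_vector.subspace_span)

text \<open>Induction on \<open>E\<close>. If \<open>e\<close> is new, a functional \<open>f\<close>
  vanishing on the smaller sum with \<open>f e = 1\<close> determines the coefficient of
  \<open>e\<close>; the larger sum is then the preimage of the smaller one under the continuous map
  that subtracts \<open>f z *\<^sub>C e\<close> from \<open>z\<close>.\<close>

lemma closed_add_span:
  fixes W :: "'a::complex_banach set"
  assumes W: "csubspace W" "closed W" and E: "finite E"
  shows "closed {w + v | w v. w \<in> W \<and> v \<in> cspan E}"
  using E
proof induction
  case empty
  then show ?case using W(2) by simp
next
  case (insert e E)
  let ?W = "{w + v | w v. w \<in> W \<and> v \<in> cspan E}"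
  let ?W' = "{w + v | w v. w \<in> W \<and> v \<in> cspan (insert e E)}"
  note sW = csubspace_add_span[OF W(1), of E]
  have eq: "z \<in> ?W' \<longleftrightarrow> (\<exists>c. z - c *\<^sub>C e \<in> ?W)" for z
  proof
    assume "z \<in> ?W'"
    then obtain w v where wv: "z = w + v" "w \<in> W" "v \<in> cspan (insert e E)" by blast
    then obtain k where "v - k *\<^sub>C e \<in> cspan E" using complex_vector.span_insert[of e E] by blast
    then have "w + (v - k *\<^sub>C e) \<in> ?W" using wv by blast
    then show "\<exists>c. z - c *\<^sub>C e \<in> ?W" using wv by (auto simp: algebra_simps intro!: exI[of _ k])
  next
    assume "\<exists>c. z - c *\<^sub>C e \<in> ?W"
    then obtain c w v where *: "z - c *\<^sub>C e = w + v" "w \<in> W" "v \<in> cspan E" by blast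
    have "v + c *\<^sub>C e \<in> cspan (insert e E)"
      unfolding complex_vector.span_insert using *(3) by (auto intro!: exI[of _ c])
    moreover have "z = w + (v + c *\<^sub>C e)" using *(1) by (simp add: algebra_simps)
    ultimately show "z \<in> ?W'" using *(2) by blast
  qed
  show ?case
  proof (cases "e \<in> ?W")
    case True
    have "?W' = ?W"
    proof (intro set_eqI iffI)
      fix z assume "z \<in> ?W'"
      then obtain c where "z - c *\<^sub>C e \<in> ?W" using eq by blast
      from complex_vector.subspace_add[OF sW this complex_vector.subspace_scale[OF sW True, of c]]
      show "z \<in> ?W" by simp
    next
      fix z assume "z \<in> ?W"
      then show "z \<in> ?W'" unfolding eq by (intro exI[of _ 0]) simp
    qed
    then show ?thesis using insert.IH by simp
  next
    case False
    obtain f where f: "cfunctional f" "\<And>w. w \<in> ?W \<Longrightarrow> f w = 0" "f e = 1"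
      using Hahn_Banach_separation[OF sW insert.IH False] by blast
    interpret f: bounded_linear f using f(1) by (simp add: cfunctional_def)
    have bl: "bounded_linear (\<lambda>z. z - f z *\<^sub>C e)"
      using bounded_clinear_scaleC_functional[OF f(1)]
      by (intro bounded_linear_sub bounded_linear_ident) (simp add: bounded_clinear_def)
    have "?W' = (\<lambda>z. z - f z *\<^sub>C e) -` ?W"
    proof (intro set_eqI iffI)
      fix z assume "z \<in> ?W'"
      then obtain c where c: "z - c *\<^sub>C e \<in> ?W" using eq by blast
      have "f (c *\<^sub>C e) = c" using f(1,3) by (simp add: cfunctional_def)
      then have "f z = c" using f(2)[OF c] by (simp add: f.diff)
      then show "z \<in> (\<lambda>z. z - f z *\<^sub>C e) -` ?W" using c by simp
    qed (use eq in auto)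
    then show ?thesis
      using continuous_closed_vimage[OF insert.IH, of "\<lambda>z. z - f z *\<^sub>C e"] linear_continuous_at[OF bl] by simp
  qed
qed

lemma closed_cspan: "finite E \<Longrightarrow> closed (cspan E)"
  using closed_add_span[of "{0}" E] by simp

text \<open>Each \<open>e\<close> is separated from the closed sum of \<open>W\<close> and the span
  of the other vectors. It lies outside this sum since \<open>E\<close> is independent and its span
  meets \<open>W\<close> trivially.\<close>

lemma dual_functionals:
  fixes W :: "'a::complex_banach set"
  assumes W: "csubspace W" "closed W" and E: "finite E" "complex_vector.independent E"
    and disj: "W \<inter> cspan E = {0}"
  obtains f where "\<And>e. e \<in> E \<Longrightarrow> cfunctional (f e)" "\<And>e w. e \<in> E \<Longrightarrow> w \<in> W \<Longrightarrow> f e w = 0"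
    "\<And>e e'. e \<in> E \<Longrightarrow> e' \<in> E \<Longrightarrow> f e e' = (if e = e' then 1 else 0)"
proof -
  have "\<exists>f. cfunctional f \<and> (\<forall>w\<in>W. f w = 0) \<and> (\<forall>e'\<in>E. f e' = (if e = e' then 1 else 0))" if e: "e \<in> E" for e
  proof -
    let ?W = "{w + v | w v. w \<in> W \<and> v \<in> cspan (E - {e})}"
    have "e \<notin> ?W"
    proof
      assume "e \<in> ?W"
      then obtain w v where wv: "e = w + v" "w \<in> W" "v \<in> cspan (E - {e})" by blast
      have "v \<in> cspan E" using wv(3) complex_vector.span_mono[of "E - {e}" E] by blast
      then have "e - v \<in> cspan E" 
        by (rule complex_vector.span_diff[OF complex_vector.span_base[OF e]])
      then have "w = 0" using wv disj by auto
      then have "e \<in> cspan (E - {e})" using wv by simp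
      then show False using E(2) e unfolding complex_vector.dependent_def by blast
    qed
    from Hahn_Banach_separation[OF csubspace_add_span[OF W(1)] closed_add_span[OF W] this] E(1)
    obtain f where f: "cfunctional f" "\<And>w. w \<in> ?W \<Longrightarrow> f w = 0" "f e = 1" by blast
    have "f w = 0" if "w \<in> W" for w
      using f(2)[of w] that complex_vector.span_zero[of "E - {e}"] by force
    moreover have "f e' = 0" if "e' \<in> E" "e' \<noteq> e" for e'
      using f(2)[of e'] that complex_vector.span_base[of e' "E - {e}"] complex_vector.subspace_0[OF W(1)] by force
    ultimately show ?thesis using f by auto
  qed
  then obtain f where f: "\<And>e. e \<in> E \<Longrightarrow> cfunctional (f e) \<and> (\<forall>w\<in>W. f e w = 0) \<and>
      (\<forall>e'\<in>E. f e e' = (if e = e' then 1 else 0))" by metis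
  show ?thesis by (rule that[of f]) (use f in auto)
qed

section \<open>Bounded complex linear maps, finite rank projections, perturbed families\<close>

lemma bounded_clinear_add: "bounded_clinear f \<Longrightarrow> bounded_clinear g \<Longrightarrow> bounded_clinear (\<lambda>x. f x + g x)"
  by (simp add: bounded_clinear_def bounded_linear_add scaleC_add_right)

lemma bounded_clinear_diff: "bounded_clinear f \<Longrightarrow> bounded_clinear g \<Longrightarrow> bounded_clinear (\<lambda>x. f x - g x)"
  by (simp add: bounded_clinear_def bounded_linear_sub complex_vector.scale_right_diff_distrib)

lemma bounded_clinear_sum: "(\<And>i. i \<in> I \<Longrightarrow> bounded_clinear (f i)) \<Longrightarrow> bounded_clinear (\<lambda>x. \<Sum>i\<in>I. f i x)"
  by (simp add: bounded_clinear_def bounded_linear_sum complex_vector.scale_sum_right)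

lemma bounded_clinear_ident: "bounded_clinear (\<lambda>x. x)"
  by (simp add: bounded_clinear_def bounded_linear_ident)

lemma bounded_clinear_compose: "bounded_clinear f \<Longrightarrow> bounded_clinear g \<Longrightarrow> bounded_clinear (\<lambda>x. f (g x))"
  by (simp add: bounded_clinear_def bounded_linear_compose)

lemma bounded_clinear_scaleC: "bounded_clinear (\<lambda>x. c *\<^sub>C x)"
  unfolding bounded_clinear_def
proof
  show "bounded_linear (\<lambda>x. c *\<^sub>C x)"
    by (rule bounded_linear_intro[of _ "cmod c"])
      (simp_all add: scaleC_add_right scaleC_scaleC norm_scaleC mult.commute flip: scaleC_of_real)
qed (simp add: scaleC_scaleC mult.commute)

lemma bounded_clinear_funpow: "bounded_clinear S \<Longrightarrow> bounded_clinear (S ^^ n)"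
  by (induction n) (simp_all add: bounded_clinear_ident bounded_clinear_compose id_def o_def)

lemma bounded_clinear_shift: "bounded_clinear T \<Longrightarrow> bounded_clinear (shift T \<mu>)"
  unfolding shift_def by (intro bounded_clinear_diff bounded_clinear_scaleC)

lemma bounded_clinear_linear: "bounded_clinear S \<Longrightarrow> Vector_Spaces.linear scaleC scaleC S"
  unfolding Vector_Spaces.linear_iff bounded_clinear_def
  by (auto simp: linear_simps complex_vector.vector_space_axioms)

lemma
  assumes "bounded_clinear S"
  shows bounded_clinear_0: "S 0 = 0"
    and bounded_clinear_plus: "S (x + y) = S x + S y"
    and bounded_clinear_minus: "S (x - y) = S x - S y"
    and bounded_clinear_uminus: "S (- x) = - S x"
    and bounded_clinear_scale: "S (c *\<^sub>C x) = c *\<^sub>C S x"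
    and bounded_clinear_setsum: "S (\<Sum>i\<in>I. g i) = (\<Sum>i\<in>I. S (g i))"
  using assms by (auto simp: bounded_clinear_def linear_simps linear_sum[OF bounded_linear.linear])

lemmas bounded_clinear_simps = bounded_clinear_0 bounded_clinear_plus bounded_clinear_minus
  bounded_clinear_uminus bounded_clinear_scale

text \<open>Used with \<open>W\<close> zero and \<open>E\<close> a basis of a kernel, or with
  \<open>W\<close> a closed range and \<open>E\<close> independent modulo it; the projection then
  measures the kernel or the defect.\<close>

lemma finite_rank_projection:
  fixes W :: "'a::complex_banach set"
  assumes W: "csubspace W" "closed W" and E: "finite E" "complex_vector.independent E"
    and disj: "W \<inter> cspan E = {0}"
  obtains P where "bounded_clinear P" "\<And>x. P x \<in> cspan E" "\<And>v. v \<in> cspan E \<Longrightarrow> P v = v"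
    "\<And>w. w \<in> W \<Longrightarrow> P w = 0"
proof -
  obtain f where f: "\<And>e. e \<in> E \<Longrightarrow> cfunctional (f e)" "\<And>e w. e \<in> E \<Longrightarrow> w \<in> W \<Longrightarrow> f e w = 0"
    "\<And>e e'. e \<in> E \<Longrightarrow> e' \<in> E \<Longrightarrow> f e e' = (if e = e' then 1 else 0)"
    using dual_functionals[OF assms] by blast
  let ?P = "\<lambda>x. \<Sum>e\<in>E. f e x *\<^sub>C e"
  have P: "bounded_clinear ?P"
    by (intro bounded_clinear_sum bounded_clinear_scaleC_functional f)
  have PE: "?P e = e" if "e \<in> E" for e
  proof -
    have "?P e = (\<Sum>e'\<in>E. if e' = e then e' else 0)"
      using f(3) that by (intro sum.cong) (auto simp: scaleC_one)
    then show ?thesis using E(1) that by simp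
  qed
  show ?thesis
  proof (rule that[OF P])
    show "?P x \<in> cspan E" for x
      by (intro complex_vector.span_sum complex_vector.span_scale complex_vector.span_base)
    show "?P v = v" if "v \<in> cspan E" for v
      using that
    proof (induction rule: complex_vector.span_induct_alt)
      case base
      show ?case by (rule bounded_clinear_0[OF P])
    next
      case (step c x y)
      have "?P (c *\<^sub>C x + y) = c *\<^sub>C ?P x + ?P y"
        unfolding bounded_clinear_plus[OF P] bounded_clinear_scale[OF P] by (rule refl)
      then show ?case using step PE by simp
    qed
    show "?P w = 0" if "w \<in> W" for w using f(2)[OF _ that] by simp
  qed
qed

text \<open>With dual functionals \<open>f\<close>, the linear map \<open>G\<close> sending
  \<open>x\<close> to \<open>x + (\<Sum>e\<in>E. f e x *\<^sub>C w e)\<close> takes \<open>e\<close>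
  to \<open>e + w e\<close>. It moves every vector by at most half of its norm, hence is injective
  and preserves independence.\<close>

lemma independent_perturb:
  fixes E :: "'a::complex_banach set"
  assumes E: "finite E" "complex_vector.independent E"
  obtains \<delta> where "\<delta> > 0" "\<And>w. (\<And>e. e \<in> E \<Longrightarrow> norm (w e) \<le> \<delta>) \<Longrightarrow>
    inj_on (\<lambda>e. e + w e) E \<and> complex_vector.independent ((\<lambda>e. e + w e) ` E)"
proof -
  have disj: "{0::'a} \<inter> cspan E = {0}" using complex_vector.span_zero by blast
  obtain f where f: "\<And>e. e \<in> E \<Longrightarrow> cfunctional (f e)"
    "\<And>e e'. e \<in> E \<Longrightarrow> e' \<in> E \<Longrightarrow> f e e' = (if e = e' then 1 else 0)"
    by (rule dual_functionals[OF complex_vector.subspace_single_0 closed_singleton E disj]) blast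
  have "\<exists>K. \<forall>x. cmod (f e x) \<le> norm x * K" if "e \<in> E" for e
    using f(1)[OF that] bounded_linear.bounded by (auto simp: cfunctional_def)
  then obtain K where K: "\<And>e x. e \<in> E \<Longrightarrow> cmod (f e x) \<le> norm x * K e" by metis
  \<comment> \<open>The summand 1 keeps \<open>L\<close> positive for empty
    \<open>E\<close>.\<close>
  define L where "L = (\<Sum>e\<in>E. \<bar>K e\<bar>) + 1"
  have L: "L > 0" unfolding L_def by (rule add_nonneg_pos) (auto intro: sum_nonneg)
  show ?thesis
  proof (rule that[of "1 / (2 * L)"])
    show "1 / (2 * L) > 0" using L by simp
    fix w :: "'a \<Rightarrow> 'a" assume w: "\<And>e. e \<in> E \<Longrightarrow> norm (w e) \<le> 1 / (2 * L)"
    define G where "G = (\<lambda>x. x + (\<Sum>e\<in>E. f e x *\<^sub>C w e))"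
    have "bounded_clinear G" unfolding G_def
      by (intro bounded_clinear_add bounded_clinear_ident bounded_clinear_sum bounded_clinear_scaleC_functional f)
    then interpret G: Vector_Spaces.linear scaleC scaleC G by (rule bounded_clinear_linear)
    have GE: "G e = e + w e" if "e \<in> E" for e
    proof -
      have "(\<Sum>e'\<in>E. f e' e *\<^sub>C w e') = (\<Sum>e'\<in>E. if e' = e then w e' else 0)"
        using f(2) that by (intro sum.cong) (auto simp: scaleC_one)
      then show ?thesis using E(1) that by (simp add: G_def)
    qed
    have "x = 0" if "G x = 0" for x
    proof -
      have "norm (\<Sum>e\<in>E. f e x *\<^sub>C w e) \<le> (\<Sum>e\<in>E. \<bar>K e\<bar> * norm x * (1 / (2 * L)))"
      proof (rule sum_norm_le)
        fix e assume e: "e \<in> E"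
        have "cmod (f e x) \<le> \<bar>K e\<bar> * norm x"
          using K[OF e, of x] by (smt (verit) mult.commute mult_right_mono norm_ge_zero)
        then show "norm (f e x *\<^sub>C w e) \<le> \<bar>K e\<bar> * norm x * (1 / (2 * L))"
          unfolding norm_scaleC by (intro mult_mono w e) auto
      qed
      also have "\<dots> = (\<Sum>e\<in>E. \<bar>K e\<bar>) * norm x * (1 / (2 * L))" by (simp only: sum_distrib_right)
      also have "\<dots> \<le> L * norm x * (1 / (2 * L))"
        by (intro mult_right_mono) (use L in \<open>auto simp: L_def\<close>)
      also have "\<dots> = norm x / 2" using L by simp
      finally have "norm (\<Sum>e\<in>E. f e x *\<^sub>C w e) \<le> norm x / 2" .
      moreover have "x = - (\<Sum>e\<in>E. f e x *\<^sub>C w e)" using that by (simp add: G_def eq_neg_iff_add_eq_0)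
      then have "norm x = norm (\<Sum>e\<in>E. f e x *\<^sub>C w e)" by (metis norm_minus_cancel)
      ultimately show "x = 0" by simp
    qed
    then have inj: "inj G" using G.inj_iff_eq_0 by blast
    have "complex_vector.independent (G ` E)"
      by (rule G.independent_injective_image[OF E(2)]) (rule inj_on_subset[OF inj subset_UNIV])
    moreover have "G ` E = (\<lambda>e. e + w e) ` E" using GE by (intro image_cong) auto
    moreover have "inj_on (\<lambda>e. e + w e) E"
      using inj_on_subset[OF inj subset_UNIV, of E] GE by (simp add: inj_on_def)
    ultimately show "inj_on (\<lambda>e. e + w e) E \<and> complex_vector.independent ((\<lambda>e. e + w e) ` E)" by simp
  qed
qed

section \<open>Dimension and codimension\<close>

lemma independent_in_span_card:
  assumes "complex_vector.independent B" "B \<subseteq> cspan C" "finite C"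
  shows "finite B \<and> card B \<le> card C"
  using complex_vector.independent_span_bound[OF assms(3,1,2)] .

lemma edim_le_iff:
  assumes V: "csubspace V"
  shows "edim V \<le> enat m \<longleftrightarrow> (\<exists>B. finite B \<and> card B \<le> m \<and> V \<subseteq> cspan B)"
proof
  assume le: "edim V \<le> enat m"
  then have fd: "cfinite_dim V" by (auto simp: edim_def split: if_splits)
  obtain B where B: "B \<subseteq> V" "complex_vector.independent B" "V \<subseteq> cspan B" "card B = cdim V"
    using complex_vector.basis_exists[of V] by blast
  obtain F where F: "finite F" "V \<subseteq> cspan F" using fd unfolding cfinite_dim_def by blast
  have "finite B" using independent_in_span_card[OF B(2) _ F(1)] B(1) F(2) by blast
  then show "\<exists>B. finite B \<and> card B \<le> m \<and> V \<subseteq> cspan B"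
    using B le fd by (auto simp: edim_def)
next
  assume "\<exists>B. finite B \<and> card B \<le> m \<and> V \<subseteq> cspan B"
  then obtain B where B: "finite B" "card B \<le> m" "V \<subseteq> cspan B" by blast
  then have "cfinite_dim V" "cdim V \<le> m"
    using complex_vector.dim_le_card[OF B(3,1)] by (auto simp: cfinite_dim_def)
  then show "edim V \<le> enat m" by (simp add: edim_def)
qed

text \<open>Ranging over finite \<open>m\<close>, this and \<open>edim_le_iff\<close> reduce
  comparisons of dimensions to finite families, with infinite dimension included.\<close>

lemma edim_ge_iff:
  assumes V: "csubspace V"
  shows "enat m \<le> edim V \<longleftrightarrow> (\<exists>B\<subseteq>V. finite B \<and> complex_vector.independent B \<and> card B = m)"
proof
  assume ge: "enat m \<le> edim V"
  obtain B where B: "B \<subseteq> V" "complex_vector.independent B" "V \<subseteq> cspan B" "card B = cdim V"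
    using complex_vector.basis_exists[of V] by blast
  have "\<exists>A\<subseteq>B. finite A \<and> card A = m"
  proof (cases "finite B")
    case True
    then have "cfinite_dim V" using B(3) by (auto simp: cfinite_dim_def)
    then have "m \<le> card B" using ge B(4) by (simp add: edim_def)
    then show ?thesis using True by (metis obtain_subset_with_card_n)
  next
    case False
    then show ?thesis using infinite_arbitrarily_large by blast
  qed
  then obtain A where A: "A \<subseteq> B" "finite A" "card A = m" by blast
  have "complex_vector.independent A" by (rule complex_vector.independent_mono[OF B(2) A(1)])
  then show "\<exists>B\<subseteq>V. finite B \<and> complex_vector.independent B \<and> card B = m"
    using A B(1) by (intro exI[of _ A]) auto
next
  assume "\<exists>B\<subseteq>V. finite B \<and> complex_vector.independent B \<and> card B = m"
  then obtain B where B: "B \<subseteq> V" "finite B" "complex_vector.independent B" "card B = m" by blast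
  show "enat m \<le> edim V"
  proof (rule ccontr)
    assume "\<not> enat m \<le> edim V"
    then obtain k where k: "edim V = enat k" "k < m" by (cases "edim V") auto
    then obtain C where C: "finite C" "card C \<le> k" "V \<subseteq> cspan C"
      using edim_le_iff[OF V, of k] by auto
    then have "card B \<le> k" using independent_in_span_card[OF B(3) _ C(1)] B(1) by fastforce
    then show False using k B(4) by simp
  qed
qed

lemma edim_eq_0_iff: "csubspace V \<Longrightarrow> edim V = 0 \<longleftrightarrow> V = {0}"
proof -
  assume V: "csubspace V"
  have "edim V = 0 \<longleftrightarrow> edim V \<le> enat 0" by (simp flip: zero_enat_def)
  also have "\<dots> \<longleftrightarrow> V \<subseteq> {0}" unfolding edim_le_iff[OF V] by (auto intro!: exI[of _ "{}"])
  also have "\<dots> \<longleftrightarrow> V = {0}" using complex_vector.subspace_0[OF V] by blast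
  finally show ?thesis .
qed

lemma edim_add_vector:
  assumes V: "csubspace V" and e: "e \<notin> V" and W: "W = {v + c *\<^sub>C e | v c. v \<in> V}"
  shows "edim W = edim V + 1"
proof -
  have VW: "V \<subseteq> W" unfolding W using complex_vector.scale_zero_left by force
  have Wspan: "W \<subseteq> cspan (insert e B)" if "V \<subseteq> cspan B" for B
  proof
    fix x assume "x \<in> W"
    then obtain v c where "x = v + c *\<^sub>C e" "v \<in> V" unfolding W by blast
    then have "x - c *\<^sub>C e \<in> cspan B" using that by auto
    then show "x \<in> cspan (insert e B)" unfolding complex_vector.span_insert by blast
  qed
  show ?thesis
  proof (cases "cfinite_dim V")
    case False
    then have "\<not> cfinite_dim W" using VW unfolding cfinite_dim_def by blast
    then show ?thesis using False by (simp add: edim_def)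
  next
    case True
    obtain B where B: "B \<subseteq> V" "complex_vector.independent B" "V \<subseteq> cspan B" "card B = cdim V"
      using complex_vector.basis_exists[of V] by blast
    obtain F where F: "finite F" "V \<subseteq> cspan F" using True unfolding cfinite_dim_def by blast
    have fB: "finite B" using independent_in_span_card[OF B(2) _ F(1)] B(1) F(2) by blast
    have sp: "cspan B = V" using B(1,3) complex_vector.span_minimal[OF B(1) V] by blast
    have "complex_vector.independent (insert e B)"
      using e B(2) unfolding sp[symmetric] by (rule complex_vector.independent_insertI)
    moreover have "insert e B \<subseteq> W"
    proof -
      have "0 + 1 *\<^sub>C e \<in> W" unfolding W using complex_vector.subspace_0[OF V] by blast
      then show ?thesis using B(1) VW by (auto simp: scaleC_one)
    qed
    moreover have "card (insert e B) = Suc (cdim V)" 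
      using card_insert_disjoint[OF fB, of e] e B(1,4) by (metis subsetD)
    ultimately have "cdim W = Suc (cdim V)"
      using complex_vector.dim_unique[of "insert e B" W] Wspan[OF B(3)] by blast
    moreover have "cfinite_dim W" using Wspan[OF B(3)] fB unfolding cfinite_dim_def by blast
    ultimately show ?thesis using True by (simp add: edim_def one_enat_def)
  qed
qed

section \<open>Algebraic complements and codimension\<close>

text \<open>The coordinates with respect to \<open>D\<close> of a common vector are supported both
  in \<open>A\<close> and in \<open>B\<close>, hence vanish.\<close>

lemma independent_span_Int:
  assumes "complex_vector.independent D" "A \<subseteq> D" "B \<subseteq> D" "A \<inter> B = {}"
  shows "cspan A \<inter> cspan B = {0}"
proof -
  have "x = 0" if x: "x \<in> cspan A" "x \<in> cspan B" for x
  proof -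
    have "complex_vector.representation D x b = 0" for b
      using complex_vector.representation_extend[OF assms(1) x(1) assms(2)]
        complex_vector.representation_extend[OF assms(1) x(2) assms(3)]
        complex_vector.representation_ne_zero[of A x b] complex_vector.representation_ne_zero[of B x b] assms(4)
      by (metis disjoint_iff)
    moreover have "x \<in> cspan D" using x(1) complex_vector.span_mono[OF assms(2)] by blast
    ultimately show "x = 0"
      using complex_vector.sum_nonzero_representation_eq[OF assms(1), of x] by simp
  qed
  then show ?thesis using complex_vector.span_zero by blast
qed

text \<open>Guarantees that the choice in \<open>ecodim\<close> picks a genuine complement: a basis
  of \<open>R\<close> is extended to one of \<open>Y\<close>, and the added vectors span it.\<close>

lemma alg_complement_exists:
  assumes Y: "csubspace Y" and R: "csubspace R" "R \<subseteq> Y"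
  obtains C where "alg_complement Y R C"
proof -
  obtain B where B: "B \<subseteq> R" "complex_vector.independent B" "R \<subseteq> cspan B"
    by (rule complex_vector.basis_exists[of R])
  obtain D where D: "B \<subseteq> D" "D \<subseteq> Y" "complex_vector.independent D" "Y \<subseteq> cspan D"
    using complex_vector.maximal_independent_subset_extend[OF order_trans[OF B(1) R(2)] B(2)] .
  have spB: "cspan B = R" using B complex_vector.span_minimal[OF B(1) R(1)] by blast
  have spD: "cspan D = Y" using D complex_vector.span_minimal[OF D(2) Y] by blast
  have un: "D = B \<union> (D - B)" using D(1) by blast
  have "alg_complement Y R (cspan (D - B))" unfolding alg_complement_def
  proof (intro conjI)
    show "csubspace (cspan (D - B))" by (rule complex_vector.subspace_span)
    show "R \<inter> cspan (D - B) = {0}"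
      using independent_span_Int[OF D(3,1), of "D - B"] unfolding spB by blast
    show "{r + c |r c. r \<in> R \<and> c \<in> cspan (D - B)} = Y"
      using complex_vector.span_Un[of B "D - B"] un spB spD by metis
  qed
  then show ?thesis using that by blast
qed

lemma ecodim_le_complement:
  assumes Y: "csubspace Y" and R: "csubspace R" "R \<subseteq> Y" and le: "ecodim Y R \<le> enat m"
  obtains B where "B \<subseteq> Y" "finite B" "complex_vector.independent B" "card B \<le> m"
    "R \<inter> cspan B = {0}" "Y \<subseteq> {r + v | r v. r \<in> R \<and> v \<in> cspan B}"
proof -
  obtain C where C: "alg_complement Y R C" using alg_complement_exists[OF Y R] .
  have sC: "csubspace C" and CY: "C \<subseteq> Y"
    using C complex_vector.subspace_0[OF R(1)] unfolding alg_complement_def by force+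
  have "edim C \<le> enat m" using le by (simp add: ecodim_eq[OF R(1) C])
  then have fd: "cfinite_dim C" "cdim C \<le> m" by (auto simp: edim_def split: if_splits)
  obtain B where B: "B \<subseteq> C" "complex_vector.independent B" "C \<subseteq> cspan B" "card B = cdim C"
    using complex_vector.basis_exists[of C] by blast
  obtain F where F: "finite F" "C \<subseteq> cspan F" using fd unfolding cfinite_dim_def by blast
  have "finite B" using independent_in_span_card[OF B(2) _ F(1)] B(1) F(2) by blast
  moreover have "cspan B = C" using B(3) complex_vector.span_minimal[OF B(1) sC] by blast
  ultimately show ?thesis
    using that[of B] B CY fd(2) C unfolding alg_complement_def by auto
qed

text \<open>On the right the span of \<open>B\<close> may overlap \<open>R\<close>. A complement of
  \<open>R \<inter> cspan B\<close> inside \<open>cspan B\<close> is then a complement of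
  \<open>R\<close> in \<open>Y\<close>.\<close>

lemma ecodim_le_iff:
  assumes Y: "csubspace Y" and R: "csubspace R" "R \<subseteq> Y"
  shows "ecodim Y R \<le> enat m \<longleftrightarrow>
    (\<exists>B\<subseteq>Y. finite B \<and> card B \<le> m \<and> Y \<subseteq> {r + v | r v. r \<in> R \<and> v \<in> cspan B})"
proof
  assume "ecodim Y R \<le> enat m"
  then show "\<exists>B\<subseteq>Y. finite B \<and> card B \<le> m \<and> Y \<subseteq> {r + v | r v. r \<in> R \<and> v \<in> cspan B}"
    by (rule ecodim_le_complement[OF assms]) blast
next
  assume "\<exists>B\<subseteq>Y. finite B \<and> card B \<le> m \<and> Y \<subseteq> {r + v | r v. r \<in> R \<and> v \<in> cspan B}"
  then obtain B where B: "B \<subseteq> Y" "finite B" "card B \<le> m" "Y \<subseteq> {r + v | r v. r \<in> R \<and> v \<in> cspan B}" by blast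
  have sB: "cspan B \<subseteq> Y" by (rule complex_vector.span_minimal[OF B(1) Y])
  obtain D where D: "alg_complement (cspan B) (R \<inter> cspan B) D"
    using alg_complement_exists[of "cspan B" "R \<inter> cspan B"] R(1)
    by (auto intro: complex_vector.subspace_inter complex_vector.subspace_span)
  have sD: "csubspace D" and DB: "D \<subseteq> cspan B"
    using D complex_vector.subspace_0[OF R(1)] complex_vector.span_zero[of B]
    unfolding alg_complement_def by force+
  have "alg_complement Y R D" unfolding alg_complement_def
  proof (intro conjI sD)
    show "R \<inter> D = {0}" using D DB unfolding alg_complement_def by blast
    show "{r + c |r c. r \<in> R \<and> c \<in> D} = Y"
    proof
      show "{r + c |r c. r \<in> R \<and> c \<in> D} \<subseteq> Y"
        using R(2) DB sB by (auto intro: complex_vector.subspace_add[OF Y])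
      show "Y \<subseteq> {r + c |r c. r \<in> R \<and> c \<in> D}"
      proof
        fix y assume "y \<in> Y"
        then obtain r v where rv: "y = r + v" "r \<in> R" "v \<in> cspan B" using B(4) by blast
        then obtain r' d where "v = r' + d" "r' \<in> R" "d \<in> D"
          using D unfolding alg_complement_def by blast
        then have "y = (r + r') + d" "r + r' \<in> R" "d \<in> D"
          using rv complex_vector.subspace_add[OF R(1)] by (auto simp: algebra_simps)
        then show "y \<in> {r + c |r c. r \<in> R \<and> c \<in> D}" by blast
      qed
    qed
  qed
  then have "ecodim Y R = edim D" by (rule ecodim_eq[OF R(1)])
  moreover have "edim D \<le> enat m" unfolding edim_le_iff[OF sD] using B DB by blast
  ultimately show "ecodim Y R \<le> enat m" by simp
qed

text \<open>To extend \<open>cspan B\<close> to a complement of \<open>R\<close>, a complement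
  \<open>D\<close> of the sum of \<open>R\<close> and \<open>cspan B\<close> is added;
  \<open>B\<close> is then an independent family inside the complement.\<close>

lemma ecodim_ge_iff:
  assumes Y: "csubspace Y" and R: "csubspace R" "R \<subseteq> Y"
  shows "enat m \<le> ecodim Y R \<longleftrightarrow>
    (\<exists>B\<subseteq>Y. finite B \<and> complex_vector.independent B \<and> card B = m \<and> R \<inter> cspan B = {0})"
proof
  obtain C where C: "alg_complement Y R C" using alg_complement_exists[OF assms] .
  have sC: "csubspace C" and CY: "C \<subseteq> Y" and RC: "R \<inter> C = {0}"
    using C complex_vector.subspace_0[OF R(1)] unfolding alg_complement_def by force+
  assume "enat m \<le> ecodim Y R"
  then have "enat m \<le> edim C" by (simp add: ecodim_eq[OF R(1) C])
  then obtain B where B: "B \<subseteq> C" "finite B" "complex_vector.independent B" "card B = m"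
    unfolding edim_ge_iff[OF sC] by blast
  have "cspan B \<subseteq> C" by (rule complex_vector.span_minimal[OF B(1) sC])
  then have "R \<inter> cspan B = {0}"
    using RC complex_vector.subspace_0[OF R(1)] complex_vector.span_zero[of B] by blast
  then show "\<exists>B\<subseteq>Y. finite B \<and> complex_vector.independent B \<and> card B = m \<and> R \<inter> cspan B = {0}"
    using B CY by blast
next
  assume "\<exists>B\<subseteq>Y. finite B \<and> complex_vector.independent B \<and> card B = m \<and> R \<inter> cspan B = {0}"
  then obtain B where B: "B \<subseteq> Y" "finite B" "complex_vector.independent B" "card B = m" "R \<inter> cspan B = {0}"
    by blast
  have sB: "cspan B \<subseteq> Y" by (rule complex_vector.span_minimal[OF B(1) Y])
  let ?R = "{r + v | r v. r \<in> R \<and> v \<in> cspan B}"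
  have sR: "csubspace ?R" using R(1) by (rule csubspace_add_span)
  have "?R \<subseteq> Y" using R(2) sB by (auto intro: complex_vector.subspace_add[OF Y])
  then obtain D where D: "alg_complement Y ?R D" using alg_complement_exists[OF Y sR] by blast
  let ?C = "{v + d | v d. v \<in> cspan B \<and> d \<in> D}"
  have sD: "csubspace D" using D by (simp add: alg_complement_def)
  have sC: "csubspace ?C"
    by (intro complex_vector.subspace_sums complex_vector.subspace_span sD)
  have "alg_complement Y R ?C" unfolding alg_complement_def
  proof (intro conjI sC)
    show "R \<inter> ?C = {0}"
    proof
      show "R \<inter> ?C \<subseteq> {0}"
      proof
        fix x assume "x \<in> R \<inter> ?C"
        then obtain v d where x: "x \<in> R" "x = v + d" "v \<in> cspan B" "d \<in> D" by blast
        have "d = x + (- v)" using x by simp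
        then have "d \<in> ?R" using x complex_vector.span_neg by blast
        then have "d = 0" using x D unfolding alg_complement_def by blast
        then show "x \<in> {0}" using x B(5) by auto
      qed
      show "{0} \<subseteq> R \<inter> ?C"
        using complex_vector.subspace_0[OF R(1)] complex_vector.subspace_0[OF sC] by blast
    qed
    have "{r + c |r c. r \<in> R \<and> c \<in> ?C} = {r + d | r d. r \<in> ?R \<and> d \<in> D}"
    proof (intro set_eqI iffI)
      fix x assume "x \<in> {r + c |r c. r \<in> R \<and> c \<in> ?C}"
      then obtain r v d where x: "x = r + (v + d)" and rvd: "r \<in> R" "v \<in> cspan B" "d \<in> D" by blast
      have "x = (r + v) + d" unfolding x by (simp only: add.assoc)
      moreover have "r + v \<in> ?R" using rvd by blast
      ultimately show "x \<in> {r + d | r d. r \<in> ?R \<and> d \<in> D}" using rvd by blast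
    next
      fix x assume "x \<in> {r + d | r d. r \<in> ?R \<and> d \<in> D}"
      then obtain r v d where x: "x = (r + v) + d" and rvd: "r \<in> R" "v \<in> cspan B" "d \<in> D" by blast
      have "x = r + (v + d)" unfolding x by (simp only: add.assoc)
      moreover have "v + d \<in> ?C" using rvd by blast
      ultimately show "x \<in> {r + c |r c. r \<in> R \<and> c \<in> ?C}" using rvd by blast
    qed
    then show "{r + c |r c. r \<in> R \<and> c \<in> ?C} = Y" using D by (simp add: alg_complement_def)
  qed
  then have eq: "ecodim Y R = edim ?C" by (rule ecodim_eq[OF R(1)])
  have "B \<subseteq> ?C"
  proof
    fix b assume "b \<in> B"
    then have "b \<in> cspan B" "0 \<in> D" "b = b + 0"
      using complex_vector.span_base complex_vector.subspace_0[OF sD] by auto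
    then show "b \<in> ?C" by blast
  qed
  then show "enat m \<le> ecodim Y R" unfolding eq edim_ge_iff[OF sC] using B by blast
qed

lemma ecodim_eq_0_iff:
  assumes Y: "csubspace Y" and R: "csubspace R" "R \<subseteq> Y"
  shows "ecodim Y R = 0 \<longleftrightarrow> R = Y"
proof -
  have "ecodim Y R = 0 \<longleftrightarrow> ecodim Y R \<le> enat 0" by (simp flip: zero_enat_def)
  also have "\<dots> \<longleftrightarrow> Y \<subseteq> R" unfolding ecodim_le_iff[OF assms] by (auto intro!: exI[of _ "{}"])
  also have "\<dots> \<longleftrightarrow> R = Y" using R(2) by blast
  finally show ?thesis .
qed

section \<open>Reducing decompositions\<close>

text \<open>Only the restriction of \<open>S\<close> to \<open>M\<close> is meant, but boundedness
  is asked of \<open>S\<close> on the whole space, because one operator is restricted to both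
  summands of a decomposition.\<close>

definition operator_on :: "'a::complex_banach set \<Rightarrow> ('a \<Rightarrow> 'a) \<Rightarrow> bool"
  where "operator_on M S \<longleftrightarrow> bounded_clinear S \<and> csubspace M \<and> closed M \<and> S ` M \<subseteq> M"

lemma
  assumes "operator_on M S"
  shows operator_on_clinear: "bounded_clinear S"
    and operator_on_csubspace: "csubspace M"
    and operator_on_subspace: "subspace M"
    and operator_on_closed: "closed M"
    and operator_on_in: "x \<in> M \<Longrightarrow> S x \<in> M"
    and operator_on_bounded_linear: "bounded_linear S"
  using assms by (auto simp: operator_on_def bounded_clinear_def csubspace_imp_subspace)

lemma csubspace_image:
  assumes S: "bounded_clinear S" and M: "csubspace M"
  shows "csubspace (S ` M)"
proof (rule complex_vector.subspaceI)
  show "0 \<in> S ` M"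
    using complex_vector.subspace_0[OF M] bounded_clinear_0[OF S] by (metis imageI)
  show "x + y \<in> S ` M" if "x \<in> S ` M" "y \<in> S ` M" for x y
  proof -
    obtain a b where "a \<in> M" "b \<in> M" "x = S a" "y = S b" using \<open>x \<in> S ` M\<close> \<open>y \<in> S ` M\<close> by blast
    then show ?thesis
      using imageI[OF complex_vector.subspace_add[OF M], of a b S] by (simp add: bounded_clinear_plus[OF S])
  qed
  show "c *\<^sub>C x \<in> S ` M" if "x \<in> S ` M" for c x
  proof -
    obtain a where "a \<in> M" "x = S a" using \<open>x \<in> S ` M\<close> by blast
    then show ?thesis
      using imageI[OF complex_vector.subspace_scale[OF M], of a S c] by (simp add: bounded_clinear_scale[OF S])
  qed
qed

lemma csubspace_kernel: "bounded_clinear S \<Longrightarrow> csubspace M \<Longrightarrow> csubspace {x \<in> M. S x = 0}"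
  unfolding complex_vector.subspace_def by (simp add: bounded_clinear_simps)

lemma bounded_clinear_continuous: "bounded_clinear S \<Longrightarrow> continuous_on A S"
  by (simp add: bounded_clinear_def linear_continuous_on)

lemma bounded_clinear_bound:
  assumes "bounded_clinear S"
  obtains K where "K > 0" "\<And>x. norm (S x) \<le> K * norm x"
  using assms bounded_linear.pos_bounded[of S] that unfolding bounded_clinear_def by (metis mult.commute)

lemma operator_on_funpow: "operator_on M S \<Longrightarrow> operator_on M (S ^^ n)"
proof -
  assume S: "operator_on M S"
  have "(S ^^ n) ` M \<subseteq> M" by (induction n) (use S in \<open>auto simp: operator_on_def\<close>)
  then show ?thesis using S bounded_clinear_funpow by (auto simp: operator_on_def)
qed

lemma operator_on_shift: "operator_on M S \<Longrightarrow> operator_on M (shift S \<mu>)"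
  unfolding operator_on_def
  by (auto intro: bounded_clinear_shift[unfolded shift_def] simp: shift_def
      intro!: complex_vector.subspace_diff complex_vector.subspace_scale)

lemma shift_shift: "shift (shift S \<mu>) \<nu> = shift S (\<mu> + \<nu>)"
  by (simp add: shift_def scaleC_add_left algebra_simps fun_eq_iff)

lemma nullity_eq_0_iff: "operator_on M S \<Longrightarrow> nullity M S = 0 \<longleftrightarrow> {x \<in> M. S x = 0} = {0}"
  unfolding nullity_def by (intro edim_eq_0_iff csubspace_kernel) (auto simp: operator_on_def)

lemma defect_eq_0_iff: "operator_on M S \<Longrightarrow> defect M S = 0 \<longleftrightarrow> S ` M = M"
  unfolding defect_def by (intro ecodim_eq_0_iff csubspace_image) (auto simp: operator_on_def)

section \<open>Decompositions and commuting idempotents\<close>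

lemma RedI:
  assumes "operator_on M S" "operator_on N S" "M \<inter> N = {0}" "\<And>z. \<exists>x\<in>M. \<exists>y\<in>N. z = x + y"
  shows "(M, N) \<in> Red S"
proof -
  have "{x + y | x y. x \<in> M \<and> y \<in> N} = UNIV" using assms(4) by blast
  then show ?thesis using assms(1-3) by (simp add: Red_def operator_on_def)
qed

lemma
  assumes "bounded_clinear S" "(M, N) \<in> Red S"
  shows Red_operator_on_left: "operator_on M S" and Red_operator_on_right: "operator_on N S"
    and Red_disjoint: "M \<inter> N = {0}" and Red_sum: "\<exists>x\<in>M. \<exists>y\<in>N. z = x + y"
proof -
  have "z \<in> {x + y |x y. x \<in> M \<and> y \<in> N}" using assms unfolding Red_def by auto
  then show "\<exists>x\<in>M. \<exists>y\<in>N. z = x + y" by blast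
qed (use assms in \<open>auto simp: Red_def operator_on_def\<close>)

lemma Red_projection:
  assumes S: "bounded_clinear S" and red: "(M, N) \<in> Red S"
  obtains E where "bounded_clinear E" "\<And>x. E x \<in> M" "\<And>x. x - E x \<in> N" "\<And>x. x \<in> M \<Longrightarrow> E x = x"
    "\<And>x. x \<in> N \<Longrightarrow> E x = 0" "\<And>x. E (S x) = S (E x)"
proof -
  note M = Red_operator_on_left[OF S red] and N = Red_operator_on_right[OF S red]
  note sM = operator_on_csubspace[OF M] and sN = operator_on_csubspace[OF N]
  have uniq: "x = x'" if "x + y = x' + y'" "x \<in> M" "x' \<in> M" "y \<in> N" "y' \<in> N" for x y x' y'
  proof -
    have "x - x' = y' - y" using that(1) by (simp add: algebra_simps)
    moreover have "x - x' \<in> M" using that complex_vector.subspace_diff[OF sM] by blast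
    moreover have "y' - y \<in> N" using that complex_vector.subspace_diff[OF sN] by blast
    ultimately have "x - x' \<in> M \<inter> N" by simp
    then show ?thesis using Red_disjoint[OF S red] by simp
  qed
  have "\<exists>x. x \<in> M \<and> z - x \<in> N" for z
    using Red_sum[OF S red, of z] by (metis add_diff_cancel_left')
  then obtain E where E: "\<And>z. E z \<in> M" "\<And>z. z - E z \<in> N" by metis
  have Eeq: "E z = x" if "x \<in> M" "z - x \<in> N" for z x
    by (rule uniq[of "E z" "z - E z" x "z - x"]) (use E that in auto)
  have add: "E (x + y) = E x + E y" for x y
  proof (rule Eeq)
    show "E x + E y \<in> M" by (intro complex_vector.subspace_add[OF sM] E)
    have "(x - E x) + (y - E y) \<in> N" by (intro complex_vector.subspace_add[OF sN] E)
    then show "x + y - (E x + E y) \<in> N" by (simp add: algebra_simps)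
  qed
  have scale: "E (c *\<^sub>C x) = c *\<^sub>C E x" for c x
  proof (rule Eeq)
    show "c *\<^sub>C E x \<in> M" by (intro complex_vector.subspace_scale[OF sM] E)
    have "c *\<^sub>C (x - E x) \<in> N" by (intro complex_vector.subspace_scale[OF sN] E)
    then show "c *\<^sub>C x - c *\<^sub>C E x \<in> N" by (simp add: complex_vector.scale_right_diff_distrib)
  qed
  have "bounded_linear E"
  proof -
    \<comment> \<open>Addition maps the closed subspace \<open>M \<times> N\<close> onto the whole
      space. Its preimages are unique, so the bounded preimages supplied by the open mapping theorem
      are the components, and \<open>E\<close> is bounded.\<close>
    let ?V = "M \<times> N" and ?T = "\<lambda>p :: 'a \<times> 'a. fst p + snd p"
    have T: "bounded_linear ?T" by (intro bounded_linear_add bounded_linear_fst bounded_linear_snd)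
    have V: "subspace ?V" "closed ?V"
      using M N by (auto intro: subspace_Times closed_Times dest: operator_on_subspace operator_on_closed)
    have TV: "?T ` ?V = UNIV" using Red_sum[OF S red] by force
    obtain K where K: "K > 0" "\<And>y. \<exists>x\<in>?V. ?T x = y \<and> norm x \<le> K * norm y"
      using open_mapping[OF T V] TV by auto
    have "norm (E z) \<le> norm z * K" for z
    proof -
      obtain x y where xy: "x \<in> M" "y \<in> N" "x + y = z" "norm (x, y) \<le> K * norm z" using K(2)[of z] by auto
      have "z - x = y" using xy(3) by auto
      then have "E z = x" using xy by (intro Eeq) auto
      then show ?thesis using xy(4) norm_fst_le[of x y] by (simp add: mult.commute)
    qed
    moreover have "E (r *\<^sub>R x) = r *\<^sub>R E x" for r x using scale[of "complex_of_real r" x] by (simp add: scaleC_of_real)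
    ultimately show ?thesis by (intro bounded_linear_intro) (auto simp: add)
  qed
  then have "bounded_clinear E" by (simp add: bounded_clinear_def scale)
  moreover have "E x = x" if "x \<in> M" for x using that complex_vector.subspace_0[OF sN] by (intro Eeq) auto
  moreover have "E x = 0" if "x \<in> N" for x using that complex_vector.subspace_0[OF sM] by (intro Eeq) auto
  moreover have "E (S x) = S (E x)" for x
  proof (rule Eeq)
    show "S (E x) \<in> M" by (rule operator_on_in[OF M E(1)])
    show "S x - S (E x) \<in> N"
      using operator_on_in[OF N E(2), of x] by (simp add: bounded_clinear_minus[OF S])
  qed
  ultimately show ?thesis using that E by blast
qed

text \<open>Further decompositions are obtained from commuting idempotents: continuity makes range
  and kernel closed, and commutation makes them invariant.\<close>

lemma projection_Red:
  assumes S: "bounded_clinear S" and E: "bounded_clinear E" "\<And>x. E (E x) = E x" "\<And>x. E (S x) = S (E x)"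
  shows "({x. E x = x}, {x. E x = 0}) \<in> Red S"
proof (rule RedI)
  have "closed {x. E x = x}" "closed {x. E x = 0}"
    using bounded_clinear_continuous[OF E(1)]
    by (auto intro!: closed_Collect_eq continuous_on_id continuous_on_const)
  then show "operator_on {x. E x = x} S" "operator_on {x. E x = 0} S"
    unfolding operator_on_def complex_vector.subspace_def
    using S by (auto simp: bounded_clinear_simps[OF E(1)] bounded_clinear_0[OF S] E(3))
  show "{x. E x = x} \<inter> {x. E x = 0} = {0}" using bounded_clinear_0[OF E(1)] by auto
  show "\<exists>x\<in>{x. E x = x}. \<exists>y\<in>{x. E x = 0}. z = x + y" for z
    by (intro bexI[of _ "E z"] bexI[of _ "z - E z"]) (auto simp: E(2) bounded_clinear_minus[OF E(1)])
qed

section \<open>Decompositions whose second summand carries a bijection\<close>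

context
  fixes S :: "'a::complex_banach \<Rightarrow> 'a" and M N
  assumes S: "bounded_clinear S" and red: "(M, N) \<in> Red S"
    and onto: "S ` N = N" and inj: "{x \<in> N. S x = 0} = {0}"
begin

lemma Red_bijective_kernel: "{x. S x = 0} = {x \<in> M. S x = 0}"
proof -
  have "x \<in> M" if "S x = 0" for x
  proof -
    obtain m n where mn: "m \<in> M" "n \<in> N" "x = m + n" using Red_sum[OF S red] by blast
    have "S n = S (- m)" using that unfolding mn(3)
      by (simp add: bounded_clinear_simps[OF S] eq_neg_iff_add_eq_0 add.commute)
    moreover have "S n \<in> N" by (rule operator_on_in[OF Red_operator_on_right[OF S red] mn(2)])
    moreover have "S (- m) \<in> M"
      using operator_on_in[OF Red_operator_on_left[OF S red]] mn(1)
        complex_vector.subspace_neg[OF operator_on_csubspace[OF Red_operator_on_left[OF S red]]] by blast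
    ultimately have "S n = 0" using Red_disjoint[OF S red] by auto
    then have "n = 0" using inj mn(2) by blast
    then show "x \<in> M" using mn by simp
  qed
  then show ?thesis by blast
qed

lemma Red_bijective_range: "range S = {u + n | u n. u \<in> S ` M \<and> n \<in> N}"
proof (intro set_eqI iffI)
  fix y assume "y \<in> range S"
  then obtain x where x: "y = S x" by blast
  obtain m n where mn: "m \<in> M" "n \<in> N" "x = m + n" using Red_sum[OF S red] by blast
  then have "y = S m + S n" "S n \<in> N"
    using operator_on_in[OF Red_operator_on_right[OF S red]] x by (auto simp: bounded_clinear_plus[OF S])
  then show "y \<in> {u + n | u n. u \<in> S ` M \<and> n \<in> N}" using mn(1) by blast
next
  fix y assume "y \<in> {u + n | u n. u \<in> S ` M \<and> n \<in> N}"
  then obtain m n where "y = S m + n" "m \<in> M" "n \<in> N" by blast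
  moreover obtain n' where "n = S n'" using onto \<open>n \<in> N\<close> by blast
  ultimately have "y = S (m + n')" by (simp add: bounded_clinear_plus[OF S])
  then show "y \<in> range S" by blast
qed

lemma Red_bijective_nullity: "nullity UNIV S = nullity M S"
  using Red_bijective_kernel by (simp add: nullity_def)

text \<open>A complement of the range inside \<open>M\<close> also complements the full range, since
  the latter is enlarged by exactly \<open>N\<close>.\<close>

lemma Red_bijective_defect: "defect UNIV S = defect M S"
proof -
  note M = Red_operator_on_left[OF S red] and N = Red_operator_on_right[OF S red]
  have sSM: "csubspace (S ` M)" by (intro csubspace_image S operator_on_csubspace[OF M])
  have SM: "S ` M \<subseteq> M" using operator_on_in[OF M] by blast
  obtain C where C: "alg_complement M (S ` M) C"
    using alg_complement_exists[OF operator_on_csubspace[OF M] sSM SM] .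
  have CM: "C \<subseteq> M" using C complex_vector.subspace_0[OF sSM] unfolding alg_complement_def by force
  have sC: "csubspace C" using C by (simp add: alg_complement_def)
  have "alg_complement UNIV (range S) C" unfolding alg_complement_def
  proof (intro conjI sC)
    have "c = 0" if c: "c \<in> range S" "c \<in> C" for c
    proof -
      obtain u n where un: "c = u + n" "u \<in> S ` M" "n \<in> N" using c(1) unfolding Red_bijective_range by blast
      have "c - u \<in> M" using c(2) CM SM un(2) by (intro complex_vector.subspace_diff[OF operator_on_csubspace[OF M]]) auto
      then have "n = 0" using un Red_disjoint[OF S red] by auto
      then show "c = 0" using un c(2) C unfolding alg_complement_def by auto
    qed
    then show "range S \<inter> C = {0}"
      using bounded_clinear_0[OF S] complex_vector.subspace_0[OF sC] by (force simp: image_iff)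
    have "z \<in> {r + c |r c. r \<in> range S \<and> c \<in> C}" for z
    proof -
      obtain m n where mn: "m \<in> M" "n \<in> N" "z = m + n" using Red_sum[OF S red] by blast
      obtain u c where uc: "m = u + c" "u \<in> S ` M" "c \<in> C" using C mn(1) unfolding alg_complement_def by blast
      have "z = (u + n) + c" using mn uc by (simp add: algebra_simps)
      moreover have "u + n \<in> range S" unfolding Red_bijective_range using uc(2) mn(2) by blast
      ultimately show ?thesis using uc(3) by blast
    qed
    then show "{r + c |r c. r \<in> range S \<and> c \<in> C} = UNIV" by blast
  qed
  then have "ecodim UNIV (range S) = edim C"
    by (intro ecodim_eq csubspace_image S complex_vector.subspace_UNIV)
  then show ?thesis using ecodim_eq[OF sSM C] by (simp add: defect_def)
qed

lemma Red_bijective_Kato: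
  assumes K: "Kato M S"
  shows "Kato UNIV S"
  unfolding Kato_def
proof
  obtain E where E: "bounded_clinear E" "\<And>x. E x \<in> M" "\<And>x. x - E x \<in> N" "\<And>x. x \<in> M \<Longrightarrow> E x = x"
    "\<And>x. x \<in> N \<Longrightarrow> E x = 0" "\<And>x. E (S x) = S (E x)" using Red_projection[OF S red] by metis
  \<comment> \<open>The range contains \<open>N\<close>, so membership depends only on the component
    in \<open>M\<close>, and closedness is pulled back along \<open>E\<close>.\<close>
  have "range S = E -` (S ` M)"
  proof (intro set_eqI iffI)
    fix y assume "y \<in> range S"
    then show "y \<in> E -` (S ` M)" using E(2,6) by auto
  next
    fix y assume "y \<in> E -` (S ` M)"
    then have "E y + (y - E y) \<in> range S" unfolding Red_bijective_range using E(3)[of y] by blast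
    then show "y \<in> range S" by simp
  qed
  moreover have "closed (E -` (S ` M))"
    using K E(1) by (intro closed_vimage) (auto simp: Kato_def bounded_clinear_continuous)
  ultimately show "closed (range S)" by simp
  show "\<forall>n. {x \<in> UNIV. S x = 0} \<subseteq> range (S ^^ n)"
  proof
    fix n
    have "{x \<in> UNIV. S x = 0} \<subseteq> (S ^^ n) ` M" using K unfolding Kato_def by (simp add: Red_bijective_kernel)
    then show "{x \<in> UNIV. S x = 0} \<subseteq> range (S ^^ n)" by blast
  qed
qed

end

section \<open>Quasinilpotency on a subspace\<close>

text \<open>Boundedness of \<open>A\<close> makes the supremum finite and \<open>0 \<in> N\<close>
  makes its index set nonempty; at \<open>x = 0\<close> the quotient is 0 by the convention for
  division.\<close>

lemma
  assumes A: "bounded_clinear A" and N: "0 \<in> N"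
  shows onorm_on_bound: "x \<in> N \<Longrightarrow> norm (A x) \<le> onorm_on N A * norm x"
    and onorm_on_nonneg: "0 \<le> onorm_on N A"
    and onorm_on_le: "c \<ge> 0 \<Longrightarrow> (\<And>x. x \<in> N \<Longrightarrow> norm (A x) \<le> c * norm x) \<Longrightarrow> onorm_on N A \<le> c"
proof -
  obtain K where K: "K > 0" "\<And>x. norm (A x) \<le> K * norm x" using bounded_clinear_bound[OF A] by blast
  have "norm (A x) / norm x \<le> K" for x using K by (cases "x = 0") (auto simp: divide_le_eq)
  then have bdd: "bdd_above ((\<lambda>x. norm (A x) / norm x) ` N)" by (intro bdd_aboveI2)
  have up: "norm (A x) / norm x \<le> onorm_on N A" if "x \<in> N" for x
    unfolding onorm_on_def by (rule cSUP_upper[OF that bdd])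
  show "0 \<le> onorm_on N A" using up[OF N] by simp
  show "norm (A x) \<le> onorm_on N A * norm x" if "x \<in> N" for x
    using up[OF that] by (cases "x = 0") (auto simp: divide_le_eq bounded_clinear_0[OF A])
  show "onorm_on N A \<le> c" if "c \<ge> 0" "\<And>x. x \<in> N \<Longrightarrow> norm (A x) \<le> c * norm x" for c
    unfolding onorm_on_def
  proof (rule cSUP_least)
    show "norm (A x) / norm x \<le> c" if "x \<in> N" for x
      using \<open>c \<ge> 0\<close> \<open>\<And>x. x \<in> N \<Longrightarrow> norm (A x) \<le> c * norm x\<close>[OF that]
      by (cases "x = 0") (auto simp: divide_le_eq)
  qed (use N in auto)
qed

text \<open>Trades roots of operator norms for pointwise estimates. Exponents are taken positive in
  the proof because \<open>root 0\<close> is constantly 0.\<close>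

lemma quasinilpotent_iff:
  assumes Q: "bounded_clinear Q" and N: "0 \<in> N"
  shows "quasinilpotent N Q \<longleftrightarrow>
    (\<forall>e>0. \<forall>\<^sub>F n in sequentially. \<forall>x\<in>N. norm ((Q ^^ n) x) \<le> e ^ n * norm x)"
proof
  note B = bounded_clinear_funpow[OF Q]
  let ?o = "\<lambda>n. onorm_on N (Q ^^ n)"
  {
    assume qn: "quasinilpotent N Q"
    show "\<forall>e>0. \<forall>\<^sub>F n in sequentially. \<forall>x\<in>N. norm ((Q ^^ n) x) \<le> e ^ n * norm x"
    proof (intro allI impI)
      fix e :: real assume "e > 0"
      then have "\<forall>\<^sub>F n in sequentially. root n (?o n) < e"
        using qn unfolding quasinilpotent_def by (auto dest: order_tendstoD)
      then show "\<forall>\<^sub>F n in sequentially. \<forall>x\<in>N. norm ((Q ^^ n) x) \<le> e ^ n * norm x"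
        using eventually_gt_at_top[of 0]
      proof eventually_elim
        case (elim n)
        have "?o n = root n (?o n) ^ n" using elim onorm_on_nonneg[OF B N] by simp
        also have "\<dots> \<le> e ^ n" using elim onorm_on_nonneg[OF B N] by (intro power_mono) auto
        finally have le: "?o n \<le> e ^ n" .
        show ?case
          using onorm_on_bound[OF B N] mult_right_mono[OF le norm_ge_zero] by (meson order_trans)
      qed
    qed
  }
  assume *: "\<forall>e>0. \<forall>\<^sub>F n in sequentially. \<forall>x\<in>N. norm ((Q ^^ n) x) \<le> e ^ n * norm x"
  show "quasinilpotent N Q" unfolding quasinilpotent_def
  proof (rule order_tendstoI)
    fix a :: real assume "a < 0"
    show "\<forall>\<^sub>F n in sequentially. a < root n (?o n)"
      using eventually_gt_at_top[of 0]
      by eventually_elim (rule less_le_trans[OF \<open>a < 0\<close> real_root_ge_zero[OF onorm_on_nonneg[OF B N]]])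
  next
    fix a :: real assume a: "0 < a"
    have "\<forall>\<^sub>F n in sequentially. \<forall>x\<in>N. norm ((Q ^^ n) x) \<le> (a/2) ^ n * norm x" using * a by simp
    then show "\<forall>\<^sub>F n in sequentially. root n (?o n) < a" using eventually_gt_at_top[of 0]
    proof eventually_elim
      case (elim n)
      have "?o n \<le> (a/2) ^ n" by (rule onorm_on_le[OF B N]) (use elim a in auto)
      then have "root n (?o n) \<le> root n ((a/2) ^ n)" using elim by simp
      also have "\<dots> = a/2" using elim a by (simp add: real_root_power_cancel)
      finally show ?case using a by simp
    qed
  qed
qed

text \<open>The constant is harmless: eventually \<open>C\<close> is below \<open>2 ^ n\<close>, so
  the estimate for \<open>e/2\<close> gives the one for \<open>e\<close>. Ignoring exponents below
  \<open>k\<close> allows nilpotent parts to be absorbed and exponent zero to be skipped.\<close>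

lemma quasinilpotent_dominated:
  assumes Q: "bounded_clinear Q" "0 \<in> N" and Q': "bounded_clinear Q'" "0 \<in> N'"
    and qn: "quasinilpotent N Q"
    and dom: "\<And>n x. n \<ge> k \<Longrightarrow> x \<in> N' \<Longrightarrow> \<exists>y\<in>N. norm y \<le> C * norm x \<and> norm ((Q' ^^ n) x) \<le> norm ((Q ^^ n) y)"
  shows "quasinilpotent N' Q'"
  unfolding quasinilpotent_iff[OF Q']
proof (intro allI impI)
  fix e :: real assume e: "e > 0"
  have "\<forall>\<^sub>F n in sequentially. \<forall>x\<in>N. norm ((Q ^^ n) x) \<le> (e/2) ^ n * norm x"
    using qn e unfolding quasinilpotent_iff[OF Q] by simp
  moreover have "\<forall>\<^sub>F n in sequentially. \<bar>C\<bar> < 2 ^ n"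
  proof -
    obtain m where m: "\<bar>C\<bar> < 2 ^ m" using real_arch_pow[of 2 "\<bar>C\<bar>"] by auto
    have "\<bar>C\<bar> < 2 ^ n" if "n \<ge> m" for n
      by (rule less_le_trans[OF m power_increasing[OF that]]) simp
    then show ?thesis by (rule eventually_sequentiallyI)
  qed
  ultimately show "\<forall>\<^sub>F n in sequentially. \<forall>x\<in>N'. norm ((Q' ^^ n) x) \<le> e ^ n * norm x"
    using eventually_ge_at_top[of k]
  proof eventually_elim
    case (elim n)
    show ?case
    proof
      fix x assume "x \<in> N'"
      then obtain y where y: "y \<in> N" "norm y \<le> C * norm x" "norm ((Q' ^^ n) x) \<le> norm ((Q ^^ n) y)"
        using dom elim(3) by blast
      have "norm y \<le> 2 ^ n * norm x"
        using y(2) elim(2) by (meson abs_ge_self less_imp_le mult_right_mono norm_ge_zero order_trans)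
      then have "(e/2) ^ n * norm y \<le> (e/2) ^ n * (2 ^ n * norm x)" using e by (intro mult_left_mono) auto
      also have "\<dots> = e ^ n * norm x" by (simp add: power_divide)
      finally show "norm ((Q' ^^ n) x) \<le> e ^ n * norm x" using y elim(1) by fastforce
    qed
  qed
qed

text \<open>A single power \<open>Q ^^ n\<close> with norm on \<open>N\<close> at most half of
  \<open>cmod \<nu> ^ n\<close> suffices. On a kernel vector of the shift it acts as
  \<open>\<nu> ^ n\<close>, so the vector is zero; for surjectivity it makes the residual of a
  truncated Neumann series small.\<close>

lemma quasinilpotent_shift_bijective:
  assumes Q: "operator_on N Q" and qn: "quasinilpotent N Q" and \<nu>: "\<nu> \<noteq> 0"
  shows "shift Q \<nu> ` N = N" "{x \<in> N. shift Q \<nu> x = 0} = {0}"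
proof -
  note cQ = operator_on_clinear[OF Q] and sN = operator_on_csubspace[OF Q]
  have N0: "0 \<in> N" by (rule complex_vector.subspace_0[OF sN])
  have "\<forall>\<^sub>F n in sequentially. \<forall>x\<in>N. norm ((Q ^^ n) x) \<le> (cmod \<nu> / 2) ^ n * norm x"
    using qn \<nu> unfolding quasinilpotent_iff[OF cQ N0] by simp
  then obtain n0 where n0: "\<And>n x. n \<ge> n0 \<Longrightarrow> x \<in> N \<Longrightarrow> norm ((Q ^^ n) x) \<le> (cmod \<nu> / 2) ^ n * norm x"
    unfolding eventually_sequentially by blast
  \<comment> \<open>The successor ensures that \<open>(1/2) ^ n\<close> is at most one half.\<close>
  define n where "n = Suc n0"
  have n: "norm ((Q ^^ n) x) \<le> (cmod \<nu>) ^ n * (norm x / 2)" if "x \<in> N" for x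
  proof -
    have "(cmod \<nu> / 2) ^ n * norm x = cmod \<nu> ^ n * ((1/2) ^ n * norm x)" by (simp add: power_divide)
    also have "\<dots> \<le> cmod \<nu> ^ n * ((1/2) * norm x)"
      by (intro mult_left_mono mult_right_mono) (auto simp: n_def intro: power_le_one)
    finally show ?thesis using n0[of n x] that by (simp add: n_def)
  qed
  have "x = 0" if x: "x \<in> N" "shift Q \<nu> x = 0" for x
  proof -
    have "Q x = \<nu> *\<^sub>C x" using x by (simp add: shift_def)
    then have "(Q ^^ k) x = (\<nu> ^ k) *\<^sub>C x" for k
      by (induction k) (auto simp: bounded_clinear_scale[OF cQ] scaleC_one scaleC_scaleC mult.commute)
    then have "cmod \<nu> ^ n * norm x \<le> cmod \<nu> ^ n * (norm x / 2)" using n[OF x(1)] by (simp add: norm_scaleC norm_power)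
    then have "norm x \<le> norm x / 2" using \<nu> by (subst (asm) mult_le_cancel_left_pos) auto
    then show "x = 0" using norm_ge_zero[of x] by (simp del: norm_ge_zero)
  qed
  then show "{x \<in> N. shift Q \<nu> x = 0} = {0}"
    using N0 bounded_clinear_0[OF bounded_clinear_shift[OF cQ]] by auto
  \<comment> \<open>The Neumann series for the inverse of \<open>shift Q \<nu>\<close>, truncated
    after \<open>m\<close> terms; applying the shift telescopes it.\<close>
  define g where "g m = (\<lambda>y. \<Sum>k<m. (- 1 / \<nu> ^ Suc k) *\<^sub>C (Q ^^ k) y)" for m
  have tel: "shift Q \<nu> (g m y) = y - (1 / \<nu> ^ m) *\<^sub>C (Q ^^ m) y" for m y
  proof (induction m)
    case 0
    show ?case by (simp add: g_def bounded_clinear_0[OF bounded_clinear_shift[OF cQ]] scaleC_one)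
  next
    case (Suc m)
    have "shift Q \<nu> (g (Suc m) y) = shift Q \<nu> (g m y) + shift Q \<nu> ((- 1 / \<nu> ^ Suc m) *\<^sub>C (Q ^^ m) y)"
      by (simp only: g_def sum.lessThan_Suc bounded_clinear_plus[OF bounded_clinear_shift[OF cQ]])
    also have "shift Q \<nu> ((- 1 / \<nu> ^ Suc m) *\<^sub>C (Q ^^ m) y) =
        (- 1 / \<nu> ^ Suc m) *\<^sub>C (Q ^^ Suc m) y + (1 / \<nu> ^ m) *\<^sub>C (Q ^^ m) y"
      using \<nu> by (simp add: shift_def bounded_clinear_simps[OF cQ] scaleC_scaleC)
    finally show ?case unfolding Suc by (simp add: algebra_simps)
  qed
  have "bounded_clinear (g n)" unfolding g_def
    by (intro bounded_clinear_sum bounded_clinear_compose[OF bounded_clinear_scaleC] bounded_clinear_funpow cQ)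
  then obtain c where c: "c > 0" "\<And>y. norm (g n y) \<le> c * norm y" using bounded_clinear_bound by metis
  have gN: "g n y \<in> N" if "y \<in> N" for y unfolding g_def
    by (intro complex_vector.subspace_sum[OF sN] complex_vector.subspace_scale[OF sN]
        operator_on_in[OF operator_on_funpow[OF Q]] that)
  have step: "\<exists>x\<in>N. norm x \<le> c * norm y \<and> norm (y - shift Q \<nu> x) \<le> norm y / 2 \<and> y - shift Q \<nu> x \<in> N"
    if y: "y \<in> N" for y
  proof (intro bexI[of _ "g n y"] conjI c gN y)
    have "norm (y - shift Q \<nu> (g n y)) = norm ((Q ^^ n) y) / cmod \<nu> ^ n"
      by (simp add: tel norm_scaleC norm_divide norm_power)
    also have "\<dots> \<le> norm y / 2" using n[OF y] \<nu> by (simp add: divide_le_eq mult.commute)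
    finally show "norm (y - shift Q \<nu> (g n y)) \<le> norm y / 2" .
    show "y - shift Q \<nu> (g n y) \<in> N"
      by (intro complex_vector.subspace_diff[OF sN] y operator_on_in[OF operator_on_shift[OF Q]] gN)
  qed
  have "N \<subseteq> shift Q \<nu> ` N"
    using successive_approximation[OF operator_on_bounded_linear[OF operator_on_shift[OF Q]]
        operator_on_subspace[OF Q] operator_on_closed[OF Q] less_imp_le[OF c(1)] step] by blast
  then show "shift Q \<nu> ` N = N" using operator_on_in[OF operator_on_shift[OF Q]] by blast
qed

section \<open>Stability of Kato operators\<close>

lemma closed_range_preimages:
  assumes S: "operator_on M S" and cl: "closed (S ` M)"
  obtains K where "K > 0" "\<And>y. y \<in> S ` M \<Longrightarrow> \<exists>x\<in>M. S x = y \<and> norm x \<le> K * norm y"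
  by (rule open_mapping[OF operator_on_bounded_linear[OF S] operator_on_subspace[OF S] operator_on_closed[OF S] cl])
    (rule that)

text \<open>Let \<open>l = S x\<close> be a limit of \<open>S (r k)\<close> with \<open>r k\<close>
  in the previous range. Bounded preimages \<open>u k\<close> of \<open>l - S (r k)\<close> tend to
  0, and \<open>x - u k\<close> differs from \<open>r k\<close> by a kernel vector, which lies in
  the previous range by assumption; so does the limit \<open>x\<close>. The inclusions are assumed
  only below \<open>n\<close> because chain removal uses the first exponent at which they
  fail.\<close>

lemma closed_range_funpow:
  assumes S: "operator_on M S" and cl: "closed (S ` M)"
    and ker: "\<And>j. j < n \<Longrightarrow> {x \<in> M. S x = 0} \<subseteq> (S ^^ j) ` M"
  shows "closed ((S ^^ n) ` M)"
  using ker
proof (induction n)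
  case 0
  then show ?case using operator_on_closed[OF S] by simp
next
  case (Suc n)
  note cS = operator_on_clinear[OF S] and sM = operator_on_csubspace[OF S]
  let ?R = "(S ^^ n) ` M"
  have clR: "closed ?R" using Suc by simp
  have sR: "csubspace ?R" by (intro csubspace_image bounded_clinear_funpow cS sM)
  have RM: "?R \<subseteq> M" using operator_on_in[OF operator_on_funpow[OF S]] by blast
  obtain K where K: "K > 0" "\<And>y. y \<in> S ` M \<Longrightarrow> \<exists>x\<in>M. S x = y \<and> norm x \<le> K * norm y"
    using closed_range_preimages[OF S cl] by metis
  have "closed (S ` ?R)"
    unfolding closed_sequential_limits
  proof (intro allI impI, elim conjE)
    fix y l assume y: "\<forall>k. y k \<in> S ` ?R" and lim: "y \<longlonglongrightarrow> l"
    have yM: "y k \<in> S ` M" for k using y RM by blast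
    then have "l \<in> S ` M" using closed_sequentially[OF cl _ lim] by blast
    then obtain x where x: "x \<in> M" "l = S x" by blast
    have "\<forall>k. \<exists>r\<in>?R. y k = S r" using y by blast
    then obtain r where r: "\<And>k. r k \<in> ?R" "\<And>k. y k = S (r k)" by metis
    have "l - y k \<in> S ` M" for k
      using complex_vector.subspace_diff[OF csubspace_image[OF cS sM] \<open>l \<in> S ` M\<close> yM] .
    then have "\<forall>k. \<exists>u\<in>M. S u = l - y k \<and> norm u \<le> K * norm (l - y k)" using K(2) by blast
    then obtain u where u: "\<And>k. u k \<in> M" "\<And>k. S (u k) = l - y k" "\<And>k. norm (u k) \<le> K * norm (l - y k)"
      by metis
    have "u \<longlonglongrightarrow> 0"
    proof (rule Lim_null_comparison)
      show "\<forall>\<^sub>F k in sequentially. norm (u k) \<le> K * norm (l - y k)" using u(3) by simp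
      have "(\<lambda>k. K * norm (l - y k)) \<longlonglongrightarrow> K * norm (l - l)" by (intro tendsto_intros lim)
      then show "(\<lambda>k. K * norm (l - y k)) \<longlonglongrightarrow> 0" by simp
    qed
    then have "(\<lambda>k. x - u k) \<longlonglongrightarrow> x - 0" by (intro tendsto_intros)
    moreover have "x - u k \<in> ?R" for k
    proof -
      have "x - u k - r k \<in> M"
        using x(1) u(1) r(1) RM by (intro complex_vector.subspace_diff[OF sM]) auto
      moreover have "S (x - u k - r k) = 0" using x(2) u(2) r(2) by (simp add: bounded_clinear_minus[OF cS])
      ultimately have "x - u k - r k \<in> ?R" using Suc.prems[of n] by blast
      from complex_vector.subspace_add[OF sR this r(1)[of k]] show ?thesis by simp
    qed
    ultimately have "x \<in> ?R" using closed_sequentially[OF clR, of "\<lambda>k. x - u k" x] by simp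
    then show "l \<in> S ` ?R" using x(2) by blast
  qed
  then show ?case by (simp add: image_comp)
qed

text \<open>\<open>M0\<close> is the intersection of the ranges of all powers. If \<open>S x\<close>
  lies in the range of \<open>S ^^ Suc n\<close>, then \<open>x\<close> differs from a vector in the
  range of \<open>S ^^ n\<close> by a kernel vector, which for Kato operators is in that range too;
  hence preimages of vectors of \<open>M0\<close> stay in \<open>M0\<close>.\<close>

lemma Kato_hyperrange:
  assumes S: "operator_on M S" and K: "Kato M S"
  obtains M0 where "operator_on M0 S" "M0 \<subseteq> M" "{x \<in> M. S x = 0} \<subseteq> M0" "S ` M0 = M0"
    "\<And>x. x \<in> M \<Longrightarrow> S x \<in> M0 \<Longrightarrow> x \<in> M0" "(\<Inter>n. (S ^^ n) ` M) \<subseteq> M0"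
proof -
  note cS = operator_on_clinear[OF S] and sM = operator_on_csubspace[OF S]
  define M0 where "M0 = (\<Inter>n. (S ^^ n) ` M)"
  have ker: "{x \<in> M. S x = 0} \<subseteq> (S ^^ n) ` M" for n using K by (simp add: Kato_def)
  have cl: "closed ((S ^^ n) ` M)" for n using K by (intro closed_range_funpow[OF S] ker) (simp add: Kato_def)
  have sR: "csubspace ((S ^^ n) ` M)" for n by (intro csubspace_image bounded_clinear_funpow cS sM)
  have M0M: "M0 \<subseteq> M"
  proof
    fix x assume "x \<in> M0"
    then have "x \<in> (S ^^ 0) ` M" unfolding M0_def by (rule INT_D) simp
    then show "x \<in> M" by simp
  qed
  have pre: "x \<in> M0" if x: "x \<in> M" "S x \<in> M0" for x
    unfolding M0_def
  proof (rule INT_I)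
    fix n
    have "S x \<in> (S ^^ Suc n) ` M" using x(2) unfolding M0_def by blast
    then obtain z where z: "z \<in> M" "S x = S ((S ^^ n) z)" by auto
    have w: "(S ^^ n) z \<in> M" by (rule operator_on_in[OF operator_on_funpow[OF S] z(1)])
    have "x - (S ^^ n) z \<in> {x \<in> M. S x = 0}"
      using complex_vector.subspace_diff[OF sM x(1) w] z(2) by (simp add: bounded_clinear_minus[OF cS])
    then have "x - (S ^^ n) z \<in> (S ^^ n) ` M" using ker by blast
    from complex_vector.subspace_add[OF sR this imageI[OF z(1)]] show "x \<in> (S ^^ n) ` M" by simp
  qed
  have SM0: "S x \<in> M0" if x: "x \<in> M0" for x
    unfolding M0_def
  proof (rule INT_I)
    fix n
    have "x \<in> (S ^^ n) ` M" using x unfolding M0_def by blast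
    then obtain z where z: "z \<in> M" "x = (S ^^ n) z" by blast
    have "S x = (S ^^ n) (S z)" using z(2) by (simp add: funpow_swap1)
    then show "S x \<in> (S ^^ n) ` M" using operator_on_in[OF S z(1)] by blast
  qed
  have onto: "\<exists>x\<in>M0. y = S x" if y: "y \<in> M0" for y
  proof -
    have "y \<in> (S ^^ 1) ` M" using y unfolding M0_def by blast
    then obtain x where "x \<in> M" "y = S x" by auto
    then show ?thesis using pre y by blast
  qed
  have "csubspace M0" unfolding M0_def by (intro complex_vector.subspace_Inter) (use sR in auto)
  moreover have "closed M0" unfolding M0_def using cl by blast
  ultimately have "operator_on M0 S" using SM0 cS by (auto simp: operator_on_def)
  then show ?thesis
  proof (rule that[OF _ M0M])
    show "{x \<in> M. S x = 0} \<subseteq> M0" using ker unfolding M0_def by blast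
    show "S ` M0 = M0" using SM0 onto by blast
    show "(\<Inter>n. (S ^^ n) ` M) \<subseteq> M0" unfolding M0_def by (rule order_refl)
  qed (rule pre)
qed

text \<open>A preimage \<open>x\<close> under \<open>S\<close> leaves the residual
  \<open>\<mu> *\<^sub>C x\<close> for the shift, and the bound on \<open>\<mu>\<close> makes this
  at most half.\<close>

lemma shift_preimage_small:
  assumes S: "operator_on M0 S" and K: "K > 0" and \<mu>: "cmod \<mu> * K \<le> 1 / 2"
    and pre: "\<And>y. y \<in> M0 \<Longrightarrow> \<exists>x\<in>M0. S x = y \<and> norm x \<le> K * norm y" and y: "y \<in> M0"
  shows "\<exists>x\<in>M0. shift S \<mu> x = y \<and> norm x \<le> 2 * K * norm y"
proof (rule successive_approximation[OF operator_on_bounded_linear[OF operator_on_shift[OF S]]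
    operator_on_subspace[OF S] operator_on_closed[OF S] less_imp_le[OF K] _ y])
  fix y assume y: "y \<in> M0"
  then obtain x where x: "x \<in> M0" "S x = y" "norm x \<le> K * norm y" using pre by blast
  have eq: "y - shift S \<mu> x = \<mu> *\<^sub>C x" using x(2) by (simp add: shift_def)
  have "norm (\<mu> *\<^sub>C x) \<le> cmod \<mu> * (K * norm y)" unfolding norm_scaleC by (intro mult_left_mono x) simp
  also have "\<dots> \<le> norm y / 2" using mult_right_mono[OF \<mu> norm_ge_zero[of y]] by (simp add: mult.assoc)
  finally show "\<exists>x\<in>M0. norm x \<le> K * norm y \<and> norm (y - shift S \<mu> x) \<le> norm y / 2 \<and> y - shift S \<mu> x \<in> M0"
    using x complex_vector.subspace_scale[OF operator_on_csubspace[OF S] x(1), of \<mu>] by (intro bexI[of _ x]) (auto simp: eq)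
qed

text \<open>The source of all stability: shifts stay onto on \<open>M0\<close> with uniformly
  bounded preimages, and \<open>S\<close> is bounded below modulo \<open>M0\<close>. The former
  corrects kernel vectors, both together give preimages with a constant independent of
  \<open>\<mu>\<close>, and closed ranges follow.\<close>

lemma Kato_kernel_approximation:
  assumes S: "operator_on M S" and Ka: "Kato M S"
  obtains r C where "r > 0" "C > 0"
    "\<And>\<mu> x. cmod \<mu> < r \<Longrightarrow> x \<in> M \<Longrightarrow> S x = 0 \<Longrightarrow> \<exists>w. x + w \<in> M \<and> shift S \<mu> (x + w) = 0 \<and> norm w \<le> C * cmod \<mu> * norm x"
    "\<And>\<mu> x. cmod \<mu> < r \<Longrightarrow> x \<in> M \<Longrightarrow> \<exists>z\<in>M. shift S \<mu> z = shift S \<mu> x \<and> norm z \<le> C * norm (shift S \<mu> x)"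
    "\<And>\<mu>. cmod \<mu> < r \<Longrightarrow> Kato M (shift S \<mu>)"
proof -
  note cS = operator_on_clinear[OF S] and sM = operator_on_csubspace[OF S]
  obtain M0 where M0: "operator_on M0 S" "M0 \<subseteq> M" "{x \<in> M. S x = 0} \<subseteq> M0" "S ` M0 = M0"
    "\<And>x. x \<in> M \<Longrightarrow> S x \<in> M0 \<Longrightarrow> x \<in> M0" "(\<Inter>n. (S ^^ n) ` M) \<subseteq> M0"
    by (rule Kato_hyperrange[OF S Ka]) (rule that)
  note sM0 = operator_on_csubspace[OF M0(1)]
  have M00: "0 \<in> M0" by (rule complex_vector.subspace_0[OF sM0])
  obtain K where K: "K > 0" "\<And>y. y \<in> S ` M \<Longrightarrow> \<exists>x\<in>M. S x = y \<and> norm x \<le> K * norm y"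
    using closed_range_preimages[OF S] Ka by (metis Kato_def)
  have K0: "\<exists>x\<in>M0. S x = y \<and> norm x \<le> K * norm y" if y: "y \<in> M0" for y
  proof -
    have "y \<in> S ` M" using y M0(2,4) by blast
    then obtain x where "x \<in> M" "S x = y" "norm x \<le> K * norm y" using K(2) by blast
    then show ?thesis using M0(5) y by blast
  qed
  obtain s where s: "s > 0" "\<And>x. norm (S x) \<le> s * norm x" using bounded_clinear_bound[OF cS] by blast
  define r where "r = 1 / (2 * K)"
  have r: "r > 0" using K(1) by (simp add: r_def)
  have small: "cmod \<mu> * K \<le> 1 / 2" if "cmod \<mu> < r" for \<mu>
    using that K(1) by (simp add: r_def field_simps)
  have P: "\<exists>x\<in>M0. shift S \<mu> x = y \<and> norm x \<le> 2 * K * norm y" if "cmod \<mu> < r" "y \<in> M0" for \<mu> y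
    by (rule shift_preimage_small[OF M0(1) K(1) small[OF that(1)] K0 that(2)])
  \<comment> \<open>The first \<open>2 * K\<close> serves the kernel vectors. The rest bounds the
    preimage constructed below: \<open>3 * K\<close> for the part \<open>x - m\<close>, and
    \<open>2 * K\<close> times the bound on \<open>shift S \<mu> m\<close> for the part
    \<open>m'\<close>.\<close>
  define C where "C = 2 * K + (3 * K + 2 * K * (1 + (s + r) * (3 * K)))"
  have C: "C > 0" "2 * K \<le> C" "3 * K + 2 * K * (1 + (s + r) * (3 * K)) \<le> C"
    unfolding C_def using K(1) s(1) r by (auto intro!: add_pos_pos mult_pos_pos add_nonneg_nonneg)
  have approx: "\<exists>w. x + w \<in> M \<and> shift S \<mu> (x + w) = 0 \<and> norm w \<le> C * cmod \<mu> * norm x"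
    if \<mu>: "cmod \<mu> < r" and x: "x \<in> M" "S x = 0" for \<mu> x
  proof -
    have xM0: "x \<in> M0" using x M0(3) by blast
    obtain w where w: "w \<in> M0" "shift S \<mu> w = \<mu> *\<^sub>C x" "norm w \<le> 2 * K * norm (\<mu> *\<^sub>C x)"
      using P[OF \<mu> complex_vector.subspace_scale[OF sM0 xM0]] by blast
    have "shift S \<mu> (x + w) = shift S \<mu> x + shift S \<mu> w"
      by (rule bounded_clinear_plus[OF bounded_clinear_shift[OF cS]])
    also have "\<dots> = 0" using x(2) by (simp add: w(2)) (simp add: shift_def)
    finally have "shift S \<mu> (x + w) = 0" .
    moreover have "x + w \<in> M" using complex_vector.subspace_add[OF sM x(1)] w(1) M0(2) by blast
    moreover have "norm w \<le> C * cmod \<mu> * norm x"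
    proof -
      have "norm w \<le> 2 * K * (cmod \<mu> * norm x)" using w(3) by (simp add: norm_scaleC)
      also have "\<dots> \<le> C * (cmod \<mu> * norm x)" by (intro mult_right_mono C) simp
      finally show ?thesis by (simp add: mult.assoc)
    qed
    ultimately show ?thesis by blast
  qed
  have pre: "\<exists>z\<in>M. shift S \<mu> z = shift S \<mu> x \<and> norm z \<le> C * norm (shift S \<mu> x)"
    if \<mu>: "cmod \<mu> < r" and x: "x \<in> M" for \<mu> x
  proof (cases "shift S \<mu> x = 0")
    case True
    then show ?thesis
      using complex_vector.subspace_0[OF sM] bounded_clinear_0[OF bounded_clinear_shift[OF cS]]
      by (intro bexI[of _ 0]) auto
  next
    case False
    let ?y = "shift S \<mu> x" and ?d = "infdist x M0"
    \<comment> \<open>Boundedness below modulo \<open>M0\<close>: for \<open>m\<close> in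
      \<open>M0\<close> near \<open>x\<close>, a preimage \<open>z\<close> of
      \<open>S x - \<mu> *\<^sub>C m\<close> satisfies \<open>x - z \<in> M0\<close>, so
      \<open>norm z\<close> bounds the distance. The distance recurs on the right with a factor of
      at most one half and is absorbed.\<close>
    have "?d \<le> 2 * K * norm ?y + e" if e: "e > 0" for e
    proof -
      obtain m where m: "m \<in> M0" "dist x m < ?d + e" using infdist_almost_attained[of M0 e x] M00 e by blast
      have "S x - \<mu> *\<^sub>C m \<in> S ` M"
        using complex_vector.subspace_diff[OF csubspace_image[OF cS sM] imageI[OF x]]
          complex_vector.subspace_scale[OF sM0 m(1), of \<mu>] M0(2,4) by blast
      then obtain z where z: "z \<in> M" "S z = S x - \<mu> *\<^sub>C m" "norm z \<le> K * norm (S x - \<mu> *\<^sub>C m)"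
        using K(2) by blast
      have "S (x - z) = \<mu> *\<^sub>C m" using z(2) by (simp add: bounded_clinear_minus[OF cS])
      then have "S (x - z) \<in> M0" using complex_vector.subspace_scale[OF sM0 m(1), of \<mu>] by simp
      then have "x - z \<in> M0" using M0(5) complex_vector.subspace_diff[OF sM x z(1)] by blast
      then have "?d \<le> dist x (x - z)" by (rule infdist_le)
      also have "\<dots> = norm z" by (simp add: dist_norm)
      also have "\<dots> \<le> K * (norm ?y + cmod \<mu> * (?d + e))"
      proof -
        have "S x - \<mu> *\<^sub>C m = ?y + \<mu> *\<^sub>C (x - m)" by (simp add: shift_def complex_vector.scale_right_diff_distrib)
        then have "norm (S x - \<mu> *\<^sub>C m) \<le> norm ?y + cmod \<mu> * dist x m"
          by (metis norm_triangle_ineq norm_scaleC dist_norm)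
        also have "\<dots> \<le> norm ?y + cmod \<mu> * (?d + e)"
          using m(2) by (intro add_left_mono mult_left_mono) auto
        finally show ?thesis using z(3) K(1) by (meson less_imp_le mult_left_mono order_trans)
      qed
      also have "\<dots> = K * norm ?y + (cmod \<mu> * K) * (?d + e)" by (simp add: algebra_simps)
      also have "\<dots> \<le> K * norm ?y + (1/2) * (?d + e)"
        using small[OF \<mu>] infdist_nonneg[of x M0] e by (intro add_left_mono mult_right_mono) auto
      finally show ?thesis by argo
    qed
    then have "?d \<le> 2 * K * norm ?y" by (rule field_le_epsilon)
    \<comment> \<open>The slack of \<open>K * norm ?y\<close> is positive since the case of a zero
      image was split off.\<close>
    then obtain m where m: "m \<in> M0" "dist x m < 3 * K * norm ?y"
      using infdist_almost_attained[of M0 "K * norm ?y" x] M00 K(1) False by fastforce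
    have "shift S \<mu> m \<in> M0" by (rule operator_on_in[OF operator_on_shift[OF M0(1)] m(1)])
    \<comment> \<open>The part \<open>m\<close> may be large, so it is exchanged for a controlled
      vector of \<open>M0\<close> with the same image.\<close>
    then obtain m' where m': "m' \<in> M0" "shift S \<mu> m' = shift S \<mu> m" "norm m' \<le> 2 * K * norm (shift S \<mu> m)"
      using P[OF \<mu>] by blast
    let ?z = "x - m + m'"
    have zM: "?z \<in> M"
      using complex_vector.subspace_add[OF sM complex_vector.subspace_diff[OF sM x]] m(1) m'(1) M0(2) by blast
    have zy: "shift S \<mu> ?z = ?y"
      using m'(2) by (simp add: bounded_clinear_simps[OF bounded_clinear_shift[OF cS]])
    have "norm (shift S \<mu> (x - m)) \<le> norm (S (x - m)) + norm (\<mu> *\<^sub>C (x - m))"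
      unfolding shift_def by (rule norm_triangle_ineq4)
    also have "\<dots> \<le> s * norm (x - m) + r * norm (x - m)"
      unfolding norm_scaleC using \<mu> by (intro add_mono s mult_right_mono) auto
    also have "\<dots> = (s + r) * norm (x - m)" by (simp add: algebra_simps)
    also have "\<dots> \<le> (s + r) * (3 * K * norm ?y)"
      using m(2) s(1) r by (intro mult_left_mono) (auto simp: dist_norm)
    finally have 1: "norm (shift S \<mu> (x - m)) \<le> (s + r) * (3 * K * norm ?y)" .
    have "shift S \<mu> m = ?y - shift S \<mu> (x - m)"
      by (simp add: bounded_clinear_simps[OF bounded_clinear_shift[OF cS]])
    then have "norm (shift S \<mu> m) \<le> norm ?y + (s + r) * (3 * K * norm ?y)"
      using norm_triangle_ineq4[of ?y "shift S \<mu> (x - m)"] 1 by simp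
    then have "norm m' \<le> 2 * K * (norm ?y + (s + r) * (3 * K * norm ?y))"
      using m'(3) K(1) by (meson less_imp_le mult_left_mono mult_nonneg_nonneg order_trans zero_le_numeral)
    moreover have "norm ?z \<le> norm (x - m) + norm m'" by (rule norm_triangle_ineq)
    ultimately have "norm ?z \<le> 3 * K * norm ?y + 2 * K * (norm ?y + (s + r) * (3 * K * norm ?y))"
      using m(2) by (simp add: dist_norm)
    also have "\<dots> = (3 * K + 2 * K * (1 + (s + r) * (3 * K))) * norm ?y" by (simp add: algebra_simps)
    also have "\<dots> \<le> C * norm ?y" by (intro mult_right_mono C) simp
    finally show ?thesis using zM zy by blast
  qed
  have Ks: "Kato M (shift S \<mu>)" if \<mu>: "cmod \<mu> < r" for \<mu>
    unfolding Kato_def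
  proof (intro conjI allI)
    show "closed (shift S \<mu> ` M)"
      by (rule closed_image_if_bounded_preimages[OF operator_on_bounded_linear[OF operator_on_shift[OF S]]
          operator_on_subspace[OF S] operator_on_closed[OF S] pre[OF \<mu>]])
    fix n
    have "M0 = (shift S \<mu> ^^ k) ` M0" for k
    proof (induction k)
      case (Suc k)
      have "shift S \<mu> ` M0 = M0"
        using P[OF \<mu>] operator_on_in[OF operator_on_shift[OF M0(1)]] by blast
      then show ?case using Suc by (metis funpow_Suc_right funpow_swap1 image_comp)
    qed simp
    then have M0sub: "M0 \<subseteq> (shift S \<mu> ^^ n) ` M" using M0(2) by (metis image_mono)
    \<comment> \<open>For \<open>\<mu> \<noteq> 0\<close> the powers of \<open>S\<close> only
      rescale the eigenvector \<open>x\<close>, which therefore lies in all their ranges.\<close>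
    have "x \<in> M0" if x: "x \<in> M" "shift S \<mu> x = 0" for x
    proof (cases "\<mu> = 0")
      case True
      then show ?thesis using x M0(3) by (auto simp: shift_def)
    next
      case False
      have Sx: "S x = \<mu> *\<^sub>C x" using x by (simp add: shift_def)
      have pow: "(S ^^ k) x = (\<mu> ^ k) *\<^sub>C x" for k
        by (induction k) (auto simp: bounded_clinear_scale[OF cS] Sx scaleC_one scaleC_scaleC mult.commute)
      show ?thesis
      proof (rule subsetD[OF M0(6)], rule INT_I)
        fix k
        have "(S ^^ k) ((1 / \<mu> ^ k) *\<^sub>C x) = x"
          using False by (simp add: bounded_clinear_scale[OF bounded_clinear_funpow[OF cS]] pow scaleC_scaleC scaleC_one)
        then show "x \<in> (S ^^ k) ` M" using complex_vector.subspace_scale[OF sM x(1)] by (metis imageI)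
      qed
    qed
    then show "{x \<in> M. shift S \<mu> x = 0} \<subseteq> (shift S \<mu> ^^ n) ` M" using M0sub by blast
  qed
  show ?thesis by (rule that[OF r C(1) approx pre Ks])
qed

section \<open>Semicontinuity of nullity and defect\<close>

lemma csubspace_range: "operator_on M S \<Longrightarrow> csubspace (S ` M)"
  by (intro csubspace_image operator_on_clinear operator_on_csubspace)

lemma range_subset: "operator_on M S \<Longrightarrow> S ` M \<subseteq> M"
  by (simp add: operator_on_def)

lemma
  assumes S: "operator_on M S"
  shows nullity_ge_iff: "enat m \<le> nullity M S \<longleftrightarrow>
      (\<exists>B\<subseteq>{x \<in> M. S x = 0}. finite B \<and> complex_vector.independent B \<and> card B = m)"
    and nullity_le_iff: "nullity M S \<le> enat m \<longleftrightarrow>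
      (\<exists>B. finite B \<and> card B \<le> m \<and> {x \<in> M. S x = 0} \<subseteq> cspan B)"
  unfolding nullity_def
  by (rule edim_ge_iff edim_le_iff, rule csubspace_kernel[OF operator_on_clinear[OF S] operator_on_csubspace[OF S]])+

lemma
  assumes S: "operator_on M S"
  shows defect_ge_iff: "enat m \<le> defect M S \<longleftrightarrow>
      (\<exists>B\<subseteq>M. finite B \<and> complex_vector.independent B \<and> card B = m \<and> S ` M \<inter> cspan B = {0})"
    and defect_le_iff: "defect M S \<le> enat m \<longleftrightarrow>
      (\<exists>B\<subseteq>M. finite B \<and> card B \<le> m \<and> M \<subseteq> {u + v | u v. u \<in> S ` M \<and> v \<in> cspan B})"
  unfolding defect_def
  by (rule ecodim_ge_iff[OF operator_on_csubspace csubspace_range range_subset, OF S S S]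
      ecodim_le_iff[OF operator_on_csubspace csubspace_range range_subset, OF S S S])+

text \<open>Kernel vectors of \<open>S\<close> become kernel vectors of the shift after a correction
  proportional to \<open>cmod \<mu>\<close>, and small corrections preserve independence.\<close>

lemma nullity_lower_semicontinuous:
  assumes S: "operator_on M S" and Ka: "Kato M S" and ge: "enat m \<le> nullity M S"
  shows "\<exists>\<epsilon>>0. \<forall>\<mu>. cmod \<mu> < \<epsilon> \<longrightarrow> enat m \<le> nullity M (shift S \<mu>)"
proof -
  obtain r C where r: "r > 0" "C > 0" and approx: "\<And>\<mu> x. cmod \<mu> < r \<Longrightarrow> x \<in> M \<Longrightarrow> S x = 0 \<Longrightarrow>
      \<exists>w. x + w \<in> M \<and> shift S \<mu> (x + w) = 0 \<and> norm w \<le> C * cmod \<mu> * norm x"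
    by (rule Kato_kernel_approximation[OF S Ka]) blast
  obtain B where B: "B \<subseteq> {x \<in> M. S x = 0}" "finite B" "complex_vector.independent B" "card B = m"
    using ge unfolding nullity_ge_iff[OF S] by blast
  obtain \<delta> where \<delta>: "\<delta> > 0" "\<And>w. (\<And>e. e \<in> B \<Longrightarrow> norm (w e) \<le> \<delta>) \<Longrightarrow>
      inj_on (\<lambda>e. e + w e) B \<and> complex_vector.independent ((\<lambda>e. e + w e) ` B)"
    using independent_perturb[OF B(2,3)] by metis
  \<comment> \<open>A common bound for the norms in \<open>B\<close>, positive also for empty
    \<open>B\<close>.\<close>
  define b where "b = (\<Sum>e\<in>B. norm e) + 1"
  have b: "b > 0" unfolding b_def by (rule add_nonneg_pos) (auto intro: sum_nonneg)
  have be: "norm e \<le> b" if "e \<in> B" for e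
    using member_le_sum[of e B norm] that B(2) by (simp add: b_def)
  have "enat m \<le> nullity M (shift S \<mu>)" if \<mu>: "cmod \<mu> < min r (\<delta> / (C * b))" for \<mu>
  proof -
    have "\<forall>e\<in>B. \<exists>w. e + w \<in> M \<and> shift S \<mu> (e + w) = 0 \<and> norm w \<le> C * cmod \<mu> * norm e"
      using approx B(1) \<mu> by auto
    then obtain w where w: "\<And>e. e \<in> B \<Longrightarrow> e + w e \<in> M" "\<And>e. e \<in> B \<Longrightarrow> shift S \<mu> (e + w e) = 0"
      "\<And>e. e \<in> B \<Longrightarrow> norm (w e) \<le> C * cmod \<mu> * norm e" by metis
    have "norm (w e) \<le> \<delta>" if "e \<in> B" for e
    proof -
      have "C * cmod \<mu> * norm e \<le> C * cmod \<mu> * b" using be[OF that] r(2) by (intro mult_left_mono) auto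
      also have "\<dots> = cmod \<mu> * (C * b)" by simp
      also have "\<dots> \<le> \<delta> / (C * b) * (C * b)" using \<mu> b r(2) by (intro mult_right_mono) auto
      also have "\<dots> = \<delta>" using b r(2) by simp
      finally show ?thesis using w(3)[OF that] by simp
    qed
    then have *: "inj_on (\<lambda>e. e + w e) B" "complex_vector.independent ((\<lambda>e. e + w e) ` B)"
      using \<delta>(2) by blast+
    show ?thesis
      unfolding nullity_ge_iff[OF operator_on_shift[OF S]]
      using * w B(2,4) by (intro exI[of _ "(\<lambda>e. e + w e) ` B"]) (auto simp: card_image)
  qed
  moreover have "min r (\<delta> / (C * b)) > 0" using r \<delta>(1) b by simp
  ultimately show ?thesis by blast
qed

text \<open>A projection \<open>P\<close> onto the kernel of \<open>S\<close> is injective on the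
  kernel of a small shift, so the dimension cannot grow.\<close>

lemma nullity_upper_semicontinuous:
  assumes S: "operator_on M S" and cl: "closed (S ` M)" and le: "nullity M S \<le> enat m"
  shows "\<exists>\<epsilon>>0. \<forall>\<mu>. cmod \<mu> < \<epsilon> \<longrightarrow> nullity M (shift S \<mu>) \<le> enat m"
proof -
  note cS = operator_on_clinear[OF S] and sM = operator_on_csubspace[OF S]
  let ?N = "{x \<in> M. S x = 0}"
  obtain K where K: "K > 0" "\<And>y. y \<in> S ` M \<Longrightarrow> \<exists>x\<in>M. S x = y \<and> norm x \<le> K * norm y"
    using closed_range_preimages[OF S cl] by metis
  obtain F where F: "finite F" "card F \<le> m" "?N \<subseteq> cspan F"
    using le unfolding nullity_le_iff[OF S] by blast
  obtain B where B: "B \<subseteq> ?N" "complex_vector.independent B" "?N \<subseteq> cspan B"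
    by (rule complex_vector.basis_exists[of ?N])
  have finB: "finite B" "card B \<le> m"
    using independent_in_span_card[OF B(2) _ F(1)] B(1) F(2,3) by (meson order_trans)+
  have disj: "{0} \<inter> cspan B = {0}" using complex_vector.span_zero[of B] by blast
  obtain P where P: "bounded_clinear P" "\<And>x. P x \<in> cspan B" "\<And>v. v \<in> cspan B \<Longrightarrow> P v = v"
    using finite_rank_projection[OF complex_vector.subspace_single_0 closed_singleton finB(1) B(2) disj] by metis
  obtain p where p: "p > 0" "\<And>x. norm (P x) \<le> p * norm x" using bounded_clinear_bound[OF P(1)] by blast
  define \<epsilon> where "\<epsilon> = 1 / (K * (1 + p))"
  have "nullity M (shift S \<mu>) \<le> enat m" if \<mu>: "cmod \<mu> < \<epsilon>" for \<mu>
  proof (rule ccontr)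
    assume "\<not> nullity M (shift S \<mu>) \<le> enat m"
    then have "enat (Suc m) \<le> nullity M (shift S \<mu>)" by (cases "nullity M (shift S \<mu>)") auto
    then obtain D where D: "D \<subseteq> {x \<in> M. shift S \<mu> x = 0}" "finite D" "complex_vector.independent D" "card D = Suc m"
      unfolding nullity_ge_iff[OF operator_on_shift[OF S]] by blast
    have spD: "cspan D \<subseteq> {x \<in> M. shift S \<mu> x = 0}"
      by (rule complex_vector.span_minimal[OF D(1) csubspace_kernel[OF bounded_clinear_shift[OF cS] sM]])
    \<comment> \<open>If \<open>x\<close> is a bounded preimage of
      \<open>S z = \<mu> *\<^sub>C z\<close>, then \<open>z - x\<close> is fixed by
      \<open>P\<close>, so \<open>z = x - P x\<close>. The choice of \<open>\<epsilon>\<close>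
      bounds \<open>norm z\<close> by a factor below 1 times itself.\<close>
    have zero: "z = 0" if z: "z \<in> M" "shift S \<mu> z = 0" "P z = 0" for z
    proof -
      have Sz: "S z = \<mu> *\<^sub>C z" using z(2) by (simp add: shift_def)
      obtain x where x: "x \<in> M" "S x = S z" "norm x \<le> K * norm (S z)" using K(2) z(1) by blast
      have "z - x \<in> ?N" using complex_vector.subspace_diff[OF sM z(1) x(1)] x(2) by (simp add: bounded_clinear_minus[OF cS])
      then have "P (z - x) = z - x" using B(3) P(3) by blast
      then have "z = x - P x" by (simp add: bounded_clinear_minus[OF P(1)] z(3) algebra_simps)
      then have "norm z \<le> norm x + norm (P x)" by (metis norm_triangle_ineq4)
      also have "\<dots> \<le> (1 + p) * norm x" using p(2)[of x] by (simp add: algebra_simps)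
      also have "\<dots> \<le> (1 + p) * (K * (cmod \<mu> * norm z))"
        using x(3) p(1) by (intro mult_left_mono) (auto simp: Sz norm_scaleC)
      also have "\<dots> = (cmod \<mu> * (K * (1 + p))) * norm z" by (simp add: algebra_simps)
      finally have le: "norm z \<le> (cmod \<mu> * (K * (1 + p))) * norm z" .
      have "cmod \<mu> * (K * (1 + p)) < 1"
        using \<mu> K(1) p(1) by (simp add: \<epsilon>_def pos_less_divide_eq)
      then show "z = 0" using le mult_strict_right_mono[of _ 1 "norm z"] by (cases "z = 0") fastforce+
    qed
    interpret P: Vector_Spaces.linear scaleC scaleC P by (rule bounded_clinear_linear[OF P(1)])
    have inj: "inj_on P (cspan D)"
    proof (rule inj_onI)
      fix x y assume xy: "x \<in> cspan D" "y \<in> cspan D" "P x = P y"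
      then have "x - y \<in> cspan D" by (intro complex_vector.span_diff)
      then have "x - y \<in> {x \<in> M. shift S \<mu> x = 0}" by (rule subsetD[OF spD])
      moreover have "P (x - y) = 0" using xy(3) by (simp add: bounded_clinear_minus[OF P(1)])
      ultimately have "x - y = 0" using zero by blast
      then show "x = y" by simp
    qed
    then have "complex_vector.independent (P ` D)"
      unfolding cspan_def by (rule P.independent_injective_image[OF D(3)])
    then have "card (P ` D) \<le> card B" using independent_in_span_card[of "P ` D" B] P(2) finB(1) by blast
    moreover have "card (P ` D) = card D"
      by (rule card_image) (rule inj_on_subset[OF inj complex_vector.span_superset])
    ultimately show False using finB(2) D(4) by simp
  qed
  moreover have "\<epsilon> > 0" using K(1) p(1) by (simp add: \<epsilon>_def)
  ultimately show ?thesis by blast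
qed

text \<open>The same family \<open>B\<close> stays independent modulo the range. If \<open>c\<close>
  in its span is the shifted image of \<open>z\<close>, applying the projection that kills the range
  of \<open>S\<close> leaves \<open>c = - (\<mu> *\<^sub>C P z)\<close>, and the bound on
  \<open>z\<close>, uniform in \<open>\<mu>\<close>, forces \<open>c = 0\<close>.\<close>

lemma defect_lower_semicontinuous:
  assumes S: "operator_on M S" and Ka: "Kato M S" and ge: "enat m \<le> defect M S"
  shows "\<exists>\<epsilon>>0. \<forall>\<mu>. cmod \<mu> < \<epsilon> \<longrightarrow> enat m \<le> defect M (shift S \<mu>)"
proof -
  note cS = operator_on_clinear[OF S] and sM = operator_on_csubspace[OF S]
  obtain r C where r: "r > 0" "C > 0" and pre: "\<And>\<mu> x. cmod \<mu> < r \<Longrightarrow> x \<in> M \<Longrightarrow>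
      \<exists>z\<in>M. shift S \<mu> z = shift S \<mu> x \<and> norm z \<le> C * norm (shift S \<mu> x)"
    by (rule Kato_kernel_approximation[OF S Ka]) blast
  obtain B where B: "B \<subseteq> M" "finite B" "complex_vector.independent B" "card B = m" "S ` M \<inter> cspan B = {0}"
    using ge unfolding defect_ge_iff[OF S] by blast
  have cl: "closed (S ` M)" using Ka by (simp add: Kato_def)
  obtain P where P: "bounded_clinear P" "\<And>v. v \<in> cspan B \<Longrightarrow> P v = v" "\<And>w. w \<in> S ` M \<Longrightarrow> P w = 0"
    using finite_rank_projection[OF csubspace_range[OF S] cl B(2,3,5)] by metis
  obtain p where p: "p > 0" "\<And>x. norm (P x) \<le> p * norm x" using bounded_clinear_bound[OF P(1)] by blast
  have "enat m \<le> defect M (shift S \<mu>)" if \<mu>: "cmod \<mu> < min r (1 / (p * C))" for \<mu>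
  proof -
    have "c = 0" if c: "c \<in> shift S \<mu> ` M" "c \<in> cspan B" for c
    proof -
      obtain z where z: "z \<in> M" "shift S \<mu> z = c" "norm z \<le> C * norm c" using pre c(1) \<mu> by force
      have "c = P (S z - \<mu> *\<^sub>C z)" using P(2)[OF c(2)] z(2) by (simp add: shift_def)
      then have "c = - (\<mu> *\<^sub>C P z)" using P(3)[OF imageI[OF z(1)]] by (simp add: bounded_clinear_simps[OF P(1)])
      then have "norm c = cmod \<mu> * norm (P z)" by (metis norm_minus_cancel norm_scaleC)
      also have "\<dots> \<le> cmod \<mu> * (p * (C * norm c))"
        using p z(3) by (intro mult_left_mono order_trans[OF p(2)]) auto
      also have "\<dots> = (cmod \<mu> * (p * C)) * norm c" by (simp add: algebra_simps)
      finally have le: "norm c \<le> (cmod \<mu> * (p * C)) * norm c" .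
      have "cmod \<mu> * (p * C) < 1" using \<mu> r(2) p(1) by (simp add: pos_less_divide_eq)
      then show "c = 0" using le mult_strict_right_mono[of _ 1 "norm c"] by (cases "c = 0") fastforce+
    qed
    then have "shift S \<mu> ` M \<inter> cspan B = {0}"
      using complex_vector.span_zero[of B] complex_vector.subspace_0[OF csubspace_range[OF operator_on_shift[OF S]]] by blast
    then show ?thesis
      unfolding defect_ge_iff[OF operator_on_shift[OF S]]
      using B by blast
  qed
  moreover have "min r (1 / (p * C)) > 0" using r p(1) by simp
  ultimately show ?thesis by blast
qed

text \<open>Range and span of \<open>B\<close> together fill \<open>M\<close>, i.e. the map taking
  \<open>(x, v)\<close> to \<open>S x + v\<close> is onto, and surjectivity survives a small shift:
  the pair of a bounded preimage of \<open>y - P y\<close> and of \<open>P y\<close> is an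
  approximate solution.\<close>

lemma defect_upper_semicontinuous:
  assumes S: "operator_on M S" and cl: "closed (S ` M)" and le: "defect M S \<le> enat m"
  shows "\<exists>\<epsilon>>0. \<forall>\<mu>. cmod \<mu> < \<epsilon> \<longrightarrow> defect M (shift S \<mu>) \<le> enat m"
proof -
  note cS = operator_on_clinear[OF S] and sM = operator_on_csubspace[OF S]
  obtain K where K: "K > 0" "\<And>y. y \<in> S ` M \<Longrightarrow> \<exists>x\<in>M. S x = y \<and> norm x \<le> K * norm y"
    using closed_range_preimages[OF S cl] by metis
  obtain B where B: "B \<subseteq> M" "finite B" "complex_vector.independent B" "card B \<le> m"
    "S ` M \<inter> cspan B = {0}" "M \<subseteq> {u + v | u v. u \<in> S ` M \<and> v \<in> cspan B}"
    by (rule ecodim_le_complement[OF operator_on_csubspace[OF S] csubspace_range[OF S] range_subset[OF S] le[unfolded defect_def]])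
  have spB: "cspan B \<subseteq> M" by (rule complex_vector.span_minimal[OF B(1) sM])
  obtain P where P: "bounded_clinear P" "\<And>x. P x \<in> cspan B" "\<And>v. v \<in> cspan B \<Longrightarrow> P v = v"
    "\<And>w. w \<in> S ` M \<Longrightarrow> P w = 0"
    using finite_rank_projection[OF csubspace_range[OF S] cl B(2,3,5)] by metis
  obtain p where p: "p > 0" "\<And>x. norm (P x) \<le> p * norm x" using bounded_clinear_bound[OF P(1)] by blast
  define \<epsilon> where "\<epsilon> = 1 / (2 * (K * (1 + p)))"
  have "defect M (shift S \<mu>) \<le> enat m" if \<mu>: "cmod \<mu> < \<epsilon>" for \<mu>
  proof -
    let ?T = "\<lambda>q :: 'a \<times> 'a. shift S \<mu> (fst q) + snd q"
    have T: "bounded_linear ?T"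
      by (intro bounded_linear_add bounded_linear_snd
          bounded_linear_compose[OF operator_on_bounded_linear[OF operator_on_shift[OF S]] bounded_linear_fst])
    have V: "subspace (M \<times> cspan B)" "closed (M \<times> cspan B)"
      using operator_on_subspace[OF S] operator_on_closed[OF S] closed_cspan[OF B(2)]
        csubspace_imp_subspace[OF complex_vector.subspace_span]
      by (auto intro: subspace_Times closed_Times)
    have step: "\<exists>q\<in>M \<times> cspan B. norm q \<le> (K * (1 + p) + p) * norm y \<and> norm (y - ?T q) \<le> norm y / 2 \<and> y - ?T q \<in> M"
      if y: "y \<in> M" for y
    proof -
      obtain u v where uv: "u \<in> S ` M" "v \<in> cspan B" "y = u + v" using B(6) y by blast
      have "y - P y = u" using uv P(3,4) by (simp add: bounded_clinear_plus[OF P(1)])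
      then obtain x where x: "x \<in> M" "S x = y - P y" "norm x \<le> K * norm (y - P y)" using K(2) uv(1) by blast
      have "norm (y - P y) \<le> (1 + p) * norm y"
        using norm_triangle_ineq4[of y "P y"] p(2)[of y] by (simp add: algebra_simps)
      then have nx: "norm x \<le> K * (1 + p) * norm y"
        using x(3) K(1) by (metis less_imp_le mult.assoc mult_left_mono order_trans)
      have "norm (x, P y) \<le> norm x + norm (P y)" by (rule norm_Pair_le)
      then have "norm (x, P y) \<le> (K * (1 + p) + p) * norm y" using nx p(2)[of y] by (simp add: algebra_simps)
      moreover have eq: "y - ?T (x, P y) = \<mu> *\<^sub>C x" using x(2) by (simp add: shift_def)
      moreover have "norm (\<mu> *\<^sub>C x) \<le> norm y / 2"
      proof -
        have "norm (\<mu> *\<^sub>C x) \<le> cmod \<mu> * (K * (1 + p) * norm y)"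
          unfolding norm_scaleC by (intro mult_left_mono nx) simp
        also have "\<dots> = (cmod \<mu> * (K * (1 + p))) * norm y" by (simp add: mult.assoc)
        also have "\<dots> \<le> (1 / 2) * norm y"
          using \<mu> K(1) p(1) by (intro mult_right_mono) (auto simp: \<epsilon>_def pos_less_divide_eq)
        finally show ?thesis by simp
      qed
      moreover have "\<mu> *\<^sub>C x \<in> M" by (rule complex_vector.subspace_scale[OF sM x(1)])
      ultimately show ?thesis using x(1) P(2) by (intro bexI[of _ "(x, P y)"]) auto
    qed
    have c: "K * (1 + p) + p \<ge> 0" using K(1) p(1) by simp
    have "M \<subseteq> {u + v | u v. u \<in> shift S \<mu> ` M \<and> v \<in> cspan B}"
    proof
      fix y assume "y \<in> M"
      from successive_approximation[OF T V c step this]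
      obtain x v where "x \<in> M" "v \<in> cspan B" "shift S \<mu> x + v = y" by auto
      then show "y \<in> {u + v | u v. u \<in> shift S \<mu> ` M \<and> v \<in> cspan B}" by blast
    qed
    then show ?thesis
      unfolding defect_le_iff[OF operator_on_shift[OF S]]
      using B(1,2,4) by blast
  qed
  moreover have "\<epsilon> > 0" using K(1) p(1) by (simp add: \<epsilon>_def)
  ultimately show ?thesis by blast
qed

text \<open>Both kinds of sublevel and superlevel sets are open, so each finite level is relatively
  clopen. Infinite values need no test of their own: if one of two values is finite, the argument
  starts from that point.\<close>

lemma enat_constant_on_connected:
  fixes h :: "'b::metric_space \<Rightarrow> enat"
  assumes U: "open U" "connected U"
    and ge: "\<And>x m. x \<in> U \<Longrightarrow> enat m \<le> h x \<Longrightarrow> \<exists>\<epsilon>>0. \<forall>y. dist y x < \<epsilon> \<longrightarrow> enat m \<le> h y"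
    and le: "\<And>x m. x \<in> U \<Longrightarrow> h x \<le> enat m \<Longrightarrow> \<exists>\<epsilon>>0. \<forall>y. dist y x < \<epsilon> \<longrightarrow> h y \<le> enat m"
    and x: "x \<in> U" and y: "y \<in> U"
  shows "h x = h y"
proof -
  have op: "open {z \<in> U. enat m \<le> h z}" "open {z \<in> U. h z \<le> enat m}" for m
    unfolding open_dist using U(1)[unfolded open_dist] ge le
    by (safe; metis (no_types, lifting) min_less_iff_conj mem_Collect_eq)+
  have main: "h z = h w" if z: "z \<in> U" and w: "w \<in> U" and fin: "h z = enat k" for z w k
  proof (rule ccontr)
    assume ne: "h z \<noteq> h w"
    let ?A = "{v \<in> U. enat k \<le> h v} \<inter> {v \<in> U. h v \<le> enat k}"
    \<comment> \<open>At \<open>k = 0\<close> there is nothing below, and truncated subtraction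
      would make the second set overlap \<open>?A\<close>.\<close>
    let ?B = "{v \<in> U. enat (Suc k) \<le> h v} \<union> (if k = 0 then {} else {v \<in> U. h v \<le> enat (k - 1)})"
    have "open ?A" "open ?B" using op by (auto intro: open_Int open_Un)
    moreover have "U \<subseteq> ?A \<union> ?B"
    proof
      fix v assume v: "v \<in> U"
      show "v \<in> ?A \<union> ?B" using v by (cases "h v") auto
    qed
    moreover have "?A \<inter> ?B \<inter> U = {}"
    proof -
      have False if "v \<in> ?A" "v \<in> ?B" for v using that by (cases "h v") (auto split: if_splits)
      then show ?thesis by blast
    qed
    moreover have "z \<in> ?A" using z fin by simp
    moreover have "w \<notin> ?A" using ne fin by auto
    ultimately show False using connectedD[OF U(2), of ?A ?B] z w by blast
  qed
  show ?thesis
  proof (cases "h x")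
    case (enat k)
    then show ?thesis using main[OF x y] by blast
  next
    case infinity
    then show ?thesis using main[OF y x] by (cases "h y") auto
  qed
qed

text \<open>Semicontinuity at the centre alone would not do: for infinite nullity it yields a radius
  for each \<open>m\<close>, with no common one. Since every shift in the disc is Kato, it applies
  at each point, and connectedness of the disc gives constancy.\<close>

theorem Kato_stable:
  assumes S: "operator_on M S" and Ka: "Kato M S"
  obtains r where "r > 0" "\<And>\<mu>. cmod \<mu> < r \<Longrightarrow> Kato M (shift S \<mu>)"
    "\<And>\<mu>. cmod \<mu> < r \<Longrightarrow> nullity M (shift S \<mu>) = nullity M S"
    "\<And>\<mu>. cmod \<mu> < r \<Longrightarrow> defect M (shift S \<mu>) = defect M S"
proof -
  have "\<exists>r>0. \<forall>\<mu>. cmod \<mu> < r \<longrightarrow> Kato M (shift S \<mu>)"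
  proof (rule Kato_kernel_approximation[OF S Ka])
    fix r :: real
    assume "r > 0" "\<And>\<mu>. cmod \<mu> < r \<Longrightarrow> Kato M (shift S \<mu>)"
    then show ?thesis by (intro exI[of _ r] conjI allI impI)
  qed
  then obtain r where r: "r > 0" "\<And>\<mu>. cmod \<mu> < r \<Longrightarrow> Kato M (shift S \<mu>)" by metis
  note Sh = operator_on_shift[OF S]
  \<comment> \<open>Moves the semicontinuity statements, which concern small shifts of one operator,
    from the centre to an arbitrary \<open>\<mu>\<close>.\<close>
  have loc: "\<exists>\<epsilon>>0. \<forall>\<nu>. dist \<nu> \<mu> < \<epsilon> \<longrightarrow> Q (shift S \<nu>)"
    if "\<exists>\<epsilon>>0. \<forall>\<nu>. cmod \<nu> < \<epsilon> \<longrightarrow> Q (shift (shift S \<mu>) \<nu>)" for Q \<mu>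
  proof -
    from that obtain \<epsilon> where \<epsilon>: "\<epsilon> > 0" "\<forall>\<nu>. cmod \<nu> < \<epsilon> \<longrightarrow> Q (shift (shift S \<mu>) \<nu>)"
      by (elim exE conjE)
    have "Q (shift S \<nu>)" if "dist \<nu> \<mu> < \<epsilon>" for \<nu>
      using \<epsilon>(2)[rule_format, of "\<nu> - \<mu>"] that by (simp add: dist_norm shift_shift)
    then show ?thesis using \<epsilon>(1) by (intro exI[of _ \<epsilon>] conjI allI impI)
  qed
  have cl: "closed (shift S \<mu> ` M)" if "\<mu> \<in> ball 0 r" for \<mu>
    using r(2)[of \<mu>] that by (simp add: Kato_def)
  have K: "Kato M (shift S \<mu>)" if "\<mu> \<in> ball 0 r" for \<mu> using r(2)[of \<mu>] that by simp
  have S0: "shift S 0 = S" by (simp add: shift_def)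
  have "nullity M (shift S \<mu>) = nullity M (shift S 0)" if "cmod \<mu> < r" for \<mu>
    by (rule enat_constant_on_connected[of "ball 0 r" "\<lambda>\<mu>. nullity M (shift S \<mu>)"])
      (use that r(1) in \<open>auto intro!: loc nullity_lower_semicontinuous[OF Sh] nullity_upper_semicontinuous[OF Sh] cl K\<close>)
  moreover have "defect M (shift S \<mu>) = defect M (shift S 0)" if "cmod \<mu> < r" for \<mu>
    by (rule enat_constant_on_connected[of "ball 0 r" "\<lambda>\<mu>. defect M (shift S \<mu>)"])
      (use that r(1) in \<open>auto intro!: loc defect_lower_semicontinuous[OF Sh] defect_upper_semicontinuous[OF Sh] cl K\<close>)
  ultimately show ?thesis using that[OF r] unfolding S0 by blast
qed

section \<open>Kato decomposition of semi-Fredholm operators\<close>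

text \<open>The map taking \<open>(x, v)\<close> to \<open>S x + v\<close> is onto \<open>M\<close>
  for a finite dimensional complement of the range. Applied to \<open>S x\<close>, the open mapping
  theorem gives a preimage whose second entry is 0, the sum being direct, hence a bounded preimage
  under \<open>S\<close>.\<close>

lemma finite_defect_closed_range:
  assumes S: "operator_on M S" and fin: "defect M S < \<infinity>"
  shows "closed (S ` M)"
proof -
  note cS = operator_on_clinear[OF S] and sM = operator_on_csubspace[OF S]
  obtain m where m: "defect M S \<le> enat m" using fin by (cases "defect M S") auto
  obtain B where B: "B \<subseteq> M" "finite B" "complex_vector.independent B" "card B \<le> m"
    "S ` M \<inter> cspan B = {0}" "M \<subseteq> {u + v | u v. u \<in> S ` M \<and> v \<in> cspan B}"
    by (rule ecodim_le_complement[OF sM csubspace_range[OF S] range_subset[OF S] m[unfolded defect_def]])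
  have spB: "cspan B \<subseteq> M" by (rule complex_vector.span_minimal[OF B(1) sM])
  let ?T = "\<lambda>q :: 'a \<times> 'a. S (fst q) + snd q" and ?V = "M \<times> cspan B"
  have T: "bounded_linear ?T"
    by (intro bounded_linear_add bounded_linear_snd
        bounded_linear_compose[OF operator_on_bounded_linear[OF S] bounded_linear_fst])
  have V: "subspace ?V" "closed ?V"
    using operator_on_subspace[OF S] operator_on_closed[OF S] closed_cspan[OF B(2)]
      csubspace_imp_subspace[OF complex_vector.subspace_span]
    by (auto intro: subspace_Times closed_Times)
  have TV: "?T ` ?V = M"
  proof
    show "?T ` ?V \<subseteq> M" using operator_on_in[OF S] spB complex_vector.subspace_add[OF sM] by auto
    show "M \<subseteq> ?T ` ?V"
    proof
      fix y assume "y \<in> M"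
      then obtain x v where "x \<in> M" "v \<in> cspan B" "y = ?T (x, v)" using B(6) by fastforce
      then show "y \<in> ?T ` ?V" by blast
    qed
  qed
  have clTV: "closed (?T ` ?V)" unfolding TV by (rule operator_on_closed[OF S])
  obtain K where K: "K > 0" "\<And>y. y \<in> M \<Longrightarrow> \<exists>q\<in>?V. ?T q = y \<and> norm q \<le> K * norm y"
    using open_mapping[OF T V clTV] unfolding TV by metis
  show ?thesis
  proof (rule closed_image_if_bounded_preimages[OF operator_on_bounded_linear[OF S]
        operator_on_subspace[OF S] operator_on_closed[OF S]])
    fix x assume x: "x \<in> M"
    obtain z v where zv: "z \<in> M" "v \<in> cspan B" "S z + v = S x" "norm (z, v) \<le> K * norm (S x)"
      using K(2)[OF operator_on_in[OF S x]] by auto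
    have "v = S (x - z)" using zv(3) by (simp add: bounded_clinear_minus[OF cS] algebra_simps)
    then have "v \<in> S ` M \<inter> cspan B" using zv(2) complex_vector.subspace_diff[OF sM x zv(1)] by blast
    then have "v = 0" using B(5) by blast
    then show "\<exists>z\<in>M. S z = S x \<and> norm z \<le> K * norm (S x)" using zv by (intro bexI[of _ z]) auto
  qed
qed

section \<open>Splitting off a Jordan chain\<close>

lemma cfunctional_simps:
  assumes "cfunctional f"
  shows "f 0 = 0" "f (x + y) = f x + f y" "f (x - y) = f x - f y" "f (c *\<^sub>C x) = c * f x"
    "f (\<Sum>i\<in>I. h i) = (\<Sum>i\<in>I. f (h i))"
  using assms by (auto simp: cfunctional_def linear_simps linear_sum[OF bounded_linear.linear])

lemma cfunctional_compose: "cfunctional f \<Longrightarrow> bounded_clinear S \<Longrightarrow> cfunctional (\<lambda>x. f (S x))"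
  by (simp add: cfunctional_def bounded_clinear_def bounded_linear_compose)

text \<open>The vector \<open>x\<close> can be corrected by multiples of \<open>S x, \<dots>, S\<^sup>k x\<close> so that \<open>f\<close> sees only the
  last vector of the Jordan chain.\<close>

lemma Jordan_chain_normalize:
  assumes S: "operator_on M S" and f: "cfunctional f"
    and x: "x \<in> M" "S ((S ^^ k) x) = 0" "f ((S ^^ k) x) = 1"
  obtains x' where "x' \<in> M" "(S ^^ k) x' = (S ^^ k) x" "\<And>j. j < k \<Longrightarrow> f ((S ^^ j) x') = 0"
proof -
  note cS = operator_on_clinear[OF S] and sM = operator_on_csubspace[OF S]
  have vanish: "(S ^^ m) y = 0" if "(S ^^ k) y = (S ^^ k) x" "k < m" for m y
  proof -
    have m: "m = (m - Suc k) + Suc k" using \<open>k < m\<close> by simp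
    have "(S ^^ m) y = (S ^^ (m - Suc k)) (S ((S ^^ k) y))" by (subst m, subst funpow_add) simp
    then show ?thesis using that(1) x(2) bounded_clinear_0[OF bounded_clinear_funpow[OF cS]] by simp
  qed
  have "\<exists>y\<in>M. (S ^^ k) y = (S ^^ k) x \<and> (\<forall>j. t \<le> j \<and> j < k \<longrightarrow> f ((S ^^ j) y) = 0)" if "t \<le> k" for t
    using that
  proof (induction t rule: inc_induct)
    case base
    show ?case using x(1) by (intro bexI[of _ x]) auto
  next
    case (step t)
    then obtain y where y: "y \<in> M" "(S ^^ k) y = (S ^^ k) x" "\<And>j. Suc t \<le> j \<Longrightarrow> j < k \<Longrightarrow> f ((S ^^ j) y) = 0"
      by blast
    \<comment> \<open>Since \<open>S ^^ (k - t)\<close> moves index \<open>t\<close> to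
      \<open>k\<close>, where \<open>f\<close> is 1, this cancels the value at \<open>t\<close>; at
      larger indices the added term is beyond the end of the chain and vanishes.\<close>
    let ?c = "f ((S ^^ t) y)"
    let ?y = "y - ?c *\<^sub>C (S ^^ (k - t)) y"
    have pow: "(S ^^ j) ?y = (S ^^ j) y - ?c *\<^sub>C (S ^^ (j + (k - t))) y" for j
      by (simp add: bounded_clinear_simps[OF bounded_clinear_funpow[OF cS]] funpow_add)
    have "?y \<in> M"
      by (intro complex_vector.subspace_diff[OF sM] complex_vector.subspace_scale[OF sM] y(1)
          operator_on_in[OF operator_on_funpow[OF S]])
    moreover have "(S ^^ k) ?y = (S ^^ k) x"
      using vanish[OF y(2), of "k + (k - t)"] step.hyps y(2) unfolding pow by simp
    moreover have "f ((S ^^ j) ?y) = 0" if j: "t \<le> j" "j < k" for j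
    proof (cases "j = t")
      case True
      have "t + (k - t) = k" using step.hyps by simp
      then show ?thesis unfolding True pow by (simp add: cfunctional_simps[OF f] y(2) x(3))
    next
      case False
      then have "(S ^^ (j + (k - t))) y = 0" using j by (intro vanish[OF y(2)]) simp
      then show ?thesis unfolding pow using y(3)[of j] j False by simp
    qed
    ultimately show ?case by blast
  qed
  from this[of 0] that show ?thesis by auto
qed

text \<open>A kernel vector \<open>e\<close> outside the range of a power ends a chain from
  \<open>x\<close> to \<open>e = (S ^^ k) x\<close>. A projection \<open>P\<close> onto the chain
  commuting with \<open>S\<close> moves it from \<open>M\<close> to the quasinilpotent part. The
  chain holds one kernel direction, \<open>e\<close>, and one direction outside the range,
  \<open>x\<close>; hence both numbers drop by exactly one.\<close>

lemma Jordan_chain_removal: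
  assumes S: "bounded_clinear S" and red: "(M, N) \<in> Red S" and qn: "quasinilpotent N S"
    and cl: "closed (S ` M)" and nK: "\<not> Kato M S"
  obtains M' N' where "(M', N') \<in> Red S" "quasinilpotent N' S" "closed (S ` M')"
    "nullity M S = nullity M' S + 1" "defect M S = defect M' S + 1"
proof -
  note M = Red_operator_on_left[OF S red] and N = Red_operator_on_right[OF S red]
  note sM = operator_on_csubspace[OF M] and sN = operator_on_csubspace[OF N]
  note SnM = operator_on_in[OF operator_on_funpow[OF M]]
  note pow = bounded_clinear_simps[OF bounded_clinear_funpow[OF S]]
  let ?ker = "{x \<in> M. S x = 0}"
  obtain E where E: "bounded_clinear E" "\<And>x. E x \<in> M" "\<And>x. x - E x \<in> N" "\<And>x. x \<in> M \<Longrightarrow> E x = x"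
    "\<And>x. x \<in> N \<Longrightarrow> E x = 0" "\<And>x. E (S x) = S (E x)" using Red_projection[OF S red] by metis
  have ES: "E ((S ^^ i) z) = (S ^^ i) (E z)" for i z by (induction i) (simp_all add: E(6))
  \<comment> \<open>Minimality is used twice: \<open>e\<close> is still in the range of
    \<open>S ^^ k\<close>, and the range of \<open>S ^^ n\<close> is closed, so that
    \<open>e\<close> can be separated from it.\<close>
  define n where "n = (LEAST n. \<not> ?ker \<subseteq> (S ^^ n) ` M)"
  have ex: "\<exists>n. \<not> ?ker \<subseteq> (S ^^ n) ` M" using nK cl by (auto simp: Kato_def)
  have n: "\<not> ?ker \<subseteq> (S ^^ n) ` M" unfolding n_def by (rule LeastI_ex[OF ex])
  have less: "?ker \<subseteq> (S ^^ j) ` M" if "j < n" for j using not_less_Least[of j] that unfolding n_def by blast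
  have "n \<noteq> 0" using n by (intro notI) auto
  then obtain k where k: "n = Suc k" using not0_implies_Suc by blast
  obtain e where e: "e \<in> ?ker" "e \<notin> (S ^^ n) ` M" using n by blast
  obtain x0 where x0: "x0 \<in> M" "e = (S ^^ k) x0" using less[of k] e(1) k by blast
  obtain f where f: "cfunctional f" "\<And>w. w \<in> (S ^^ n) ` M \<Longrightarrow> f w = 0" "f e = 1"
    using Hahn_Banach_separation[OF csubspace_image[OF bounded_clinear_funpow[OF S] sM]
        closed_range_funpow[OF M cl less] e(2)] by metis
  \<comment> \<open>Composing with \<open>E\<close> makes the functional ignore \<open>N\<close>, so
    that \<open>P\<close> below vanishes on \<open>N\<close>.\<close>
  define g where "g = (\<lambda>z. f (E z))"
  have g: "cfunctional g" unfolding g_def by (rule cfunctional_compose[OF f(1) E(1)])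
  have gM: "g z = f z" if "z \<in> M" for z using that by (simp add: g_def E(4))
  have gE: "g ((S ^^ i) (E z)) = g ((S ^^ i) z)" for i z using E(2,4) by (simp add: g_def ES)
  have gn: "g ((S ^^ m) z) = 0" if "k < m" for m z
  proof -
    have m: "m = n + (m - n)" using that k by simp
    have "E ((S ^^ m) z) = (S ^^ n) ((S ^^ (m - n)) (E z))" unfolding ES by (subst m, subst funpow_add) simp
    then show ?thesis using f(2) SnM[OF E(2)] by (simp add: g_def)
  qed
  have Sx0: "S ((S ^^ k) x0) = 0" using e(1) x0(2) by simp
  have gx0: "g ((S ^^ k) x0) = 1" using e(1) x0(2) f(3) gM by simp
  obtain x where x: "x \<in> M" "(S ^^ k) x = (S ^^ k) x0" "\<And>j. j < k \<Longrightarrow> g ((S ^^ j) x) = 0"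
    by (rule Jordan_chain_normalize[OF M g x0(1) Sx0 gx0]) (rule that)
  have xe: "(S ^^ k) x = e" using x(2) x0(2) by simp
  have gx: "g ((S ^^ j) x) = (if j = k then 1 else 0)" for j
    using x(3)[of j] gn[of j x] gx0 x(2) by (cases j k rule: linorder_cases) auto
  have Sx: "(S ^^ m) x = 0" if "k < m" for m
  proof -
    have m: "m = (m - Suc k) + Suc k" using that by simp
    have "(S ^^ m) x = (S ^^ (m - Suc k)) (S ((S ^^ k) x))" by (subst m, subst funpow_add) simp
    then show ?thesis using x(2) Sx0 by (simp add: pow)
  qed
  \<comment> \<open>After normalization, \<open>g\<close> applied to
    \<open>(S ^^ (k - j)) ((S ^^ i) x)\<close> is 1 for \<open>i = j\<close> and 0 otherwise: these
    functionals are dual to the chain.\<close>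
  define P where "P = (\<lambda>z. \<Sum>j<Suc k. g ((S ^^ (k - j)) z) *\<^sub>C (S ^^ j) x)"
  have P: "bounded_clinear P" unfolding P_def
    by (intro bounded_clinear_sum bounded_clinear_scaleC_functional cfunctional_compose[OF g] bounded_clinear_funpow S)
  have PM: "P z \<in> M" for z unfolding P_def
    by (intro complex_vector.subspace_sum[OF sM] complex_vector.subspace_scale[OF sM] SnM x(1))
  have Px: "P ((S ^^ i) x) = (S ^^ i) x" if "i \<le> k" for i
  proof -
    have "P ((S ^^ i) x) = (\<Sum>j<Suc k. if j = i then (S ^^ j) x else 0)"
      unfolding P_def
    proof (intro sum.cong refl)
      fix j assume "j \<in> {..<Suc k}"
      then have j: "j \<le> k" by simp
      have "(S ^^ (k - j)) ((S ^^ i) x) = (S ^^ (k - j + i)) x" by (simp add: funpow_add)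
      moreover have "k - j + i = k \<longleftrightarrow> j = i" using j that by auto
      ultimately show "g ((S ^^ (k - j)) ((S ^^ i) x)) *\<^sub>C (S ^^ j) x = (if j = i then (S ^^ j) x else 0)"
        by (simp add: gx scaleC_one)
    qed
    also have "\<dots> = (S ^^ i) x" using that by simp
    finally show ?thesis .
  qed
  have PP: "P (P z) = P z" for z
  proof -
    have eq: "P z = (\<Sum>j<Suc k. g ((S ^^ (k - j)) z) *\<^sub>C (S ^^ j) x)" by (simp only: P_def)
    have "P (P z) = (\<Sum>j<Suc k. g ((S ^^ (k - j)) z) *\<^sub>C P ((S ^^ j) x))"
      unfolding eq bounded_clinear_setsum[OF P] bounded_clinear_scale[OF P] by (rule refl)
    also have "\<dots> = P z" unfolding eq by (intro sum.cong refl) (simp add: Px)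
    finally show ?thesis .
  qed
  have PE: "P (E z) = P z" for z by (simp only: P_def gE)
  have EP: "E (P z) = P z" for z by (rule E(4)[OF PM])
  \<comment> \<open>Both sides agree up to an index shift. The boundary terms vanish because
    \<open>g\<close> kills images of powers beyond \<open>k\<close> and \<open>S\<close> kills the
    end of the chain.\<close>
  have PS: "P (S z) = S (P z)" for z
  proof -
    have "P (S z) = (\<Sum>j<k. g ((S ^^ (k - Suc j)) (S z)) *\<^sub>C (S ^^ Suc j) x)"
      unfolding P_def sum.lessThan_Suc_shift using gn[of "Suc k" z] by (simp add: funpow_swap1)
    also have "\<dots> = (\<Sum>j<k. S (g ((S ^^ (k - j)) z) *\<^sub>C (S ^^ j) x))"
    proof (intro sum.cong refl)
      fix j assume "j \<in> {..<k}"
      then have "k - j = Suc (k - Suc j)" by auto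
      then show "g ((S ^^ (k - Suc j)) (S z)) *\<^sub>C (S ^^ Suc j) x = S (g ((S ^^ (k - j)) z) *\<^sub>C (S ^^ j) x)"
        by (simp add: bounded_clinear_scale[OF S] funpow_swap1)
    qed
    also have "\<dots> = S (P z)"
      unfolding P_def using Sx[of "Suc k"]
      by (simp add: bounded_clinear_setsum[OF S] bounded_clinear_plus[OF S] bounded_clinear_scale[OF S])
    finally show ?thesis .
  qed
  have SnP: "(S ^^ m) (P z) = 0" if "k < m" for m z
  proof -
    have "(S ^^ m) (P z) = (\<Sum>j<Suc k. g ((S ^^ (k - j)) z) *\<^sub>C (S ^^ (m + j)) x)"
      unfolding P_def by (simp add: bounded_clinear_setsum[OF bounded_clinear_funpow[OF S]] pow funpow_add del: sum.lessThan_Suc)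
    also have "\<dots> = 0" using that by (intro sum.neutral) (simp add: Sx)
    finally show ?thesis .
  qed
  \<comment> \<open>This functional reads off the coefficient of \<open>x\<close>, the head of the
    chain, and so vanishes where \<open>P\<close> does.\<close>
  have gkP: "g ((S ^^ k) (P z)) = g ((S ^^ k) z)" for z
  proof -
    have "g ((S ^^ k) (P z)) = (\<Sum>j<Suc k. g ((S ^^ (k - j)) z) * g ((S ^^ (k + j)) x))"
      unfolding P_def by (simp add: bounded_clinear_setsum[OF bounded_clinear_funpow[OF S]] pow funpow_add
          cfunctional_simps[OF g] del: sum.lessThan_Suc)
    also have "\<dots> = (\<Sum>j<Suc k. if j = 0 then g ((S ^^ k) z) else 0)"
      by (intro sum.cong refl) (auto simp: gx)
    finally show ?thesis by simp
  qed
  \<comment> \<open>The projection onto the part of \<open>M\<close> killed by \<open>P\<close>; its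
    kernel consists of \<open>N\<close> and the chain.\<close>
  define E' where "E' = (\<lambda>z. E z - P z)"
  have E': "bounded_clinear E'" unfolding E'_def by (rule bounded_clinear_diff[OF E(1) P])
  have E'E': "E' (E' z) = E' z" for z
    by (simp add: E'_def bounded_clinear_minus[OF E(1)] bounded_clinear_minus[OF P] EP PE PP E(2,4))
  have E'S: "E' (S z) = S (E' z)" for z by (simp add: E'_def E(6) PS bounded_clinear_minus[OF S])
  let ?M' = "{z. E' z = z}" and ?N' = "{z. E' z = 0}"
  have red': "(?M', ?N') \<in> Red S" by (rule projection_Red[OF S E' E'E' E'S])
  note M' = Red_operator_on_left[OF S red'] and N' = Red_operator_on_right[OF S red']
  have M'_iff: "z \<in> ?M' \<longleftrightarrow> z \<in> M \<and> P z = 0" for z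
  proof
    assume "z \<in> ?M'"
    then have z: "E z - P z = z" by (simp add: E'_def)
    then have "E (E z - P z) = E z" by simp
    then have "P z = 0" by (simp add: bounded_clinear_minus[OF E(1)] EP E(2,4))
    then show "z \<in> M \<and> P z = 0" using z E(2)[of z] by simp
  qed (simp add: E'_def E(4))
  have M'I: "z - P z \<in> ?M'" if "z \<in> M" for z
    unfolding M'_iff using that PM complex_vector.subspace_diff[OF sM] by (simp add: bounded_clinear_minus[OF P] PP)
  \<comment> \<open>On the new summand \<open>E z = P z\<close> lies in the chain, which powers
    beyond \<open>k\<close> annihilate; these powers therefore see only \<open>z - E z\<close> in
    \<open>N\<close>.\<close>
  have qn': "quasinilpotent ?N' S"
  proof -
    have "bounded_clinear (\<lambda>z. z - E z)" by (intro bounded_clinear_diff bounded_clinear_ident E)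
    then obtain c where c: "\<And>z. norm (z - E z) \<le> c * norm z" using bounded_clinear_bound by metis
    show ?thesis
    proof (rule quasinilpotent_dominated[OF S _ S _ qn])
      show "0 \<in> N" "0 \<in> ?N'" by (intro complex_vector.subspace_0 sN operator_on_csubspace[OF N'])+
      fix m z assume m: "Suc k \<le> m" and z: "z \<in> ?N'"
      have "E z = P z" using z by (simp add: E'_def)
      then have "(S ^^ m) z = (S ^^ m) (z - E z)" using SnP[of m z] m by (simp add: pow)
      then show "\<exists>y\<in>N. norm y \<le> c * norm z \<and> norm ((S ^^ m) z) \<le> norm ((S ^^ m) y)"
        using c E(3) by (metis order_refl)
    qed
  qed
  have rng: "S ` ?M' = S ` M \<inter> P -` {0}"
  proof (intro set_eqI iffI)
    fix y assume "y \<in> S ` ?M'"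
    then obtain z where z: "z \<in> ?M'" "y = S z" by blast
    then show "y \<in> S ` M \<inter> P -` {0}" using M'_iff[of z] by (simp add: PS bounded_clinear_0[OF S])
  next
    fix y assume "y \<in> S ` M \<inter> P -` {0}"
    then obtain z where z: "z \<in> M" "y = S z" "P (S z) = 0" by auto
    then have "y = S (z - P z)" by (simp add: bounded_clinear_minus[OF S] PS)
    then show "y \<in> S ` ?M'" using M'I[OF z(1)] by blast
  qed
  have cl': "closed (S ` ?M')" unfolding rng
    using cl by (intro closed_Int closed_vimage bounded_clinear_continuous[OF P]) auto
  have ge: "g e = 1" using gx[of k] xe by simp
  have Pe: "P e = e" using Px[of k] xe by simp
  have "nullity M S = nullity ?M' S + 1"
    unfolding nullity_def
  proof (rule edim_add_vector[OF csubspace_kernel[OF S operator_on_csubspace[OF M']]])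
    show "e \<notin> {x \<in> ?M'. S x = 0}"
      using M'_iff[of e] Pe ge cfunctional_simps(1)[OF g] by auto
    show "?ker = {v + c *\<^sub>C e | v c. v \<in> {x \<in> ?M'. S x = 0}}"
    proof (intro set_eqI iffI)
      fix z assume z: "z \<in> ?ker"
      have "P z = g z *\<^sub>C e"
      proof -
        have "P z = (\<Sum>j<Suc k. if j = k then g z *\<^sub>C e else 0)"
          unfolding P_def
        proof (intro sum.cong refl)
          fix j assume "j \<in> {..<Suc k}"
          moreover have "(S ^^ (k - j)) z = 0" if "j < k"
          proof -
            have "k - j = Suc (k - Suc j)" using that by simp
            then show ?thesis using z by (simp add: funpow_swap1 pow del: funpow.simps)
              (simp add: funpow_swap1 pow)
          qed
          ultimately show "g ((S ^^ (k - j)) z) *\<^sub>C (S ^^ j) x = (if j = k then g z *\<^sub>C e else 0)"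
            by (auto simp: xe cfunctional_simps(1)[OF g])
        qed
        then show ?thesis by simp
      qed
      moreover have "S (z - P z) = 0" using z PS[of z] bounded_clinear_0[OF P] by (simp add: bounded_clinear_minus[OF S])
      moreover have "z = (z - P z) + P z" by simp
      moreover have "z - P z \<in> ?M'" using M'I z by simp
      ultimately have "z = (z - P z) + g z *\<^sub>C e" "z - P z \<in> {x \<in> ?M'. S x = 0}" by simp_all
      then show "z \<in> {v + c *\<^sub>C e | v c. v \<in> {x \<in> ?M'. S x = 0}}" by blast
    next
      fix z assume "z \<in> {v + c *\<^sub>C e | v c. v \<in> {x \<in> ?M'. S x = 0}}"
      then obtain v c where "z = v + c *\<^sub>C e" "v \<in> ?M'" "S v = 0" by blast
      then show "z \<in> ?ker"
        using e(1) M'_iff[of v] complex_vector.subspace_add[OF sM] complex_vector.subspace_scale[OF sM]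
        by (simp add: bounded_clinear_simps[OF S])
    qed
  qed
  moreover have "defect M S = defect ?M' S + 1"
  proof -
    obtain C where C: "alg_complement ?M' (S ` ?M') C"
      by (rule alg_complement_exists[OF operator_on_csubspace[OF M'] csubspace_range[OF M'] range_subset[OF M']])
    have sC: "csubspace C" using C by (simp add: alg_complement_def)
    have sum: "{r + c |r c. r \<in> S ` ?M' \<and> c \<in> C} = ?M'" using C unfolding alg_complement_def by blast
    have CM': "C \<subseteq> ?M'"
    proof
      fix c assume "c \<in> C"
      then have "0 + c \<in> {r + c |r c. r \<in> S ` ?M' \<and> c \<in> C}"
        using complex_vector.subspace_0[OF csubspace_range[OF M']] by blast
      then show "c \<in> ?M'" unfolding sum by simp
    qed
    let ?C = "{c + t *\<^sub>C x | c t. c \<in> C}"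
    have x_nz: "x \<noteq> 0" using gx[of k] by (auto simp: pow cfunctional_simps(1)[OF g])
    have xC: "x \<notin> C" using Px[of 0] x_nz M'_iff[of x] CM' by auto
    have CM: "c + t *\<^sub>C x \<in> M" if "c \<in> C" for c t
      using CM' that M'_iff[of c] x(1) complex_vector.subspace_add[OF sM] complex_vector.subspace_scale[OF sM] by blast
    have "?C = {c + v | c v. c \<in> C \<and> v \<in> cspan {x}}" unfolding complex_vector.span_singleton by blast
    then have sC': "csubspace ?C" using csubspace_add_span[OF sC, of "{x}"] by simp
    have "alg_complement M (S ` M) ?C" unfolding alg_complement_def
    proof (intro conjI sC')
      have "y = 0" if y: "y \<in> S ` M" "y \<in> ?C" for y
      proof -
        obtain m c t where mct: "m \<in> M" "y = S m" "y = c + t *\<^sub>C x" "c \<in> C" using y by blast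
        have Pc: "P c = 0" using mct(4) CM' M'_iff[of c] by blast
        have "g ((S ^^ k) y) = 0" using gn[of "Suc k" m] mct(2) by (simp add: funpow_swap1)
        moreover have "g ((S ^^ k) c) = 0" using gkP[of c] Pc by (simp add: pow cfunctional_simps[OF g])
        ultimately have "t = 0" using gx[of k] mct(3) by (simp add: pow cfunctional_simps[OF g])
        then have yc: "y = c" using mct(3) by simp
        then have "y = S (m - P m)" using Pc mct(2) PS[of m] by (simp add: bounded_clinear_minus[OF S])
        then have "y \<in> S ` ?M' \<inter> C" using M'I[OF mct(1)] mct(4) yc by blast
        then show "y = 0" using C unfolding alg_complement_def by blast
      qed
      then show "S ` M \<inter> ?C = {0}"
        using complex_vector.subspace_0[OF csubspace_range[OF M]] complex_vector.subspace_0[OF sC'] by blast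
      show "{r + c |r c. r \<in> S ` M \<and> c \<in> ?C} = M"
      proof
        show "{r + c |r c. r \<in> S ` M \<and> c \<in> ?C} \<subseteq> M"
          using range_subset[OF M] CM complex_vector.subspace_add[OF sM] by blast
        show "M \<subseteq> {r + c |r c. r \<in> S ` M \<and> c \<in> ?C}"
        proof
          fix m assume m: "m \<in> M"
          obtain m1 c where mc: "m1 \<in> ?M'" "c \<in> C" "m - P m = S m1 + c"
            using C M'I[OF m] unfolding alg_complement_def by blast
          \<comment> \<open>All chain vectors after \<open>x\<close> are images under
            \<open>S\<close>; \<open>u\<close> collects preimages, so that only a multiple of
            \<open>x\<close> is left for the complement.\<close>
          define u where "u = (\<Sum>j<k. g ((S ^^ (k - Suc j)) m) *\<^sub>C (S ^^ j) x)"
          have uM: "u \<in> M" unfolding u_def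
            by (intro complex_vector.subspace_sum[OF sM] complex_vector.subspace_scale[OF sM] SnM x(1))
          have "P m = g ((S ^^ k) m) *\<^sub>C x + S u"
            unfolding P_def sum.lessThan_Suc_shift u_def
            by (simp add: bounded_clinear_setsum[OF S] bounded_clinear_scale[OF S])
          then have "m = S (m1 + u) + (c + g ((S ^^ k) m) *\<^sub>C x)"
            using mc(3) by (simp add: bounded_clinear_plus[OF S] algebra_simps)
          moreover have "m1 + u \<in> M" using mc(1) M'_iff[of m1] uM complex_vector.subspace_add[OF sM] by blast
          ultimately show "m \<in> {r + c |r c. r \<in> S ` M \<and> c \<in> ?C}" using mc(2) by blast
        qed
      qed
    qed
    then have "defect M S = edim ?C" unfolding defect_def by (rule ecodim_eq[OF csubspace_range[OF M]])
    also have "\<dots> = edim C + 1" by (rule edim_add_vector[OF sC xC refl])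
    also have "edim C = defect ?M' S" unfolding defect_def by (rule ecodim_eq[OF csubspace_range[OF M'] C, symmetric])
    finally show ?thesis .
  qed
  ultimately show ?thesis using that[OF red' qn' cl'] by blast
qed

text \<open>Induction on whichever of nullity and defect is finite, as each removal lowers it by
  one. At zero no removal is possible, so the operator is Kato.\<close>

theorem Kato_decomposition:
  assumes S: "bounded_clinear S" and red: "(M, N) \<in> Red S" and qn: "quasinilpotent N S"
    and cl: "closed (S ` M)" and fin: "nullity M S < \<infinity> \<or> defect M S < \<infinity>"
  obtains M' N' k where "(M', N') \<in> Red S" "quasinilpotent N' S" "Kato M' S"
    "nullity M S = nullity M' S + enat k" "defect M S = defect M' S + enat k"
proof -
  obtain p where "nullity M S = enat p \<or> defect M S = enat p" using fin by auto
  then have "\<exists>M' N' k. (M', N') \<in> Red S \<and> quasinilpotent N' S \<and> Kato M' S \<and>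
      nullity M S = nullity M' S + enat k \<and> defect M S = defect M' S + enat k"
    using red qn cl
  proof (induction p arbitrary: M N)
    case (0 M N)
    have "Kato M S"
    proof (rule ccontr)
      assume "\<not> Kato M S"
      then obtain M' N' where "nullity M S = nullity M' S + 1" "defect M S = defect M' S + 1"
        using Jordan_chain_removal[OF S 0(2,3,4)] by metis
      then show False using 0(1) by (auto simp flip: zero_enat_def)
    qed
    then show ?case using 0 by (intro exI[of _ M] exI[of _ N] exI[of _ 0]) (simp flip: zero_enat_def)
  next
    case (Suc p M N)
    show ?case
    proof (cases "Kato M S")
      case True
      then show ?thesis using Suc.prems by (intro exI[of _ M] exI[of _ N] exI[of _ 0]) (simp flip: zero_enat_def)
    next
      case False
      obtain M1 N1 where 1: "(M1, N1) \<in> Red S" "quasinilpotent N1 S" "closed (S ` M1)"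
        "nullity M S = nullity M1 S + 1" "defect M S = defect M1 S + 1"
        by (rule Jordan_chain_removal[OF S Suc.prems(2,3,4) False])
      have "nullity M1 S = enat p \<or> defect M1 S = enat p"
        using Suc.prems(1) unfolding 1(4,5) by (cases "nullity M1 S"; cases "defect M1 S") (auto simp: one_enat_def)
      from Suc.IH[OF this 1(1,2,3)] obtain M' N' k where k: "(M', N') \<in> Red S" "quasinilpotent N' S" "Kato M' S"
        "nullity M1 S = nullity M' S + enat k" "defect M1 S = defect M' S + enat k" by blast
      then show ?thesis unfolding 1(4,5)
        by (intro exI[of _ M'] exI[of _ N'] exI[of _ "Suc k"]) (simp add: add.assoc one_enat_def)
    qed
  qed
  then show ?thesis using that by blast
qed

section \<open>Generalized Kato spectra\<close>

definition has_GKD :: "(enat \<times> enat) set \<Rightarrow> ('a::complex_banach \<Rightarrow> 'a) \<Rightarrow> bool"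
  where "has_GKD C S \<longleftrightarrow> (\<exists>M N. (M, N) \<in> Red S \<and> Kato M S \<and> quasinilpotent N S \<and> (nullity M S, defect M S) \<in> C)"

definition GKD_spectrum :: "(enat \<times> enat) set \<Rightarrow> ('a::complex_banach \<Rightarrow> 'a) \<Rightarrow> complex set"
  where "GKD_spectrum C T = {\<mu>. \<not> has_GKD C (shift T \<mu>)}"

lemma Kato_if_injective:
  assumes S: "operator_on M S" and "closed (S ` M)" and "{x \<in> M. S x = 0} = {0}"
  shows "Kato M S"
proof -
  have "0 \<in> (S ^^ n) ` M" for n
    by (rule complex_vector.subspace_0[OF csubspace_range[OF operator_on_funpow[OF S]]])
  then show ?thesis using assms by (simp add: Kato_def)
qed

lemma Kato_if_surjective:
  assumes S: "operator_on M S" and onto: "S ` M = M"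
  shows "Kato M S"
proof -
  have "(S ^^ n) ` M = M" for n
  proof (induction n)
    case (Suc n)
    have "(S ^^ Suc n) ` M = S ` ((S ^^ n) ` M)" by (simp add: image_comp)
    then show ?case using Suc onto by simp
  qed simp
  then show ?thesis using onto operator_on_closed[OF S] by (auto simp: Kato_def)
qed

lemma Red_trivial:
  assumes S: "bounded_clinear S"
  shows "(UNIV, {0}) \<in> Red S" "quasinilpotent {0} S"
proof -
  show "(UNIV, {0}) \<in> Red S"
    by (rule RedI) (simp_all add: operator_on_def S bounded_clinear_0[OF S])
  show "quasinilpotent {0} S"
    unfolding quasinilpotent_iff[OF S singletonI] by (simp add: bounded_clinear_0[OF bounded_clinear_funpow[OF S]])
qed

lemma Red_shift:
  assumes S: "bounded_clinear S" and red: "(M, N) \<in> Red S"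
  shows "(M, N) \<in> Red (shift S \<mu>)"
  using Red_operator_on_left[OF assms] Red_operator_on_right[OF assms] Red_disjoint[OF assms] Red_sum[OF assms]
  by (intro RedI operator_on_shift)

text \<open>The radius comes from the Kato part alone, since on \<open>N\<close> every nonzero shift
  is bijective. A bijective summand adds nothing to kernel or defect, so the numbers on the whole
  space are those of \<open>M\<close>.\<close>

lemma GKD_punctured_neighbourhood:
  assumes T: "bounded_clinear T" and red: "(M, N) \<in> Red (shift T \<kappa>)"
    and Ka: "Kato M (shift T \<kappa>)" and qn: "quasinilpotent N (shift T \<kappa>)"
  obtains r where "r > 0" "\<And>\<mu>. dist \<mu> \<kappa> < r \<Longrightarrow> \<mu> \<noteq> \<kappa> \<Longrightarrow> Kato UNIV (shift T \<mu>) \<and>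
    nullity UNIV (shift T \<mu>) = nullity M (shift T \<kappa>) \<and> defect UNIV (shift T \<mu>) = defect M (shift T \<kappa>)"
proof -
  note S = bounded_clinear_shift[OF T, of \<kappa>]
  note M = Red_operator_on_left[OF S red] and N = Red_operator_on_right[OF S red]
  obtain r where r: "r > 0" "\<And>\<nu>. cmod \<nu> < r \<Longrightarrow> Kato M (shift (shift T \<kappa>) \<nu>)"
    "\<And>\<nu>. cmod \<nu> < r \<Longrightarrow> nullity M (shift (shift T \<kappa>) \<nu>) = nullity M (shift T \<kappa>)"
    "\<And>\<nu>. cmod \<nu> < r \<Longrightarrow> defect M (shift (shift T \<kappa>) \<nu>) = defect M (shift T \<kappa>)"
    by (rule Kato_stable[OF M Ka]) (rule that)
  show ?thesis
  proof (rule that[OF r(1)])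
    fix \<mu> assume \<mu>: "dist \<mu> \<kappa> < r" "\<mu> \<noteq> \<kappa>"
    let ?\<nu> = "\<mu> - \<kappa>"
    have eq: "shift (shift T \<kappa>) ?\<nu> = shift T \<mu>" by (simp add: shift_shift)
    have \<nu>: "cmod ?\<nu> < r" "?\<nu> \<noteq> 0" using \<mu> by (auto simp: dist_norm)
    note bij = quasinilpotent_shift_bijective[OF N qn \<nu>(2)]
    note tr = bounded_clinear_shift[OF S] Red_shift[OF S red] bij
    show "Kato UNIV (shift T \<mu>) \<and> nullity UNIV (shift T \<mu>) = nullity M (shift T \<kappa>) \<and>
        defect UNIV (shift T \<mu>) = defect M (shift T \<kappa>)"
      using Red_bijective_Kato[OF tr r(2)[OF \<nu>(1)]] Red_bijective_nullity[OF tr] Red_bijective_defect[OF tr]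
        r(3,4)[OF \<nu>(1)] unfolding eq by simp
  qed
qed

section \<open>Frontiers and connected hulls\<close>

lemma has_GKD_UNIV:
  "bounded_clinear S \<Longrightarrow> Kato UNIV S \<Longrightarrow> (nullity UNIV S, defect UNIV S) \<in> C \<Longrightarrow> has_GKD C S"
  using Red_trivial[of S] unfolding has_GKD_def by blast

lemma GKD_spectrum_antimono: "C \<subseteq> C' \<Longrightarrow> GKD_spectrum C' T \<subseteq> GKD_spectrum C T"
  unfolding GKD_spectrum_def has_GKD_def by blast

text \<open>A pair in \<open>C\<close> at \<open>\<kappa>\<close> keeps a ball out of the spectrum.
  A pair outside \<open>C\<close> keeps a ball inside it: a point of the ball with another pair
  would contradict the common values on overlapping punctured discs.\<close>

lemma frontier_GKD_spectrum:
  assumes T: "bounded_clinear T"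
  shows "frontier (GKD_spectrum C T) \<subseteq> GKD_spectrum UNIV T"
proof
  fix \<kappa> assume fr: "\<kappa> \<in> frontier (GKD_spectrum C T)"
  show "\<kappa> \<in> GKD_spectrum UNIV T"
  proof (rule ccontr)
    assume "\<kappa> \<notin> GKD_spectrum UNIV T"
    then obtain M N where MN: "(M, N) \<in> Red (shift T \<kappa>)" "Kato M (shift T \<kappa>)" "quasinilpotent N (shift T \<kappa>)"
      by (auto simp: GKD_spectrum_def has_GKD_def)
    obtain r where r: "r > 0" "\<And>\<mu>. dist \<mu> \<kappa> < r \<Longrightarrow> \<mu> \<noteq> \<kappa> \<Longrightarrow> Kato UNIV (shift T \<mu>) \<and>
        nullity UNIV (shift T \<mu>) = nullity M (shift T \<kappa>) \<and> defect UNIV (shift T \<mu>) = defect M (shift T \<kappa>)"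
      by (rule GKD_punctured_neighbourhood[OF T MN]) (rule that)
    show False
    proof (cases "(nullity M (shift T \<kappa>), defect M (shift T \<kappa>)) \<in> C")
      case True
      have "\<mu> \<notin> GKD_spectrum C T" if "\<mu> \<in> ball \<kappa> r" for \<mu>
      proof (cases "\<mu> = \<kappa>")
        case True
        then show ?thesis using MN \<open>(nullity M (shift T \<kappa>), defect M (shift T \<kappa>)) \<in> C\<close>
          by (auto simp: GKD_spectrum_def has_GKD_def)
      next
        case False
        then show ?thesis
          using has_GKD_UNIV[OF bounded_clinear_shift[OF T]] r(2)[of \<mu>] that True
          by (auto simp: GKD_spectrum_def dist_commute)
      qed
      then have "ball \<kappa> r \<inter> closure (GKD_spectrum C T) = {}"
        by (subst open_Int_closure_eq_empty) auto
      moreover have "\<kappa> \<in> ball \<kappa> r" using r(1) by simp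
      moreover have "\<kappa> \<in> closure (GKD_spectrum C T)" using fr by (simp add: frontier_def)
      ultimately show False by blast
    next
      case False
      have "ball \<kappa> r \<subseteq> GKD_spectrum C T"
      proof
        fix \<mu> assume \<mu>: "\<mu> \<in> ball \<kappa> r"
        show "\<mu> \<in> GKD_spectrum C T"
        proof (rule ccontr)
          assume "\<mu> \<notin> GKD_spectrum C T"
          then obtain M' N' where MN': "(M', N') \<in> Red (shift T \<mu>)" "Kato M' (shift T \<mu>)"
            "quasinilpotent N' (shift T \<mu>)" and C: "(nullity M' (shift T \<mu>), defect M' (shift T \<mu>)) \<in> C"
            by (auto simp: GKD_spectrum_def has_GKD_def)
          obtain s where s: "s > 0" "\<And>\<nu>. dist \<nu> \<mu> < s \<Longrightarrow> \<nu> \<noteq> \<mu> \<Longrightarrow> Kato UNIV (shift T \<nu>) \<and>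
              nullity UNIV (shift T \<nu>) = nullity M' (shift T \<mu>) \<and> defect UNIV (shift T \<nu>) = defect M' (shift T \<mu>)"
            by (rule GKD_punctured_neighbourhood[OF T MN']) (rule that)
          have "\<mu> \<in> ball \<kappa> r \<inter> ball \<mu> s" using \<mu> s(1) by simp
          \<comment> \<open>A nonempty open set is infinite and thus contains a point off both
            centres. The case \<open>\<mu> = \<kappa>\<close> is included and compares two
            decompositions of the same operator.\<close>
          then have "infinite (ball \<kappa> r \<inter> ball \<mu> s)"
            using finite_imp_not_open[of "ball \<kappa> r \<inter> ball \<mu> s"] open_Int[OF open_ball open_ball] by blast
          then obtain \<nu> where "\<nu> \<in> ball \<kappa> r \<inter> ball \<mu> s" "\<nu> \<noteq> \<kappa>" "\<nu> \<noteq> \<mu>"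
            using infinite_imp_nonempty[of "ball \<kappa> r \<inter> ball \<mu> s - {\<kappa>, \<mu>}"] by fastforce
          then have "(nullity M (shift T \<kappa>), defect M (shift T \<kappa>)) = (nullity M' (shift T \<mu>), defect M' (shift T \<mu>))"
            using r(2)[of \<nu>] s(2)[of \<nu>] by (simp add: dist_commute)
          then show False using C False by simp
        qed
      qed
      then have "\<kappa> \<in> interior (GKD_spectrum C T)" using r(1) by (intro interiorI[of "ball \<kappa> r"]) auto
      then show False using fr by (simp add: frontier_def)
    qed
  qed
qed

text \<open>A larger \<open>C'\<close> gives a smaller spectrum, hence a smaller interior. A
  frontier point of the larger spectrum still belongs to the smaller one, because it belongs to the
  smallest of all.\<close>

lemma frontier_GKD_spectrum_mono:
  assumes T: "bounded_clinear T" and C: "C \<subseteq> C'"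
  shows "frontier (GKD_spectrum C T) \<subseteq> frontier (GKD_spectrum C' T)"
proof
  fix \<kappa> assume fr: "\<kappa> \<in> frontier (GKD_spectrum C T)"
  then have "\<kappa> \<in> GKD_spectrum UNIV T" using frontier_GKD_spectrum[OF T] by blast
  then have "\<kappa> \<in> closure (GKD_spectrum C' T)"
    using GKD_spectrum_antimono[of C' UNIV T] closure_subset by blast
  moreover have "\<kappa> \<notin> interior (GKD_spectrum C' T)"
    using fr interior_mono[OF GKD_spectrum_antimono[OF C, of T]] by (auto simp: frontier_def)
  ultimately show "\<kappa> \<in> frontier (GKD_spectrum C' T)" by (simp add: frontier_def)
qed

text \<open>For large \<open>\<mu>\<close> the shift is bijective, with pair \<open>(0, 0)\<close>.
  The approximate preimage \<open>(- 1 / \<mu>) *\<^sub>C y\<close> leaves the residual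
  \<open>T y\<close> divided by \<open>\<mu>\<close>; the radius \<open>2 * c\<close> is what halves
  it.\<close>

lemma bounded_GKD_spectrum:
  assumes T: "bounded_clinear T" and C: "(0, 0) \<in> C"
  shows "bounded (GKD_spectrum C T)"
proof -
  obtain c where c: "c > 0" "\<And>x. norm (T x) \<le> c * norm x" using bounded_clinear_bound[OF T] by blast
  have "has_GKD C (shift T \<mu>)" if \<mu>: "cmod \<mu> > 2 * c" for \<mu>
  proof -
    have \<mu>0: "\<mu> \<noteq> 0" using \<mu> c(1) by auto
    have U: "operator_on UNIV (shift T \<mu>)" by (simp add: operator_on_def bounded_clinear_shift[OF T])
    have "x = 0" if "shift T \<mu> x = 0" for x
    proof (rule ccontr)
      assume "x \<noteq> 0"
      have "T x = \<mu> *\<^sub>C x" using that by (simp add: shift_def)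
      then have "cmod \<mu> * norm x \<le> c * norm x" using c(2)[of x] by (simp add: norm_scaleC)
      then have "cmod \<mu> \<le> c" using \<open>x \<noteq> 0\<close> by simp
      then show False using \<mu> c(1) by simp
    qed
    then have ker: "{x \<in> UNIV. shift T \<mu> x = 0} = {0}" by (auto simp: shift_def bounded_clinear_0[OF T])
    have step: "\<exists>x\<in>UNIV. norm x \<le> (1 / cmod \<mu>) * norm y \<and> norm (y - shift T \<mu> x) \<le> norm y / 2 \<and> y - shift T \<mu> x \<in> UNIV" for y
    proof (intro bexI[of _ "(- 1 / \<mu>) *\<^sub>C y"] conjI UNIV_I)
      show "norm ((- 1 / \<mu>) *\<^sub>C y) \<le> (1 / cmod \<mu>) * norm y" by (simp add: norm_scaleC norm_divide)
      have "y - shift T \<mu> ((- 1 / \<mu>) *\<^sub>C y) = (1 / \<mu>) *\<^sub>C T y"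
        using \<mu>0 by (simp add: shift_def bounded_clinear_simps[OF T] scaleC_scaleC scaleC_one)
      then have "norm (y - shift T \<mu> ((- 1 / \<mu>) *\<^sub>C y)) = norm (T y) / cmod \<mu>" by (simp add: norm_scaleC norm_divide)
      also have "\<dots> \<le> c * norm y / cmod \<mu>" by (intro divide_right_mono c) simp
      also have "\<dots> \<le> norm y / 2"
        using mult_right_mono[OF less_imp_le[OF \<mu>] norm_ge_zero[of y]] \<mu>0 by (simp add: field_simps)
      finally show "norm (y - shift T \<mu> ((- 1 / \<mu>) *\<^sub>C y)) \<le> norm y / 2" .
    qed
    have "\<exists>x\<in>UNIV. shift T \<mu> x = y \<and> norm x \<le> 2 * (1 / cmod \<mu>) * norm y" for y
      by (rule successive_approximation[OF operator_on_bounded_linear[OF U] subspace_UNIV closed_UNIV _ step UNIV_I]) simp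
    then have onto: "range (shift T \<mu>) = UNIV" by (metis surj_def)
    show ?thesis
      using has_GKD_UNIV[OF bounded_clinear_shift[OF T] Kato_if_surjective[OF U onto]] C
        nullity_eq_0_iff[OF U] ker defect_eq_0_iff[OF U] onto by simp
  qed
  then have "GKD_spectrum C T \<subseteq> cball 0 (2 * c)" by (force simp: GKD_spectrum_def)
  then show ?thesis using bounded_cball bounded_subset by blast
qed

text \<open>An unbounded component of the complement of \<open>H\<close> is not contained in the
  bounded set \<open>K\<close> and cannot cross the frontier of \<open>K\<close>, which lies in
  \<open>H\<close>; hence it avoids \<open>K\<close>.\<close>

lemma outside_eq_if_frontier_subset:
  fixes H K :: "complex set"
  assumes "H \<subseteq> K" "bounded K" "frontier K \<subseteq> H"
  shows "outside H = outside K"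
proof
  show "outside K \<subseteq> outside H" by (rule outside_mono[OF assms(1)])
  show "outside H \<subseteq> outside K"
  proof
    fix x assume "x \<in> outside H"
    then have x: "x \<notin> H" "\<not> bounded (connected_component_set (- H) x)" by (auto simp: outside_def)
    let ?C = "connected_component_set (- H) x"
    have sub: "?C \<subseteq> - H" by (rule connected_component_subset)
    have "?C - K \<noteq> {}" using x(2) bounded_subset[OF assms(2)] by blast
    then have disj: "?C \<inter> K = {}"
      using connected_Int_frontier[OF connected_connected_component, of "- H" x K] sub assms(3) by blast
    have xC: "x \<in> ?C" using x(1) by (simp add: connected_component_refl)
    have "?C \<subseteq> connected_component_set (- K) x"
      by (rule connected_component_maximal[OF xC]) (use disj in auto)
    then have "\<not> bounded (connected_component_set (- K) x)" using x(2) bounded_subset by blast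
    moreover have "x \<notin> K" using disj xC by blast
    ultimately show "x \<in> outside K" by (simp add: outside_def)
  qed
qed

lemma connected_hull_GKD_spectrum:
  assumes T: "bounded_clinear T" and C: "(0, 0) \<in> C" "(0, 0) \<in> C'"
  shows "\<eta> (GKD_spectrum C T) = \<eta> (GKD_spectrum C' T)"
proof -
  have "outside (GKD_spectrum UNIV T) = outside (GKD_spectrum D T)" if "(0, 0) \<in> D" for D
    by (rule outside_eq_if_frontier_subset[OF GKD_spectrum_antimono[OF subset_UNIV]
        bounded_GKD_spectrum[OF T that] frontier_GKD_spectrum[OF T]])
  then show ?thesis using C unfolding connected_hull_def by metis
qed

section \<open>Operator classes as sets of pairs\<close>

text \<open>Separates the two directions: \<open>dec\<close> may replace the given decomposition by
  another one, while \<open>cls\<close> only concerns operators that are already Kato.\<close>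

lemma \<sigma>_gDR_eq_GKD_spectrum:
  assumes T: "bounded_clinear T"
    and dec: "\<And>S M N. bounded_clinear S \<Longrightarrow> (M, N) \<in> Red S \<Longrightarrow> quasinilpotent N S \<Longrightarrow> R M S \<Longrightarrow> has_GKD C S"
    and cls: "\<And>S M. operator_on M S \<Longrightarrow> Kato M S \<Longrightarrow> (nullity M S, defect M S) \<in> C \<Longrightarrow> R M S"
  shows "\<sigma>_gDR R T = GKD_spectrum C T"
proof -
  have "(\<exists>(M, N) \<in> Red S. R M S \<and> quasinilpotent N S) \<longleftrightarrow> has_GKD C S" if S: "bounded_clinear S" for S
  proof
    assume "\<exists>(M, N) \<in> Red S. R M S \<and> quasinilpotent N S"
    then show "has_GKD C S" using dec[OF S] by blast
  next
    assume "has_GKD C S"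
    then show "\<exists>(M, N) \<in> Red S. R M S \<and> quasinilpotent N S"
      unfolding has_GKD_def using cls Red_operator_on_left[OF S] by blast
  qed
  then show ?thesis unfolding \<sigma>_gDR_def GKD_spectrum_def using bounded_clinear_shift[OF T] by simp
qed

text \<open>Chain removal changes both entries by the same finite amount, so it preserves exactly
  what assumption \<open>C\<close> refers to: which entries are infinite, and their difference. By
  \<open>fin\<close> this difference is never infinity minus infinity.\<close>

lemma semi_Fredholm_has_GKD:
  assumes S: "bounded_clinear S" and red: "(M, N) \<in> Red S" and qn: "quasinilpotent N S"
    and cl: "closed (S ` M)" and fin: "nullity M S < \<infinity> \<or> defect M S < \<infinity>"
    and C: "\<And>a b. (a = \<infinity> \<longleftrightarrow> nullity M S = \<infinity>) \<Longrightarrow> (b = \<infinity> \<longleftrightarrow> defect M S = \<infinity>) \<Longrightarrow>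
      ereal_of_enat a - ereal_of_enat b = ind M S \<Longrightarrow> (a, b) \<in> C"
  shows "has_GKD C S"
proof -
  obtain M' N' k where *: "(M', N') \<in> Red S" "quasinilpotent N' S" "Kato M' S"
    "nullity M S = nullity M' S + enat k" "defect M S = defect M' S + enat k"
    by (rule Kato_decomposition[OF S red qn cl fin])
  have "(nullity M' S, defect M' S) \<in> C"
    by (rule C) (use fin in \<open>cases "nullity M' S"; cases "defect M' S"; simp add: ind_def *(4,5)\<close>)+
  then show ?thesis unfolding has_GKD_def using *(1-3) by blast
qed

lemma gDR_upper_semi_Fredholm:
  "bounded_clinear T \<Longrightarrow> \<sigma>_gDR upper_semi_Fredholm T = GKD_spectrum {(a, b). a < \<infinity>} T"
proof (rule \<sigma>_gDR_eq_GKD_spectrum)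
  fix S :: "'a \<Rightarrow> 'a" and M N
  assume "bounded_clinear S" "(M, N) \<in> Red S" "quasinilpotent N S" "upper_semi_Fredholm M S"
  then show "has_GKD {(a, b). a < \<infinity>} S"
    by (intro semi_Fredholm_has_GKD) (auto simp: upper_semi_Fredholm_def)
qed (auto simp: upper_semi_Fredholm_def Kato_def)

lemma gDR_lower_semi_Fredholm:
  "bounded_clinear T \<Longrightarrow> \<sigma>_gDR lower_semi_Fredholm T = GKD_spectrum {(a, b). b < \<infinity>} T"
proof (rule \<sigma>_gDR_eq_GKD_spectrum)
  fix S :: "'a \<Rightarrow> 'a" and M N
  assume "bounded_clinear S" "(M, N) \<in> Red S" "quasinilpotent N S" "lower_semi_Fredholm M S"
  then show "has_GKD {(a, b). b < \<infinity>} S"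
    by (intro semi_Fredholm_has_GKD finite_defect_closed_range Red_operator_on_left)
      (auto simp: lower_semi_Fredholm_def)
qed (auto simp: lower_semi_Fredholm_def)

lemma gDR_Fredholm:
  "bounded_clinear T \<Longrightarrow> \<sigma>_gDR Fredholm T = GKD_spectrum {(a, b). a < \<infinity> \<and> b < \<infinity>} T"
proof (rule \<sigma>_gDR_eq_GKD_spectrum)
  fix S :: "'a \<Rightarrow> 'a" and M N
  assume "bounded_clinear S" "(M, N) \<in> Red S" "quasinilpotent N S" "Fredholm M S"
  then show "has_GKD {(a, b). a < \<infinity> \<and> b < \<infinity>} S"
    by (intro semi_Fredholm_has_GKD finite_defect_closed_range Red_operator_on_left)
      (auto simp: Fredholm_def)
qed (auto simp: Fredholm_def)

lemma gDR_upper_semi_Weyl: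
  "bounded_clinear T \<Longrightarrow> \<sigma>_gDR upper_semi_Weyl T =
    GKD_spectrum {(a, b). a < \<infinity> \<and> ereal_of_enat a - ereal_of_enat b \<le> 0} T"
proof (rule \<sigma>_gDR_eq_GKD_spectrum)
  fix S :: "'a \<Rightarrow> 'a" and M N
  assume "bounded_clinear S" "(M, N) \<in> Red S" "quasinilpotent N S" "upper_semi_Weyl M S"
  then show "has_GKD {(a, b). a < \<infinity> \<and> ereal_of_enat a - ereal_of_enat b \<le> 0} S"
    by (intro semi_Fredholm_has_GKD)
      (auto simp: upper_semi_Weyl_def upper_semi_Fredholm_def ind_def)
qed (auto simp: upper_semi_Weyl_def upper_semi_Fredholm_def Kato_def ind_def)

lemma gDR_lower_semi_Weyl:
  "bounded_clinear T \<Longrightarrow> \<sigma>_gDR lower_semi_Weyl T =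
    GKD_spectrum {(a, b). b < \<infinity> \<and> ereal_of_enat a - ereal_of_enat b \<ge> 0} T"
proof (rule \<sigma>_gDR_eq_GKD_spectrum)
  fix S :: "'a \<Rightarrow> 'a" and M N
  assume "bounded_clinear S" "(M, N) \<in> Red S" "quasinilpotent N S" "lower_semi_Weyl M S"
  then show "has_GKD {(a, b). b < \<infinity> \<and> ereal_of_enat a - ereal_of_enat b \<ge> 0} S"
    by (intro semi_Fredholm_has_GKD finite_defect_closed_range Red_operator_on_left)
      (auto simp: lower_semi_Weyl_def lower_semi_Fredholm_def ind_def)
qed (auto simp: lower_semi_Weyl_def lower_semi_Fredholm_def ind_def)

lemma gDR_Weyl:
  "bounded_clinear T \<Longrightarrow> \<sigma>_gDR Weyl T =
    GKD_spectrum {(a, b). a < \<infinity> \<and> b < \<infinity> \<and> ereal_of_enat a - ereal_of_enat b = 0} T"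
proof (rule \<sigma>_gDR_eq_GKD_spectrum)
  fix S :: "'a \<Rightarrow> 'a" and M N
  assume "bounded_clinear S" "(M, N) \<in> Red S" "quasinilpotent N S" "Weyl M S"
  then show "has_GKD {(a, b). a < \<infinity> \<and> b < \<infinity> \<and> ereal_of_enat a - ereal_of_enat b = 0} S"
    by (intro semi_Fredholm_has_GKD finite_defect_closed_range Red_operator_on_left)
      (auto simp: Weyl_def Fredholm_def ind_def)
qed (auto simp: Weyl_def Fredholm_def ind_def)

text \<open>Closed range is part of being Kato, so for Kato operators only a condition on the
  nullity remains and the class becomes a set of pairs.\<close>

lemma bounded_below_iff:
  assumes S: "operator_on M S"
  shows "bounded_below M S \<longleftrightarrow> closed (S ` M) \<and> nullity M S = 0"
proof
  assume "bounded_below M S"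
  then obtain c where c: "c > 0" "\<And>x. x \<in> M \<Longrightarrow> c * norm x \<le> norm (S x)" unfolding bounded_below_def by blast
  have "norm x \<le> (1 / c) * norm (S x)" if "x \<in> M" for x using c(1) c(2)[OF that] by (simp add: field_simps)
  then have "closed (S ` M)"
    by (intro closed_image_if_bounded_preimages[OF operator_on_bounded_linear[OF S]
        operator_on_subspace[OF S] operator_on_closed[OF S], of "1 / c"]) blast
  moreover have "x = 0" if "x \<in> M" "S x = 0" for x
    using c(2)[OF that(1)] c(1) that(2) by (simp add: mult_le_0_iff)
  then have "{x \<in> M. S x = 0} = {0}"
    using complex_vector.subspace_0[OF operator_on_csubspace[OF S]] bounded_clinear_0[OF operator_on_clinear[OF S]] by auto
  ultimately show "closed (S ` M) \<and> nullity M S = 0" unfolding nullity_eq_0_iff[OF S] by blast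
next
  assume "closed (S ` M) \<and> nullity M S = 0"
  then have cl: "closed (S ` M)" and ker: "{x \<in> M. S x = 0} = {0}" unfolding nullity_eq_0_iff[OF S] by auto
  obtain K where K: "K > 0" "\<And>y. y \<in> S ` M \<Longrightarrow> \<exists>x\<in>M. S x = y \<and> norm x \<le> K * norm y"
    using closed_range_preimages[OF S cl] by metis
  have "1 / K * norm x \<le> norm (S x)" if x: "x \<in> M" for x
  proof -
    obtain z where z: "z \<in> M" "S z = S x" "norm z \<le> K * norm (S x)" using K(2) x by blast
    have "z - x \<in> {x \<in> M. S x = 0}"
      using complex_vector.subspace_diff[OF operator_on_csubspace[OF S] z(1) x] z(2)
      by (simp add: bounded_clinear_minus[OF operator_on_clinear[OF S]])
    then show ?thesis using ker z(3) K(1) by (simp add: field_simps)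
  qed
  then show "bounded_below M S" unfolding bounded_below_def using K(1) by (intro exI[of _ "1 / K"]) auto
qed

text \<open>An injective operator with closed range is already Kato, so the given decomposition
  serves unchanged. The surjective case is analogous.\<close>

lemma gDR_bounded_below:
  "bounded_clinear T \<Longrightarrow> \<sigma>_gDR bounded_below T = GKD_spectrum {(a, b). a = 0} T"
proof (rule \<sigma>_gDR_eq_GKD_spectrum)
  fix S :: "'a \<Rightarrow> 'a" and M N
  assume S: "bounded_clinear S" "(M, N) \<in> Red S" "quasinilpotent N S" "bounded_below M S"
  note M = Red_operator_on_left[OF S(1,2)]
  have *: "closed (S ` M)" "nullity M S = 0" using S(4) unfolding bounded_below_iff[OF M] by auto
  then have "Kato M S" by (intro Kato_if_injective[OF M]) (simp_all add: nullity_eq_0_iff[OF M])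
  then show "has_GKD {(a, b). a = 0} S" unfolding has_GKD_def using S * by blast
qed (auto simp: bounded_below_iff Kato_def)

lemma gDR_surjective:
  "bounded_clinear T \<Longrightarrow> \<sigma>_gDR surjective T = GKD_spectrum {(a, b). b = 0} T"
proof (rule \<sigma>_gDR_eq_GKD_spectrum)
  fix S :: "'a \<Rightarrow> 'a" and M N
  assume S: "bounded_clinear S" "(M, N) \<in> Red S" "quasinilpotent N S" "surjective M S"
  note M = Red_operator_on_left[OF S(1,2)]
  have onto: "S ` M = M" using S(4) by (simp add: surjective_def)
  then have "Kato M S" "defect M S = 0" using Kato_if_surjective[OF M] defect_eq_0_iff[OF M] by auto
  then show "has_GKD {(a, b). b = 0} S" unfolding has_GKD_def using S by blast
qed (auto simp: surjective_def defect_eq_0_iff)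

section \<open>Generalized Drazin inverses\<close>

text \<open>The idempotent is \<open>B\<close> after \<open>S\<close>. On its range \<open>B\<close>
  inverts \<open>S\<close>; on its kernel the assumed quasinilpotent operator is \<open>- S\<close>,
  and the sign disappears in norms.\<close>

lemma gen_Drazin_imp_has_GKD:
  assumes S: "bounded_clinear S" and gD: "gen_Drazin_invertible S"
  shows "has_GKD {(0, 0)} S"
proof -
  obtain B where B: "bounded_clinear B" "S \<circ> B = B \<circ> S" "B \<circ> S \<circ> B = B"
    and qn: "quasinilpotent UNIV (\<lambda>x. S (B (S x)) - S x)"
    using gD unfolding gen_Drazin_invertible_def by blast
  have SB: "S (B x) = B (S x)" and BSB: "B (S (B x)) = B x" for x
    using fun_cong[OF B(2), of x] fun_cong[OF B(3), of x] by auto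
  define E where "E = (\<lambda>x. B (S x))"
  have E: "bounded_clinear E" unfolding E_def by (rule bounded_clinear_compose[OF B(1) S])
  have EE: "E (E x) = E x" and ES: "E (S x) = S (E x)" for x
    by (simp add: E_def BSB) (simp add: E_def SB)
  let ?M = "{x. E x = x}" and ?N = "{x. E x = 0}"
  have red: "(?M, ?N) \<in> Red S" by (rule projection_Red[OF S E EE ES])
  note M = Red_operator_on_left[OF S red] and N = Red_operator_on_right[OF S red]
  have onto: "S ` ?M = ?M"
  proof
    show "?M \<subseteq> S ` ?M"
    proof
      fix x assume "x \<in> ?M"
      then have "x = S (B x)" by (simp add: E_def SB)
      moreover have "B x \<in> ?M" by (simp add: E_def BSB)
      ultimately show "x \<in> S ` ?M" by blast
    qed
  qed (rule range_subset[OF M])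
  have ker: "{x \<in> ?M. S x = 0} = {0}" using bounded_clinear_0[OF B(1)] bounded_clinear_0[OF S] by (auto simp: E_def)
  have "quasinilpotent ?N S"
  proof -
    let ?Q = "\<lambda>x. S (B (S x)) - S x"
    have Q: "bounded_clinear ?Q" 
      by (rule bounded_clinear_diff[OF bounded_clinear_compose[OF S bounded_clinear_compose[OF B(1) S]] S])
    have pow: "(?Q ^^ n) x = (- 1) ^ n *\<^sub>C (S ^^ n) x" if x: "x \<in> ?N" for n x
    proof (induction n)
      case (Suc n)
      have "E ((S ^^ n) x) = 0" using operator_on_in[OF operator_on_funpow[OF N] x] by simp
      then have "?Q ((S ^^ n) x) = - S ((S ^^ n) x)" by (simp add: E_def bounded_clinear_0[OF S])
      moreover have "(?Q ^^ Suc n) x = (- 1) ^ n *\<^sub>C ?Q ((S ^^ n) x)"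
        using Suc bounded_clinear_scale[OF Q] by simp
      ultimately show ?case by simp
    qed (simp add: scaleC_one)
    show ?thesis
    proof (rule quasinilpotent_dominated[OF Q UNIV_I S _ qn, of _ 0 1])
      show "0 \<in> ?N" by (simp add: bounded_clinear_0[OF E])
      fix n x assume "x \<in> ?N"
      then have "norm ((?Q ^^ n) x) = norm ((S ^^ n) x)" by (simp only: pow norm_scaleC) (simp add: norm_power)
      then show "\<exists>y\<in>UNIV. norm y \<le> 1 * norm x \<and> norm ((S ^^ n) x) \<le> norm ((?Q ^^ n) y)" by (intro bexI[of _ x]) auto
    qed
  qed
  moreover have "nullity ?M S = 0" unfolding nullity_eq_0_iff[OF M] by (rule ker)
  moreover have "defect ?M S = 0" unfolding defect_eq_0_iff[OF M] by (rule onto)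
  ultimately show ?thesis
    unfolding has_GKD_def
    by (intro exI[of _ ?M] exI[of _ ?N] conjI red Kato_if_surjective[OF M onto]) simp_all
qed

text \<open>\<open>B\<close> is the projection \<open>E\<close> onto \<open>M\<close> followed by
  the inverse of \<open>S\<close> there, and so is zero on \<open>N\<close>. The operator to be
  shown quasinilpotent is then \<open>- S (x - E x)\<close> at \<open>x\<close>, which sees only the
  component in \<open>N\<close>.\<close>

lemma has_GKD_imp_gen_Drazin:
  assumes S: "bounded_clinear S" and GKD: "has_GKD {(0, 0)} S"
  shows "gen_Drazin_invertible S"
proof -
  obtain M N where red: "(M, N) \<in> Red S" and qn: "quasinilpotent N S" and Ka: "Kato M S"
    and z: "nullity M S = 0" "defect M S = 0" using GKD by (auto simp: has_GKD_def)
  note M = Red_operator_on_left[OF S red] and N = Red_operator_on_right[OF S red]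
  note sM = operator_on_csubspace[OF M]
  have onto: "S ` M = M" and ker: "{x \<in> M. S x = 0} = {0}"
    using z nullity_eq_0_iff[OF M] defect_eq_0_iff[OF M] by auto
  obtain E where E: "bounded_clinear E" "\<And>x. E x \<in> M" "\<And>x. x - E x \<in> N" "\<And>x. x \<in> M \<Longrightarrow> E x = x"
    "\<And>x. x \<in> N \<Longrightarrow> E x = 0" "\<And>x. E (S x) = S (E x)" using Red_projection[OF S red] by metis
  obtain c where c: "c > 0" "\<And>x. c * norm x \<le> norm (S x) \<or> x \<notin> M"
    using z(1) Ka bounded_below_iff[OF M] unfolding Kato_def bounded_below_def by blast
  have inj: "x = y" if "x \<in> M" "y \<in> M" "S x = S y" for x y
  proof -
    have "x - y \<in> {x \<in> M. S x = 0}"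
      using complex_vector.subspace_diff[OF sM that(1,2)] that(3) by (simp add: bounded_clinear_minus[OF S])
    then show ?thesis using ker by simp
  qed
  have "\<exists>x. x \<in> M \<and> S x = E y" for y using E(2)[of y] onto by (metis imageE)
  then obtain B where B: "\<And>y. B y \<in> M" "\<And>y. S (B y) = E y" by metis
  obtain e where e: "e > 0" "\<And>x. norm (E x) \<le> e * norm x" using bounded_clinear_bound[OF E(1)] by blast
  have scale: "B (a *\<^sub>C x) = a *\<^sub>C B x" for a x
    by (rule inj) (simp_all add: B complex_vector.subspace_scale[OF sM] bounded_clinear_simps[OF S] bounded_clinear_simps[OF E(1)])
  have "bounded_linear B"
  proof (rule bounded_linear_intro)
    show "B (x + y) = B x + B y" for x y
      by (rule inj) (simp_all add: B complex_vector.subspace_add[OF sM] bounded_clinear_simps[OF S] bounded_clinear_simps[OF E(1)])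
    show "B (r *\<^sub>R x) = r *\<^sub>R B x" for r x using scale[of "complex_of_real r" x] by (simp add: scaleC_of_real)
    show "norm (B x) \<le> norm x * (e / c)" for x
    proof -
      have "c * norm (B x) \<le> e * norm x" using c(2)[of "B x"] e(2)[of x] B by fastforce
      then show ?thesis using c(1) by (simp add: field_simps)
    qed
  qed
  then have Bc: "bounded_clinear B" by (simp add: bounded_clinear_def scale)
  have BS: "B (S x) = E x" for x by (rule inj) (simp_all add: B E)
  have BE: "B (E x) = B x" for x by (rule inj) (simp_all add: B E)
  have qnQ: "quasinilpotent UNIV (\<lambda>x. S (B (S x)) - S x)"
  proof -
    let ?Q = "\<lambda>x. S (B (S x)) - S x"
    have Q: "bounded_clinear ?Q" 
      by (rule bounded_clinear_diff[OF bounded_clinear_compose[OF S bounded_clinear_compose[OF Bc S]] S])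
    have "bounded_clinear (\<lambda>x. x - E x)" by (intro bounded_clinear_diff bounded_clinear_ident E)
    then obtain d where d: "\<And>x. norm (x - E x) \<le> d * norm x" using bounded_clinear_bound by metis
    have Qx: "?Q x = - S (x - E x)" for x by (simp add: BS bounded_clinear_minus[OF S])
    \<comment> \<open>At exponent zero the left side is \<open>x\<close> and not
      \<open>x - E x\<close>, so the comparison starts at 1.\<close>
    have pow: "(?Q ^^ n) x = (- 1) ^ n *\<^sub>C (S ^^ n) (x - E x)" if "1 \<le> n" for n x
      using that
    proof (induction n rule: nat_induct_at_least)
      case base
      show ?case using Qx[of x] by (simp add: scaleC_one)
    next
      case (Suc n)
      have "E ((S ^^ n) (x - E x)) = 0" by (intro E(5) operator_on_in[OF operator_on_funpow[OF N]] E(3))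
      then have "?Q ((S ^^ n) (x - E x)) = - S ((S ^^ n) (x - E x))" unfolding Qx by simp
      moreover have "(?Q ^^ Suc n) x = (- 1) ^ n *\<^sub>C ?Q ((S ^^ n) (x - E x))"
        using Suc bounded_clinear_scale[OF Q] by simp
      ultimately show ?case by simp
    qed
    show ?thesis
    proof (rule quasinilpotent_dominated[OF S _ Q UNIV_I qn, of 1 d])
      show "0 \<in> N" by (rule complex_vector.subspace_0[OF operator_on_csubspace[OF N]])
      fix n x assume "1 \<le> (n::nat)"
      then have "norm ((?Q ^^ n) x) = norm ((S ^^ n) (x - E x))" by (simp only: pow norm_scaleC) (simp add: norm_power)
      then show "\<exists>y\<in>N. norm y \<le> d * norm x \<and> norm ((?Q ^^ n) x) \<le> norm ((S ^^ n) y)"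
        using d E(3) by (intro bexI[of _ "x - E x"]) auto
    qed
  qed
  show ?thesis
    unfolding gen_Drazin_invertible_def
    by (intro exI[of _ B] conjI Bc qnQ) (simp_all add: fun_eq_iff B BS BE)
qed

lemma \<sigma>_gD_eq_GKD_spectrum:
  assumes "bounded_clinear T"
  shows "\<sigma>_gD T = GKD_spectrum {(0, 0)} T"
  unfolding \<sigma>_gD_def GKD_spectrum_def
  using gen_Drazin_imp_has_GKD[OF bounded_clinear_shift[OF assms]]
    has_GKD_imp_gen_Drazin[OF bounded_clinear_shift[OF assms]] by blast

lemma \<sigma>_gK_eq_GKD_spectrum: "\<sigma>_gK T = GKD_spectrum UNIV T"
  unfolding \<sigma>_gK_def GKD_spectrum_def admits_GKD_def has_GKD_def by auto

theorem theorem4p6: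
  fixes T :: "'a::complex_banach \<Rightarrow> 'a"
  assumes "\<not> cfinite_dim (UNIV :: 'a set)"
    and "bounded_clinear T"
  shows
    "frontier (\<sigma>_gD T) \<subseteq> frontier (\<sigma>_gDR bounded_below T)
   \<and> frontier (\<sigma>_gDR bounded_below T) \<subseteq> frontier (\<sigma>_gDR upper_semi_Weyl T)
   \<and> frontier (\<sigma>_gDR upper_semi_Weyl T) \<subseteq> frontier (\<sigma>_gDR upper_semi_Fredholm T)
   \<and> frontier (\<sigma>_gDR upper_semi_Fredholm T) \<subseteq> frontier (\<sigma>_gK T)

   \<and> frontier (\<sigma>_gD T) \<subseteq> frontier (\<sigma>_gDR Weyl T)
   \<and> frontier (\<sigma>_gDR Weyl T) \<subseteq> frontier (\<sigma>_gDR Fredholm T)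
   \<and> frontier (\<sigma>_gDR Fredholm T) \<subseteq> frontier (\<sigma>_gK T)

   \<and> frontier (\<sigma>_gD T) \<subseteq> frontier (\<sigma>_gDR surjective T)
   \<and> frontier (\<sigma>_gDR surjective T) \<subseteq> frontier (\<sigma>_gDR lower_semi_Weyl T)
   \<and> frontier (\<sigma>_gDR lower_semi_Weyl T) \<subseteq> frontier (\<sigma>_gDR lower_semi_Fredholm T)
   \<and> frontier (\<sigma>_gDR lower_semi_Fredholm T) \<subseteq> frontier (\<sigma>_gK T)

   \<and> frontier (\<sigma>_gDR Fredholm T) \<subseteq> frontier (\<sigma>_gDR upper_semi_Fredholm T)
   \<and> frontier (\<sigma>_gDR Fredholm T) \<subseteq> frontier (\<sigma>_gDR lower_semi_Fredholm T)
   \<and> frontier (\<sigma>_gDR Weyl T) \<subseteq> frontier (\<sigma>_gDR upper_semi_Weyl T)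
   \<and> frontier (\<sigma>_gDR Weyl T) \<subseteq> frontier (\<sigma>_gDR lower_semi_Weyl T)

   \<and> \<eta> (\<sigma>_gK T) = \<eta> (\<sigma>_gDR upper_semi_Fredholm T)
   \<and> \<eta> (\<sigma>_gDR upper_semi_Fredholm T) = \<eta> (\<sigma>_gDR upper_semi_Weyl T)
   \<and> \<eta> (\<sigma>_gDR upper_semi_Weyl T) = \<eta> (\<sigma>_gDR bounded_below T)
   \<and> \<eta> (\<sigma>_gDR bounded_below T) = \<eta> (\<sigma>_gDR lower_semi_Fredholm T)
   \<and> \<eta> (\<sigma>_gDR lower_semi_Fredholm T) = \<eta> (\<sigma>_gDR lower_semi_Weyl T)
   \<and> \<eta> (\<sigma>_gDR lower_semi_Weyl T) = \<eta> (\<sigma>_gDR surjective T)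
   \<and> \<eta> (\<sigma>_gDR surjective T) = \<eta> (\<sigma>_gDR Fredholm T)
   \<and> \<eta> (\<sigma>_gDR Fredholm T) = \<eta> (\<sigma>_gDR Weyl T)
   \<and> \<eta> (\<sigma>_gDR Weyl T) = \<eta> (\<sigma>_gD T)"
  unfolding \<sigma>_gD_eq_GKD_spectrum[OF assms(2)] \<sigma>_gK_eq_GKD_spectrum
    gDR_bounded_below[OF assms(2)] gDR_surjective[OF assms(2)]
    gDR_upper_semi_Weyl[OF assms(2)] gDR_lower_semi_Weyl[OF assms(2)] gDR_Weyl[OF assms(2)]
    gDR_upper_semi_Fredholm[OF assms(2)] gDR_lower_semi_Fredholm[OF assms(2)] gDR_Fredholm[OF assms(2)]
  \<comment> \<open>What remains are inclusions between sets of pairs, and membership of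
    \<open>(0, 0)\<close> for the hulls. Nullity 0 makes the difference at most 0, and defect 0
    makes it at least 0.\<close>
  by (intro conjI frontier_GKD_spectrum_mono[OF assms(2)] connected_hull_GKD_spectrum[OF assms(2)])
    (auto simp: enat_0_iff)

end
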